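(* A $\mathbb Z^n$-module is finitely determined if and only if it admits one, and hence all, of the following: 1. a finite flange presentation; or 2. a finite flat presentation; or 3. a finite injective copresentation; or 4. a finite flat resolution; or 5. a finite injective resolution; or 6. a minimal one of any of the objects in items 1–5. Any minimal one of these objects is unique up to noncanonical isomorphism, and the resolutions have length at most $n$.
   Context: Fix a field $\Bbbk$. $\mathbb Z^n$ carries the componentwise partial order, with positive cone $\mathbb N^n$. A $\mathbb Z^n$-module is a module over this poset, equivalently a $\mathbb Z^n$-graded module over $\Bbbk[x_1,\dots,x_n]$. It is $\mathbb Z^n$-finite if all graded components have finite dimension. A $\mathbb Z^n$-finite module $N$ is finitely determined if for each $i=1,\dots,n$ the multiplication map $\cdot x_i:N_b\to N_{b+e_i}$ is an isomorphism whenever $b_i$ lies outside of some bounded interval. Injective and flat refer to the category of $\mathbb Z^n$-modules. Faces $\tau$ of $\mathbb N^n$ are the submonoids generated by subsets of the standard basis, $\mathbb Z\tau$ is the subgroup generated by $\tau$. The indecomposable injective modules are the modules $\Bbbk[b+\mathbb Z\tau-\mathbb N^n]$ and the ($\mathbb Z^n$-finite) indecomposable flat modules are the modules $\Bbbk[b+\mathbb Z\tau+\mathbb N^n]$, for $b\in\mathbb Z^n$ and faces $\tau$, where $\Bbbk[S]$ has $\Bbbk$ in degrees from $S$ and $0$ elsewhere with identity structure maps within $S$. Finite, for any of the objects below, means that the total number of indecomposable summands (of these forms) is finite. - A flange presentation of $N$ is a morphism $\varphi:F\to E$ with image isomorphic to $N$, with $F$ flat and $E$ injective; it is minimal if the numbers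 of indecomposable summands of $F$ and $E$ are simultaneously minimized. - A flat presentation expresses $N$ as the cokernel of a morphism $F_1\to F_0$ of flat modules; an injective copresentation expresses $N$ as the kernel of a morphism $E^0\to E^1$ of injective modules. - A flat cover is a surjection $F\to N$ with $F$ flat; an injective hull (in the sense used here) is an injection $N\to E$ with $E$ injective. Each is minimal if the number of indecomposable summands is minimal. - A flat resolution is a complex $F_\bullet$ of flat modules, with differential $F_{i+1}\to F_i$ for $i\ge0$, whose only nonzero homology is $H_0(F_\bullet)\cong N$; it is minimal if $F_0\to N$ and $F_{i+1}\to\ker(F_i\to F_{i-1})$ are all minimal flat covers. - An injective resolution is a complex $E^\bullet$ of injective modules, with differential $E^i\to E^{i+1}$ for $i\ge0$, whose only nonzero homology is $H^0(E^\bullet)\cong N$; it is minimal if $N\to E^0$ and $\operatorname{coker}(E^{i-1}\to E^i)\to E^{i+1}$ are all minimal injective hulls. - A minimal flat presentation or injective copresentation is one whose maps are likewise minimal flat covers (of $N$ and of $\ker(F_0\to N)$), respectively minimal injective hulls (of $N$ and of $\operatorname{coker}(N\to E^0)$). - A resolution has length $\ell$ if its term in degree $\ell$ is nonzero and those in degrees above $\ell$ vanish. *)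

theory Defs
  imports
    "HOL-Analysis.Analysis"
    "HOL-Library.Function_Algebras"
    "HOL-Computational_Algebra.Group_Closure"
begin

section \<open>Modules over the poset \<open>\<int>\<^sup>n\<close>\<close>

text \<open>
  The group \<open>\<int>\<^sup>n\<close> is the type \<open>int ^ 'n\<close>, so \<open>n = CARD('n)\<close>; its library order is the
  componentwise one.  The graded components of a module are linear subspaces of one ambient vector
  space \<open>'v\<close> (whose scalar multiplication is part of the data).  This is no restriction: any family
  of vector spaces embeds into its direct sum.  The components need not be independent in the
  ambient space, and maps are only relevant on the components.
\<close>

record ('k, 'v, 'n) zn_module =
  scl :: "'k \<Rightarrow> 'v \<Rightarrow> 'v"
  piece :: "int ^ 'n \<Rightarrow> 'v set"
  str :: "int ^ 'n \<Rightarrow> int ^ 'n \<Rightarrow> 'v \<Rightarrow> 'v"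

definition linear_between ::
  "('k::field \<Rightarrow> 'v \<Rightarrow> 'v) \<Rightarrow> ('k \<Rightarrow> 'w \<Rightarrow> 'w) \<Rightarrow> 'v::ab_group_add set \<Rightarrow> 'w::ab_group_add set
    \<Rightarrow> ('v \<Rightarrow> 'w) \<Rightarrow> bool" where
  "linear_between s t V W f \<longleftrightarrow>
     f ` V \<subseteq> W \<and>
     (\<forall>x\<in>V. \<forall>y\<in>V. f (x + y) = f x + f y) \<and>
     (\<forall>c. \<forall>x\<in>V. f (s c x) = t c (f x))"

definition is_zn_module :: "('k::field, 'v::ab_group_add, 'n::finite) zn_module \<Rightarrow> bool" where
  "is_zn_module M \<longleftrightarrow>
     vector_space (scl M) \<and>
     (\<forall>b. module.subspace (scl M) (piece M b)) \<and>
     (\<forall>b c. b \<le> c \<longrightarrow> linear_between (scl M) (scl M) (piece M b) (piece M c) (str M b c)) \<and>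
     (\<forall>b. \<forall>x\<in>piece M b. str M b b x = x) \<and>
     (\<forall>b c d. b \<le> c \<longrightarrow> c \<le> d \<longrightarrow> (\<forall>x\<in>piece M b. str M c d (str M b c x) = str M b d x))"

definition zn_hom ::
  "('k::field, 'v::ab_group_add, 'n::finite) zn_module \<Rightarrow> ('k, 'w::ab_group_add, 'n) zn_module
    \<Rightarrow> (int ^ 'n \<Rightarrow> 'v \<Rightarrow> 'w) \<Rightarrow> bool" where
  "zn_hom M N f \<longleftrightarrow>
     (\<forall>b. linear_between (scl M) (scl N) (piece M b) (piece N b) (f b)) \<and>
     (\<forall>b c. b \<le> c \<longrightarrow> (\<forall>x\<in>piece M b. f c (str M b c x) = str N b c (f b x)))"

definition zn_inj ::
  "('k, 'v, 'n::finite) zn_module \<Rightarrow> (int ^ 'n \<Rightarrow> 'v \<Rightarrow> 'w) \<Rightarrow> bool" where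
  "zn_inj M f \<longleftrightarrow> (\<forall>b. inj_on (f b) (piece M b))"

definition zn_surj ::
  "('k, 'v, 'n::finite) zn_module \<Rightarrow> ('k, 'w, 'n) zn_module \<Rightarrow> (int ^ 'n \<Rightarrow> 'v \<Rightarrow> 'w) \<Rightarrow> bool" where
  "zn_surj M N f \<longleftrightarrow> (\<forall>b. f b ` piece M b = piece N b)"

definition zn_iso ::
  "('k::field, 'v::ab_group_add, 'n::finite) zn_module \<Rightarrow> ('k, 'w::ab_group_add, 'n) zn_module
    \<Rightarrow> (int ^ 'n \<Rightarrow> 'v \<Rightarrow> 'w) \<Rightarrow> bool" where
  "zn_iso M N f \<longleftrightarrow> zn_hom M N f \<and> zn_inj M f \<and> zn_surj M N f"

definition zn_isomorphic ::
  "('k::field, 'v::ab_group_add, 'n::finite) zn_module \<Rightarrow> ('k, 'w::ab_group_add, 'n) zn_module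
    \<Rightarrow> bool" where
  "zn_isomorphic M N \<longleftrightarrow> (\<exists>f. zn_iso M N f)"

definition zero_module :: "('k, 'v::zero, 'n::finite) zn_module \<Rightarrow> bool" where
  "zero_module M \<longleftrightarrow> (\<forall>b. piece M b = {0})"

definition zn_kernel ::
  "('k, 'v, 'n::finite) zn_module \<Rightarrow> (int ^ 'n \<Rightarrow> 'v \<Rightarrow> 'w::zero) \<Rightarrow> ('k, 'v, 'n) zn_module" where
  "zn_kernel M f = M\<lparr>piece := \<lambda>b. {x \<in> piece M b. f b x = 0}\<rparr>"

definition zn_image ::
  "('k, 'v, 'n::finite) zn_module \<Rightarrow> ('k, 'w, 'n) zn_module \<Rightarrow> (int ^ 'n \<Rightarrow> 'v \<Rightarrow> 'w)
    \<Rightarrow> ('k, 'w, 'n) zn_module" where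
  "zn_image M N f = N\<lparr>piece := \<lambda>b. f b ` piece M b\<rparr>"

text \<open>Exactness of \<open>L \<longrightarrow> M \<longrightarrow> \<cdot>\<close> at \<open>M\<close>; this includes that the composite vanishes.\<close>

definition exact_at ::
  "('k, 'u, 'n::finite) zn_module \<Rightarrow> (int ^ 'n \<Rightarrow> 'u \<Rightarrow> 'v) \<Rightarrow> ('k, 'v, 'n) zn_module
    \<Rightarrow> (int ^ 'n \<Rightarrow> 'v \<Rightarrow> 'w::zero) \<Rightarrow> bool" where
  "exact_at L f M g \<longleftrightarrow> (\<forall>b. f b ` piece L b = {x \<in> piece M b. g b x = 0})"

text \<open>\<open>q: M \<longrightarrow> C\<close> is a cokernel of \<open>f: L \<longrightarrow> M\<close>.\<close>

definition is_cokernel ::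
  "('k::field, 'u::ab_group_add, 'n::finite) zn_module \<Rightarrow> ('k, 'v::ab_group_add, 'n) zn_module
    \<Rightarrow> (int ^ 'n \<Rightarrow> 'u \<Rightarrow> 'v) \<Rightarrow> ('k, 'w::ab_group_add, 'n) zn_module
    \<Rightarrow> (int ^ 'n \<Rightarrow> 'v \<Rightarrow> 'w) \<Rightarrow> bool" where
  "is_cokernel L M f C q \<longleftrightarrow>
     is_zn_module C \<and> zn_hom M C q \<and> zn_surj M C q \<and> exact_at L f M q"


section \<open>Finitely determined modules\<close>

definition zn_finite :: "('k::field, 'v::ab_group_add, 'n::finite) zn_module \<Rightarrow> bool" where
  "zn_finite M \<longleftrightarrow> (\<forall>b. \<exists>B. finite B \<and> module.span (scl M) B = piece M b)"

definition finitely_determined :: "('k::field, 'v::ab_group_add, 'n::finite) zn_module \<Rightarrow> bool" where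
  "finitely_determined M \<longleftrightarrow>
     zn_finite M \<and>
     (\<forall>i. \<exists>lo hi::int. \<forall>b. b $ i \<notin> {lo..hi} \<longrightarrow>
        bij_betw (str M b (b + axis i 1)) (piece M b) (piece M (b + axis i 1)))"


section \<open>Indecomposable flat and injective modules and their finite direct sums\<close>

definition pos_cone :: "(int ^ 'n::finite) set" where
  "pos_cone = {a. 0 \<le> a}"

text \<open>The face of the positive cone generated, as a submonoid, by the basis vectors indexed by \<open>T\<close>.\<close>

inductive_set face :: "'n set \<Rightarrow> (int ^ 'n::finite) set" for T where
  zero: "0 \<in> face T"
| add: "a \<in> face T \<Longrightarrow> i \<in> T \<Longrightarrow> a + axis i 1 \<in> face T"

definition flat_region :: "int ^ 'n \<Rightarrow> 'n::finite set \<Rightarrow> (int ^ 'n) set" where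
  "flat_region b T = {b + z + a | z a. z \<in> group_closure (face T) \<and> a \<in> pos_cone}"

definition injective_region :: "int ^ 'n \<Rightarrow> 'n::finite set \<Rightarrow> (int ^ 'n) set" where
  "injective_region b T = {b + z - a | z a. z \<in> group_closure (face T) \<and> a \<in> pos_cone}"

definition indicator_module :: "(int ^ 'n::finite) set \<Rightarrow> ('k::field, 'k, 'n) zn_module" where
  "indicator_module S =
     \<lparr>scl = (*),
      piece = (\<lambda>b. if b \<in> S then UNIV else {0}),
      str = (\<lambda>b c x. if b \<in> S \<and> c \<in> S then x else 0)\<rparr>"

text \<open>The direct sum of \<open>M 0, \<dots>, M (m - 1)\<close>; the ambient space is a full function space.\<close>

definition direct_sum ::
  "nat \<Rightarrow> (nat \<Rightarrow> ('k, 'v::zero, 'n::finite) zn_module) \<Rightarrow> ('k, nat \<Rightarrow> 'v, 'n) zn_module" where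
  "direct_sum m M =
     \<lparr>scl = (\<lambda>c x i. scl (M i) c (x i)),
      piece = (\<lambda>b. {x. (\<forall>i<m. x i \<in> piece (M i) b) \<and> (\<forall>i\<ge>m. x i = 0)}),
      str = (\<lambda>b c x i. if i < m then str (M i) b c (x i) else 0)\<rparr>"

text \<open>
  Only finite objects occur, so only flat and injective modules with finitely many indecomposable
  summands are needed.  The predicates below say that a module is flat (injective) with exactly
  \<open>m\<close> indecomposable summands.
\<close>

definition flat_summands ::
  "('k::field, 'v::ab_group_add, 'n::finite) zn_module \<Rightarrow> nat \<Rightarrow> bool" where
  "flat_summands F m \<longleftrightarrow>
     is_zn_module F \<and>
     (\<exists>b T. zn_isomorphic F
        (direct_sum m (\<lambda>i. indicator_module (flat_region (b i) (T i)) :: ('k, 'k, 'n) zn_module)))"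

definition injective_summands ::
  "('k::field, 'v::ab_group_add, 'n::finite) zn_module \<Rightarrow> nat \<Rightarrow> bool" where
  "injective_summands E m \<longleftrightarrow>
     is_zn_module E \<and>
     (\<exists>b T. zn_isomorphic E
        (direct_sum m (\<lambda>i. indicator_module (injective_region (b i) (T i)) :: ('k, 'k, 'n) zn_module)))"

definition finite_flat :: "('k::field, 'v::ab_group_add, 'n::finite) zn_module \<Rightarrow> bool" where
  "finite_flat F \<longleftrightarrow> (\<exists>m. flat_summands F m)"

definition finite_injective :: "('k::field, 'v::ab_group_add, 'n::finite) zn_module \<Rightarrow> bool" where
  "finite_injective E \<longleftrightarrow> (\<exists>m. injective_summands E m)"

text \<open>
  The ambient space \<open>nat \<Rightarrow> 'k\<close> contains a copy of every module with finitely many indecomposable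
  flat or injective summands, and of all its subquotients; existential quantifiers over modules
  (and the competitors in minimality conditions) range over this type without loss of generality.
\<close>

type_synonym ('k, 'n) std_module = "('k, nat \<Rightarrow> 'k, 'n) zn_module"


section \<open>Flat covers and injective hulls\<close>

definition flat_cover ::
  "('k::field, 'v::ab_group_add, 'n::finite) zn_module \<Rightarrow> ('k, 'f::ab_group_add, 'n) zn_module
    \<Rightarrow> (int ^ 'n \<Rightarrow> 'f \<Rightarrow> 'v) \<Rightarrow> bool" where
  "flat_cover N F p \<longleftrightarrow> finite_flat F \<and> zn_hom F N p \<and> zn_surj F N p"

definition minimal_flat_cover ::
  "('k::field, 'v::ab_group_add, 'n::finite) zn_module \<Rightarrow> ('k, 'f::ab_group_add, 'n) zn_module
    \<Rightarrow> (int ^ 'n \<Rightarrow> 'f \<Rightarrow> 'v) \<Rightarrow> bool" where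
  "minimal_flat_cover N F p \<longleftrightarrow>
     flat_cover N F p \<and>
     (\<exists>m. flat_summands F m \<and>
        (\<forall>(F' :: ('k, 'n) std_module) p' m'.
            flat_cover N F' p' \<and> flat_summands F' m' \<longrightarrow> m \<le> m'))"

definition injective_hull ::
  "('k::field, 'v::ab_group_add, 'n::finite) zn_module \<Rightarrow> ('k, 'e::ab_group_add, 'n) zn_module
    \<Rightarrow> (int ^ 'n \<Rightarrow> 'v \<Rightarrow> 'e) \<Rightarrow> bool" where
  "injective_hull N E j \<longleftrightarrow> finite_injective E \<and> zn_hom N E j \<and> zn_inj N j"

definition minimal_injective_hull ::
  "('k::field, 'v::ab_group_add, 'n::finite) zn_module \<Rightarrow> ('k, 'e::ab_group_add, 'n) zn_module
    \<Rightarrow> (int ^ 'n \<Rightarrow> 'v \<Rightarrow> 'e) \<Rightarrow> bool" where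
  "minimal_injective_hull N E j \<longleftrightarrow>
     injective_hull N E j \<and>
     (\<exists>m. injective_summands E m \<and>
        (\<forall>(E' :: ('k, 'n) std_module) j' m'.
            injective_hull N E' j' \<and> injective_summands E' m' \<longrightarrow> m \<le> m'))"

text \<open>\<open>g: M \<longrightarrow> E\<close> induces a minimal injective hull \<open>coker f \<longrightarrow> E\<close>, where \<open>f: L \<longrightarrow> M\<close>.\<close>

definition minimal_hull_of_cokernel ::
  "('k::field, 'u::ab_group_add, 'n::finite) zn_module \<Rightarrow> (int ^ 'n \<Rightarrow> 'u \<Rightarrow> 'v)
    \<Rightarrow> ('k, 'v::ab_group_add, 'n) zn_module \<Rightarrow> (int ^ 'n \<Rightarrow> 'v \<Rightarrow> 'e)
    \<Rightarrow> ('k, 'e::ab_group_add, 'n) zn_module \<Rightarrow> bool" where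
  "minimal_hull_of_cokernel L f M g E \<longleftrightarrow>
     (\<exists>(C :: ('k, 'n) std_module) q j.
        is_cokernel L M f C q \<and> minimal_injective_hull C E j \<and>
        (\<forall>b. \<forall>x\<in>piece M b. j b (q b x) = g b x))"


section \<open>Flange presentations\<close>

definition finite_flange_presentation ::
  "('k::field, 'v::ab_group_add, 'n::finite) zn_module \<Rightarrow> ('k, 'f::ab_group_add, 'n) zn_module
    \<Rightarrow> ('k, 'e::ab_group_add, 'n) zn_module \<Rightarrow> (int ^ 'n \<Rightarrow> 'f \<Rightarrow> 'e) \<Rightarrow> bool" where
  "finite_flange_presentation N F E \<phi> \<longleftrightarrow>
     finite_flat F \<and> finite_injective E \<and> zn_hom F E \<phi> \<and> zn_isomorphic (zn_image F E \<phi>) N"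

definition minimal_flange_presentation ::
  "('k::field, 'v::ab_group_add, 'n::finite) zn_module \<Rightarrow> ('k, 'f::ab_group_add, 'n) zn_module
    \<Rightarrow> ('k, 'e::ab_group_add, 'n) zn_module \<Rightarrow> (int ^ 'n \<Rightarrow> 'f \<Rightarrow> 'e) \<Rightarrow> bool" where
  "minimal_flange_presentation N F E \<phi> \<longleftrightarrow>
     finite_flange_presentation N F E \<phi> \<and>
     (\<exists>m p. flat_summands F m \<and> injective_summands E p \<and>
        (\<forall>(F' :: ('k, 'n) std_module) (E' :: ('k, 'n) std_module) \<phi>' m' p'.
            finite_flange_presentation N F' E' \<phi>' \<and> flat_summands F' m' \<and> injective_summands E' p'
            \<longrightarrow> m \<le> m' \<and> p \<le> p'))"

definition flange_isomorphic ::
  "('k::field, 'f::ab_group_add, 'n::finite) zn_module \<Rightarrow> ('k, 'e::ab_group_add, 'n) zn_module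
    \<Rightarrow> (int ^ 'n \<Rightarrow> 'f \<Rightarrow> 'e) \<Rightarrow> ('k, 'g::ab_group_add, 'n) zn_module
    \<Rightarrow> ('k, 'h::ab_group_add, 'n) zn_module \<Rightarrow> (int ^ 'n \<Rightarrow> 'g \<Rightarrow> 'h) \<Rightarrow> bool" where
  "flange_isomorphic F E \<phi> F' E' \<phi>' \<longleftrightarrow>
     (\<exists>\<alpha> \<beta>. zn_iso F F' \<alpha> \<and> zn_iso E E' \<beta> \<and>
        (\<forall>b. \<forall>x\<in>piece F b. \<beta> b (\<phi> b x) = \<phi>' b (\<alpha> b x)))"


section \<open>Flat presentations and injective copresentations\<close>

text \<open>
  The identification of the cokernel (kernel) with \<open>N\<close>, in the form of the augmentation
  \<open>\<epsilon>: F\<^sub>0 \<longrightarrow> N\<close> (respectively \<open>\<eta>: N \<longrightarrow> E\<^sup>0\<close>), is part of the data.  Isomorphisms of these objects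
  are isomorphisms over (under) \<open>N\<close>, that is, compatible with the augmentations.
\<close>

definition finite_flat_presentation ::
  "('k::field, 'v::ab_group_add, 'n::finite) zn_module \<Rightarrow> ('k, 'f::ab_group_add, 'n) zn_module
    \<Rightarrow> ('k, 'f, 'n) zn_module \<Rightarrow> (int ^ 'n \<Rightarrow> 'f \<Rightarrow> 'f) \<Rightarrow> (int ^ 'n \<Rightarrow> 'f \<Rightarrow> 'v) \<Rightarrow> bool" where
  "finite_flat_presentation N F\<^sub>1 F\<^sub>0 \<phi> \<epsilon> \<longleftrightarrow>
     finite_flat F\<^sub>1 \<and> finite_flat F\<^sub>0 \<and> zn_hom F\<^sub>1 F\<^sub>0 \<phi> \<and> is_cokernel F\<^sub>1 F\<^sub>0 \<phi> N \<epsilon>"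

definition minimal_flat_presentation ::
  "('k::field, 'v::ab_group_add, 'n::finite) zn_module \<Rightarrow> ('k, 'f::ab_group_add, 'n) zn_module
    \<Rightarrow> ('k, 'f, 'n) zn_module \<Rightarrow> (int ^ 'n \<Rightarrow> 'f \<Rightarrow> 'f) \<Rightarrow> (int ^ 'n \<Rightarrow> 'f \<Rightarrow> 'v) \<Rightarrow> bool" where
  "minimal_flat_presentation N F\<^sub>1 F\<^sub>0 \<phi> \<epsilon> \<longleftrightarrow>
     finite_flat_presentation N F\<^sub>1 F\<^sub>0 \<phi> \<epsilon> \<and>
     minimal_flat_cover N F\<^sub>0 \<epsilon> \<and>
     minimal_flat_cover (zn_kernel F\<^sub>0 \<epsilon>) F\<^sub>1 \<phi>"

definition flat_presentation_isomorphic ::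
  "('k::field, 'f::ab_group_add, 'n::finite) zn_module \<Rightarrow> ('k, 'f, 'n) zn_module
    \<Rightarrow> (int ^ 'n \<Rightarrow> 'f \<Rightarrow> 'f) \<Rightarrow> (int ^ 'n \<Rightarrow> 'f \<Rightarrow> 'v)
    \<Rightarrow> ('k, 'g::ab_group_add, 'n) zn_module \<Rightarrow> ('k, 'g, 'n) zn_module
    \<Rightarrow> (int ^ 'n \<Rightarrow> 'g \<Rightarrow> 'g) \<Rightarrow> (int ^ 'n \<Rightarrow> 'g \<Rightarrow> 'v) \<Rightarrow> bool" where
  "flat_presentation_isomorphic F\<^sub>1 F\<^sub>0 \<phi> \<epsilon> F\<^sub>1' F\<^sub>0' \<phi>' \<epsilon>' \<longleftrightarrow>
     (\<exists>\<alpha>\<^sub>1 \<alpha>\<^sub>0. zn_iso F\<^sub>1 F\<^sub>1' \<alpha>\<^sub>1 \<and> zn_iso F\<^sub>0 F\<^sub>0' \<alpha>\<^sub>0 \<and>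
        (\<forall>b. \<forall>x\<in>piece F\<^sub>1 b. \<alpha>\<^sub>0 b (\<phi> b x) = \<phi>' b (\<alpha>\<^sub>1 b x)) \<and>
        (\<forall>b. \<forall>x\<in>piece F\<^sub>0 b. \<epsilon> b x = \<epsilon>' b (\<alpha>\<^sub>0 b x)))"

definition finite_injective_copresentation ::
  "('k::field, 'v::ab_group_add, 'n::finite) zn_module \<Rightarrow> ('k, 'e::ab_group_add, 'n) zn_module
    \<Rightarrow> ('k, 'e, 'n) zn_module \<Rightarrow> (int ^ 'n \<Rightarrow> 'v \<Rightarrow> 'e) \<Rightarrow> (int ^ 'n \<Rightarrow> 'e \<Rightarrow> 'e) \<Rightarrow> bool" where
  "finite_injective_copresentation N E\<^sub>0 E\<^sub>1 \<eta> \<psi> \<longleftrightarrow>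
     finite_injective E\<^sub>0 \<and> finite_injective E\<^sub>1 \<and> zn_hom E\<^sub>0 E\<^sub>1 \<psi> \<and>
     zn_iso N (zn_kernel E\<^sub>0 \<psi>) \<eta>"

definition minimal_injective_copresentation ::
  "('k::field, 'v::ab_group_add, 'n::finite) zn_module \<Rightarrow> ('k, 'e::ab_group_add, 'n) zn_module
    \<Rightarrow> ('k, 'e, 'n) zn_module \<Rightarrow> (int ^ 'n \<Rightarrow> 'v \<Rightarrow> 'e) \<Rightarrow> (int ^ 'n \<Rightarrow> 'e \<Rightarrow> 'e) \<Rightarrow> bool" where
  "minimal_injective_copresentation N E\<^sub>0 E\<^sub>1 \<eta> \<psi> \<longleftrightarrow>
     finite_injective_copresentation N E\<^sub>0 E\<^sub>1 \<eta> \<psi> \<and>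
     minimal_injective_hull N E\<^sub>0 \<eta> \<and>
     minimal_hull_of_cokernel N \<eta> E\<^sub>0 \<psi> E\<^sub>1"

definition injective_copresentation_isomorphic ::
  "('k::field, 'v, 'n::finite) zn_module
    \<Rightarrow> ('k, 'e::ab_group_add, 'n) zn_module \<Rightarrow> ('k, 'e, 'n) zn_module
    \<Rightarrow> (int ^ 'n \<Rightarrow> 'v \<Rightarrow> 'e) \<Rightarrow> (int ^ 'n \<Rightarrow> 'e \<Rightarrow> 'e)
    \<Rightarrow> ('k, 'h::ab_group_add, 'n) zn_module \<Rightarrow> ('k, 'h, 'n) zn_module
    \<Rightarrow> (int ^ 'n \<Rightarrow> 'v \<Rightarrow> 'h) \<Rightarrow> (int ^ 'n \<Rightarrow> 'h \<Rightarrow> 'h) \<Rightarrow> bool" where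
  "injective_copresentation_isomorphic N E\<^sub>0 E\<^sub>1 \<eta> \<psi> E\<^sub>0' E\<^sub>1' \<eta>' \<psi>' \<longleftrightarrow>
     (\<exists>\<beta>\<^sub>0 \<beta>\<^sub>1. zn_iso E\<^sub>0 E\<^sub>0' \<beta>\<^sub>0 \<and> zn_iso E\<^sub>1 E\<^sub>1' \<beta>\<^sub>1 \<and>
        (\<forall>b. \<forall>x\<in>piece N b. \<beta>\<^sub>0 b (\<eta> b x) = \<eta>' b x) \<and>
        (\<forall>b. \<forall>x\<in>piece E\<^sub>0 b. \<beta>\<^sub>1 b (\<psi> b x) = \<psi>' b (\<beta>\<^sub>0 b x)))"


section \<open>Flat and injective resolutions\<close>

text \<open>
  The differential \<open>d i\<close> goes from \<open>F (i + 1)\<close> to \<open>F i\<close>, and \<open>\<epsilon>: F 0 \<longrightarrow> N\<close> identifies the zeroth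
  homology with \<open>N\<close>.  Finiteness bounds the total number of summands of all terms together.
\<close>

definition finite_flat_resolution ::
  "('k::field, 'v::ab_group_add, 'n::finite) zn_module \<Rightarrow> (nat \<Rightarrow> ('k, 'f::ab_group_add, 'n) zn_module)
    \<Rightarrow> (nat \<Rightarrow> int ^ 'n \<Rightarrow> 'f \<Rightarrow> 'f) \<Rightarrow> (int ^ 'n \<Rightarrow> 'f \<Rightarrow> 'v) \<Rightarrow> bool" where
  "finite_flat_resolution N F d \<epsilon> \<longleftrightarrow>
     (\<exists>m. (\<forall>i. flat_summands (F i) (m i)) \<and> finite {i. m i \<noteq> 0}) \<and>
     (\<forall>i. zn_hom (F (Suc i)) (F i) (d i)) \<and>
     (\<forall>i. exact_at (F (Suc (Suc i))) (d (Suc i)) (F (Suc i)) (d i)) \<and>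
     is_cokernel (F 1) (F 0) (d 0) N \<epsilon>"

definition minimal_flat_resolution ::
  "('k::field, 'v::ab_group_add, 'n::finite) zn_module \<Rightarrow> (nat \<Rightarrow> ('k, 'f::ab_group_add, 'n) zn_module)
    \<Rightarrow> (nat \<Rightarrow> int ^ 'n \<Rightarrow> 'f \<Rightarrow> 'f) \<Rightarrow> (int ^ 'n \<Rightarrow> 'f \<Rightarrow> 'v) \<Rightarrow> bool" where
  "minimal_flat_resolution N F d \<epsilon> \<longleftrightarrow>
     finite_flat_resolution N F d \<epsilon> \<and>
     minimal_flat_cover N (F 0) \<epsilon> \<and>
     minimal_flat_cover (zn_kernel (F 0) \<epsilon>) (F 1) (d 0) \<and>
     (\<forall>i. minimal_flat_cover (zn_kernel (F (Suc i)) (d i)) (F (Suc (Suc i))) (d (Suc i)))"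

definition flat_resolution_isomorphic ::
  "(nat \<Rightarrow> ('k::field, 'f::ab_group_add, 'n::finite) zn_module)
    \<Rightarrow> (nat \<Rightarrow> int ^ 'n \<Rightarrow> 'f \<Rightarrow> 'f) \<Rightarrow> (int ^ 'n \<Rightarrow> 'f \<Rightarrow> 'v)
    \<Rightarrow> (nat \<Rightarrow> ('k, 'g::ab_group_add, 'n) zn_module)
    \<Rightarrow> (nat \<Rightarrow> int ^ 'n \<Rightarrow> 'g \<Rightarrow> 'g) \<Rightarrow> (int ^ 'n \<Rightarrow> 'g \<Rightarrow> 'v) \<Rightarrow> bool" where
  "flat_resolution_isomorphic F d \<epsilon> F' d' \<epsilon>' \<longleftrightarrow>
     (\<exists>\<alpha>. (\<forall>i. zn_iso (F i) (F' i) (\<alpha> i)) \<and>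
        (\<forall>i b. \<forall>x\<in>piece (F (Suc i)) b. \<alpha> i b (d i b x) = d' i b (\<alpha> (Suc i) b x)) \<and>
        (\<forall>b. \<forall>x\<in>piece (F 0) b. \<epsilon> b x = \<epsilon>' b (\<alpha> 0 b x)))"

text \<open>Dually, \<open>d i\<close> goes from \<open>E i\<close> to \<open>E (i + 1)\<close>, with coaugmentation \<open>\<eta>: N \<longrightarrow> E 0\<close>.\<close>

definition finite_injective_resolution ::
  "('k::field, 'v::ab_group_add, 'n::finite) zn_module \<Rightarrow> (nat \<Rightarrow> ('k, 'e::ab_group_add, 'n) zn_module)
    \<Rightarrow> (nat \<Rightarrow> int ^ 'n \<Rightarrow> 'e \<Rightarrow> 'e) \<Rightarrow> (int ^ 'n \<Rightarrow> 'v \<Rightarrow> 'e) \<Rightarrow> bool" where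
  "finite_injective_resolution N E d \<eta> \<longleftrightarrow>
     (\<exists>m. (\<forall>i. injective_summands (E i) (m i)) \<and> finite {i. m i \<noteq> 0}) \<and>
     (\<forall>i. zn_hom (E i) (E (Suc i)) (d i)) \<and>
     (\<forall>i. exact_at (E i) (d i) (E (Suc i)) (d (Suc i))) \<and>
     zn_iso N (zn_kernel (E 0) (d 0)) \<eta>"

definition minimal_injective_resolution ::
  "('k::field, 'v::ab_group_add, 'n::finite) zn_module \<Rightarrow> (nat \<Rightarrow> ('k, 'e::ab_group_add, 'n) zn_module)
    \<Rightarrow> (nat \<Rightarrow> int ^ 'n \<Rightarrow> 'e \<Rightarrow> 'e) \<Rightarrow> (int ^ 'n \<Rightarrow> 'v \<Rightarrow> 'e) \<Rightarrow> bool" where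
  "minimal_injective_resolution N E d \<eta> \<longleftrightarrow>
     finite_injective_resolution N E d \<eta> \<and>
     minimal_injective_hull N (E 0) \<eta> \<and>
     minimal_hull_of_cokernel N \<eta> (E 0) (d 0) (E 1) \<and>
     (\<forall>i. minimal_hull_of_cokernel (E i) (d i) (E (Suc i)) (d (Suc i)) (E (Suc (Suc i))))"

definition injective_resolution_isomorphic ::
  "('k::field, 'v, 'n::finite) zn_module \<Rightarrow> (nat \<Rightarrow> ('k, 'e::ab_group_add, 'n) zn_module)
    \<Rightarrow> (nat \<Rightarrow> int ^ 'n \<Rightarrow> 'e \<Rightarrow> 'e) \<Rightarrow> (int ^ 'n \<Rightarrow> 'v \<Rightarrow> 'e)
    \<Rightarrow> (nat \<Rightarrow> ('k, 'h::ab_group_add, 'n) zn_module)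
    \<Rightarrow> (nat \<Rightarrow> int ^ 'n \<Rightarrow> 'h \<Rightarrow> 'h) \<Rightarrow> (int ^ 'n \<Rightarrow> 'v \<Rightarrow> 'h) \<Rightarrow> bool" where
  "injective_resolution_isomorphic N E d \<eta> E' d' \<eta>' \<longleftrightarrow>
     (\<exists>\<beta>. (\<forall>i. zn_iso (E i) (E' i) (\<beta> i)) \<and>
        (\<forall>b. \<forall>x\<in>piece N b. \<beta> 0 b (\<eta> b x) = \<eta>' b x) \<and>
        (\<forall>i b. \<forall>x\<in>piece (E i) b. \<beta> (Suc i) b (d i b x) = d' i b (\<beta> i b x)))"

definition has_length :: "(nat \<Rightarrow> ('k, 'v::zero, 'n::finite) zn_module) \<Rightarrow> nat \<Rightarrow> bool" where
  "has_length X l \<longleftrightarrow> \<not> zero_module (X l) \<and> (\<forall>i>l. zero_module (X i))"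

text \<open>The zero complex, a resolution of the zero module, has no length and satisfies every bound.\<close>

definition length_at_most :: "(nat \<Rightarrow> ('k, 'v::zero, 'n::finite) zn_module) \<Rightarrow> nat \<Rightarrow> bool" where
  "length_at_most X n \<longleftrightarrow> (\<forall>i. zero_module (X i)) \<or> (\<exists>l\<le>n. has_length X l)"

end

theory Submission
  imports Defs
begin

text \<open>
  Relative to a large box \<open>[-L, L]\<^sup>n\<close> a finitely determined module is the pullback of its restriction
  to the box along the clamping map, and flat modules become free modules over the box, with a
  generator on the lower boundary encoding an invariant direction. So flat covers behave like
  projective covers over a finite poset: the kernel of a cover with the least number of summands is
  killed by all maps to skyscrapers (otherwise a generator could be dropped), which gives
  uniqueness by a Nakayama argument. The length bound follows because a skyscraper has injective
  dimension at most \<open>n\<close>, while every generator in homological degree \<open>i\<close> of a minimal resolution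
  contributes to \<open>Ext\<^sup>i\<close> into a skyscraper. The injective half is obtained by Matlis duality, and
  a minimal flange presentation is a minimal flat cover followed by a minimal injective hull.
\<close>

section \<open>Linear algebra over a field\<close>

text \<open>A flat module with an invariant direction is in general not projective among all
  modules, so covers can be lifted only after everything in sight has been clamped to one common
  box. The radius \<open>L\<close> is therefore a parameter throughout, and lemmas that extract it
  yield every sufficiently large value, so that finitely many choices can be reconciled. A
  resolution has infinitely many terms and may at first need infinitely many radii; hence the Ext
  argument is run on a finite truncation, and finiteness of a constructed resolution is a
  consequence of the vanishing. Minimality is a bare count of summands over competitors in
  \<open>std_module\<close>. Duals live in function spaces and cokernels are not subspaces, so both
  have to be moved back into \<open>std_module\<close>: duals of flat modules through explicit
  indicator sums, cokernels through coordinates on quotient spaces.\<close>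

lemma linear_betweenD:
  assumes "linear_between s t V W f"
  shows "x \<in> V \<Longrightarrow> f x \<in> W"
    and "x \<in> V \<Longrightarrow> y \<in> V \<Longrightarrow> f (x + y) = f x + f y"
    and "x \<in> V \<Longrightarrow> f (s c x) = t c (f x)"
  using assms by (auto simp: linear_between_def)

text \<open>Module maps are linear on components only. Prescribing the values on a basis of
  \<open>V\<close> and extending over the ambient space gives a total linear map with the same
  restriction, to which the theory of \<open>Vector_Spaces.linear\<close> applies.\<close>

lemma linear_between_extend:
  fixes s :: "'k::field \<Rightarrow> 'v::ab_group_add \<Rightarrow> 'v" and t :: "'k \<Rightarrow> 'w::ab_group_add \<Rightarrow> 'w"
  assumes s: "vector_space s" and t: "vector_space t" and V: "module.subspace s V"
    and f: "linear_between s t V W f"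
  obtains f' where "Vector_Spaces.linear s t f'" "\<And>x. x \<in> V \<Longrightarrow> f' x = f x"
proof -
  interpret vector_space_pair s t using s t by (simp add: vector_space_pair_def)
  obtain B where B: "B \<subseteq> V" "vs1.independent B" "V \<subseteq> vs1.span B"
    using vs1.maximal_independent_subset[of V] by blast
  let ?g = "construct B f"
  have lin: "Vector_Spaces.linear s t ?g" by (rule linear_construct[OF B(2)])
  have "x \<in> V \<and> ?g x = f x" if "x \<in> vs1.span B" for x
    using that
  proof (induction rule: vs1.span_induct_alt)
    case base
    have "0 \<in> V" by (rule vs1.subspace_0[OF V])
    moreover have "f 0 = 0" using linear_betweenD(3)[OF f \<open>0 \<in> V\<close>, of 0] by simp
    ultimately show ?case using linear_0[OF lin] by simp
  next
    case (step c b y)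
    have b: "b \<in> V" using step B by blast
    have cb: "s c b \<in> V" using b vs1.subspace_scale[OF V] by blast
    show ?case
      using step b cb linear_betweenD[OF f] construct_basis[OF B(2), of b f] linear_add[OF lin]
        linear_scale[OF lin] vs1.subspace_add[OF V] by simp
  qed
  then show thesis using that lin B(3) by blast
qed

lemma vector_space_mult: "vector_space ((*) :: 'k::field \<Rightarrow> 'k \<Rightarrow> 'k)"
  by unfold_locales (simp_all add: algebra_simps)

lemma linear_betweenI_linear:
  assumes "Vector_Spaces.linear s t f" "f ` V \<subseteq> W"
  shows "linear_between s t V W f"
proof -
  interpret Vector_Spaces.linear s t f by fact
  show ?thesis using assms(2) by (auto simp: linear_between_def add scale)
qed

lemma subspace_linear_image:
  fixes s :: "'k::field \<Rightarrow> 'v::ab_group_add \<Rightarrow> 'v" and t :: "'k \<Rightarrow> 'w::ab_group_add \<Rightarrow> 'w"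
  assumes s: "vector_space s" and t: "vector_space t" and V: "module.subspace s V"
    and f: "linear_between s t V W f"
  shows "module.subspace t (f ` V)"
proof -
  obtain f' where f': "Vector_Spaces.linear s t f'" "\<And>x. x \<in> V \<Longrightarrow> f' x = f x"
    using linear_between_extend[OF assms] by blast
  interpret Vector_Spaces.linear s t f' by fact
  have "f ` V = f' ` V" using f' by force
  then show ?thesis using subspace_image[OF V] by simp
qed

lemma finite_span_linear_image:
  fixes s :: "'k::field \<Rightarrow> 'v::ab_group_add \<Rightarrow> 'v" and t :: "'k \<Rightarrow> 'w::ab_group_add \<Rightarrow> 'w"
  assumes s: "vector_space s" and t: "vector_space t" and V: "module.subspace s V"
    and f: "linear_between s t V W f" and B: "finite B" "module.span s B = V"
  shows "\<exists>C. finite C \<and> module.span t C = f ` V"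
proof -
  obtain f' where f': "Vector_Spaces.linear s t f'" "\<And>x. x \<in> V \<Longrightarrow> f' x = f x"
    using linear_between_extend[OF s t V f] by blast
  interpret Vector_Spaces.linear s t f' by fact
  have "f ` V = f' ` V" using f' by force
  then show ?thesis using span_image[of B] B by (metis finite_imageI)
qed

lemma finite_basis_subspace:
  assumes s: "vector_space s" and U: "module.subspace s U" "U \<subseteq> V"
    and B: "finite B" "module.span s B = V"
  obtains C where "finite C" "module.span s C = U" "\<not> module.dependent s C" "C \<subseteq> U"
proof -
  interpret vector_space s by fact
  obtain C where C: "C \<subseteq> U" "independent C" "U \<subseteq> span C"
    using maximal_independent_subset[of U] by blast
  have "finite C" using independent_span_bound[OF B(1) C(2)] C(1) U(2) B(2) by auto
  moreover have "span C = U" using span_subspace[OF C(1) C(3) U(1)] .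
  ultimately show thesis using that C by blast
qed

text \<open>A field is injective over itself: a functional killing the kernel of \<open>f\<close>
  descends to the image of \<open>f\<close> and then extends to the whole target space. This serves
  both the Ext computation and the exactness of duality.\<close>

lemma functional_factor:
  fixes s :: "'k::field \<Rightarrow> 'v::ab_group_add \<Rightarrow> 'v" and t :: "'k \<Rightarrow> 'w::ab_group_add \<Rightarrow> 'w"
  assumes s: "vector_space s" and t: "vector_space t" and V: "module.subspace s V"
    and f: "linear_between s t V W f" and phi: "linear_between s (*) V UNIV \<phi>"
    and ker: "\<And>x. x \<in> V \<Longrightarrow> f x = 0 \<Longrightarrow> \<phi> x = 0"
  obtains \<psi> where "Vector_Spaces.linear t (*) \<psi>" "\<And>x. x \<in> V \<Longrightarrow> \<psi> (f x) = \<phi> x"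
proof -
  interpret s: vector_space s by fact
  interpret t: vector_space t by fact
  have eq: "\<phi> x = \<phi> y" if "x \<in> V" "y \<in> V" "f x = f y" for x y
  proof -
    have d: "x - y \<in> V" using that s.subspace_diff[OF V] by blast
    have "f (x - y) = 0" "\<phi> (x - y) = \<phi> x - \<phi> y"
      using linear_betweenD(2)[OF f d that(2)] linear_betweenD(2)[OF phi d that(2)] that by simp_all
    then show ?thesis using ker[OF d] by simp
  qed
  define \<psi>0 where "\<psi>0 y = \<phi> (inv_into V f y)" for y
  have 0: "\<psi>0 (f x) = \<phi> x" if "x \<in> V" for x
    unfolding \<psi>0_def using that by (intro eq) (auto simp: inv_into_into f_inv_into_f)
  have "linear_between t (*) (f ` V) UNIV \<psi>0"
    unfolding linear_between_def
  proof (intro conjI ballI allI, blast)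
    fix x y c assume "x \<in> f ` V" "y \<in> f ` V"
    then obtain a b where ab: "a \<in> V" "b \<in> V" "x = f a" "y = f b" by blast
    have m: "a + b \<in> V" "s c a \<in> V" using ab s.subspace_add[OF V] s.subspace_scale[OF V] by auto
    show "\<psi>0 (x + y) = \<psi>0 x + \<psi>0 y"
      using ab 0 0[OF m(1)] linear_betweenD[OF f] linear_betweenD[OF phi] by simp
    show "\<psi>0 (t c x) = c * \<psi>0 x"
      using ab 0 0[OF m(2)] linear_betweenD[OF f] linear_betweenD[OF phi] by simp
  qed
  then obtain \<psi> where psi: "Vector_Spaces.linear t (*) \<psi>" "\<And>x. x \<in> f ` V \<Longrightarrow> \<psi> x = \<psi>0 x"
    using linear_between_extend[OF t vector_space_mult subspace_linear_image[OF s t V f]] by blast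
  show thesis using that[OF psi(1)] psi(2) 0 by auto
qed

text \<open>A basis of \<open>U\<close> stays independent when \<open>x\<close> is added, so a
  functional may vanish on the former and take the value 1 at \<open>x\<close>. It detects failures
  of surjectivity and shows that evaluation is injective.\<close>

lemma functional_separation:
  fixes s :: "'k::field \<Rightarrow> 'v::ab_group_add \<Rightarrow> 'v"
  assumes s: "vector_space s" and U: "module.subspace s U" and x: "x \<notin> U"
  obtains \<psi> where "Vector_Spaces.linear s (*) \<psi>" "\<And>y. y \<in> U \<Longrightarrow> \<psi> y = 0" "\<psi> x = 1"
proof -
  interpret vector_space_pair s "(*)" using s vector_space_mult by (simp add: vector_space_pair_def)
  obtain B where B: "B \<subseteq> U" "vs1.independent B" "U \<subseteq> vs1.span B"
    using vs1.maximal_independent_subset[of U] by blast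
  have sp: "vs1.span B = U" using vs1.span_subspace[OF B(1) B(3) U] .
  have ind: "vs1.independent (insert x B)" using vs1.independent_insertI[OF _ B(2)] sp x by blast
  let ?g = "construct (insert x B) (\<lambda>y. if y = x then 1 else 0)"
  have lin: "Vector_Spaces.linear s (*) ?g" by (rule linear_construct[OF ind])
  have xB: "x \<notin> B" using B x by blast
  have "?g y = 0" if "y \<in> B" for y
    using construct_basis[OF ind, of y] that xB by auto
  then have "?g y = 0" if "y \<in> U" for y
    using linear_eq_0_on_span[OF lin, of B y] that sp by blast
  moreover have "?g x = 1" using construct_basis[OF ind, of x] by simp
  ultimately show thesis using that lin by blast
qed

text \<open>The quotient of \<open>V\<close> by \<open>U\<close> is realised inside
  \<open>nat => 'k\<close>, so that cokernels can be kept in \<open>std_module\<close>: extend a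
  basis of \<open>U\<close> to one of \<open>V\<close>; the coordinates at the added basis vectors
  vanish exactly on \<open>U\<close>.\<close>

lemma quotient_coordinates:
  fixes s :: "'k::field \<Rightarrow> 'v::ab_group_add \<Rightarrow> 'v"
  assumes s: "vector_space s" and U: "module.subspace s U" and UV: "U \<subseteq> V"
    and V: "module.subspace s V" and B: "finite B" "module.span s B = V"
  obtains \<pi> :: "'v \<Rightarrow> nat \<Rightarrow> 'k"
  where "Vector_Spaces.linear s (\<lambda>c x i. c * x i) \<pi>" "\<And>x. x \<in> V \<Longrightarrow> \<pi> x = 0 \<longleftrightarrow> x \<in> U"
proof -
  interpret vector_space s by fact
  obtain C where C: "C \<subseteq> U" "independent C" "U \<subseteq> span C"
    using maximal_independent_subset[of U] by blast
  have sp: "span C = U" using span_subspace[OF C(1) C(3) U] .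
  obtain D where D: "C \<subseteq> D" "D \<subseteq> V" "independent D" "V \<subseteq> span D"
    using maximal_independent_subset_extend[of C V] C UV by blast
  have "finite D" using independent_span_bound[OF B(1) D(3)] D(2) B(2) by auto
  then obtain \<beta> and d :: nat where \<beta>: "D - C = \<beta> ` {i. i < d}"
    using finite_imp_nat_seg_image_inj_on[of "D - C"] by auto
  \<comment> \<open>The basis of \<open>V\<close> is completed to one of the whole space, so that
    its coordinate functions are linear everywhere; on \<open>V\<close> the further vectors
    contribute nothing.\<close>
  define E where "E = extend_basis D"
  have E: "independent E" "span E = UNIV" "D \<subseteq> E"
    unfolding E_def using D(3) independent_extend_basis span_extend_basis extend_basis_superset by auto
  define \<pi> :: "'v \<Rightarrow> nat \<Rightarrow> 'k" where "\<pi> x = (\<lambda>i. if i < d then representation E x (\<beta> i) else 0)" for x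
  have vs: "vector_space (\<lambda>c (x :: nat \<Rightarrow> 'k) i. c * x i)"
    by unfold_locales (auto simp: algebra_simps fun_eq_iff)
  have lin: "Vector_Spaces.linear s (\<lambda>c x i. c * x i) \<pi>"
    unfolding Vector_Spaces.linear_iff using E(1,2) s vs
    by (auto simp: \<pi>_def fun_eq_iff representation_add representation_scale)
  have "\<pi> x = 0 \<longleftrightarrow> x \<in> U" if "x \<in> V" for x
  proof
    assume "x \<in> U"
    then have "representation E x = representation C x"
      using representation_extend[OF E(1), of x C] sp C D E by auto
    moreover have "representation C x v = 0" if "v \<notin> C" for v
      using that representation_ne_zero[of C x v] by blast
    ultimately show "\<pi> x = 0" using \<beta> by (auto simp: \<pi>_def fun_eq_iff)
  next
    assume 0: "\<pi> x = 0"
    have xD: "x \<in> span D" using that D by blast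
    have r: "representation E x = representation D x"
      using representation_extend[OF E(1) xD E(3)] .
    have "representation D x v = 0" if "v \<in> D - C" for v
    proof -
      have "v \<in> \<beta> ` {i. i < d}" using that \<beta> by simp
      then obtain i where "i < d" "v = \<beta> i" by blast
      then show ?thesis using fun_cong[OF 0, of i] r by (simp add: \<pi>_def)
    qed
    then have "{v. representation D x v \<noteq> 0} \<subseteq> C" using representation_ne_zero[of D x] by blast
    then have "(\<Sum>v | representation D x v \<noteq> 0. s (representation D x v) v) \<in> span C"
      by (intro span_sum span_scale span_base) auto
    then show "x \<in> U" using sum_nonzero_representation_eq[OF D(3) xD] sp by simp
  qed
  then show thesis using that lin by blast
qed

section \<open>Homomorphisms, kernels, images and quotients\<close>

lemma zn_moduleD:
  assumes "is_zn_module M"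
  shows "vector_space (scl M)"
    and "module.subspace (scl M) (piece M b)"
    and "b \<le> c \<Longrightarrow> linear_between (scl M) (scl M) (piece M b) (piece M c) (str M b c)"
    and "x \<in> piece M b \<Longrightarrow> str M b b x = x"
    and "b \<le> c \<Longrightarrow> c \<le> d \<Longrightarrow> x \<in> piece M b \<Longrightarrow> str M c d (str M b c x) = str M b d x"
  using assms by (simp_all add: is_zn_module_def)

lemmas zn_vector_space = zn_moduleD(1) and zn_subspace = zn_moduleD(2)
  and zn_str_linear = zn_moduleD(3) and str_id = zn_moduleD(4) and str_comp = zn_moduleD(5)

lemma zn_piece:
  assumes M: "is_zn_module M"
  shows "0 \<in> piece M b"
    and "x \<in> piece M b \<Longrightarrow> y \<in> piece M b \<Longrightarrow> x + y \<in> piece M b"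
    and "x \<in> piece M b \<Longrightarrow> y \<in> piece M b \<Longrightarrow> x - y \<in> piece M b"
    and "x \<in> piece M b \<Longrightarrow> scl M a x \<in> piece M b"
    and "(\<And>i. i \<in> I \<Longrightarrow> g i \<in> piece M b) \<Longrightarrow> sum g I \<in> piece M b"
proof -
  interpret vector_space "scl M" by (rule zn_vector_space[OF M])
  note s = zn_subspace[OF M, of b]
  show "0 \<in> piece M b"
    and "x \<in> piece M b \<Longrightarrow> y \<in> piece M b \<Longrightarrow> x + y \<in> piece M b"
    and "x \<in> piece M b \<Longrightarrow> y \<in> piece M b \<Longrightarrow> x - y \<in> piece M b"
    and "x \<in> piece M b \<Longrightarrow> scl M a x \<in> piece M b"
    and "(\<And>i. i \<in> I \<Longrightarrow> g i \<in> piece M b) \<Longrightarrow> sum g I \<in> piece M b"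
    using subspace_0[OF s] subspace_add[OF s] subspace_diff[OF s] subspace_scale[OF s]
      subspace_sum[OF s] by blast+
qed

lemma linear_between_zero:
  assumes "linear_between s t V W f" "0 \<in> V"
  shows "f (0::'v::ab_group_add) = (0::'w::ab_group_add)"
proof -
  have "f (0 + 0) = f 0 + f 0" by (rule linear_betweenD(2)[OF assms(1)]) fact+
  then show ?thesis by simp
qed

lemma linear_between_diff:
  assumes "linear_between s t V W f" "x - y \<in> V" "y \<in> V"
  shows "f (x - y) = f x - (f y::'w::ab_group_add)"
  using linear_betweenD(2)[OF assms] by simp

lemma zn_str:
  assumes M: "is_zn_module M" and bc: "b \<le> c"
  shows "x \<in> piece M b \<Longrightarrow> str M b c x \<in> piece M c"
    and "x \<in> piece M b \<Longrightarrow> y \<in> piece M b \<Longrightarrow> str M b c (x + y) = str M b c x + str M b c y"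
    and "x \<in> piece M b \<Longrightarrow> y \<in> piece M b \<Longrightarrow> str M b c (x - y) = str M b c x - str M b c y"
    and "x \<in> piece M b \<Longrightarrow> str M b c (scl M a x) = scl M a (str M b c x)"
    and "str M b c 0 = 0"
  using linear_betweenD[OF zn_str_linear[OF M bc]] linear_between_diff[OF zn_str_linear[OF M bc]]
    linear_between_zero[OF zn_str_linear[OF M bc]] zn_piece[OF M] by auto

lemma zn_homD:
  assumes "zn_hom M N f"
  shows "linear_between (scl M) (scl N) (piece M b) (piece N b) (f b)"
    and "b \<le> c \<Longrightarrow> x \<in> piece M b \<Longrightarrow> f c (str M b c x) = str N b c (f b x)"
  using assms by (auto simp: zn_hom_def)

lemmas hom_linear = zn_homD(1) and hom_nat = zn_homD(2)

lemma zn_hom_apply: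
  assumes M: "is_zn_module M" and f: "zn_hom M N f"
  shows "x \<in> piece M b \<Longrightarrow> f b x \<in> piece N b"
    and "x \<in> piece M b \<Longrightarrow> y \<in> piece M b \<Longrightarrow> f b (x + y) = f b x + f b y"
    and "x \<in> piece M b \<Longrightarrow> y \<in> piece M b \<Longrightarrow> f b (x - y) = f b x - f b y"
    and "x \<in> piece M b \<Longrightarrow> f b (scl M a x) = scl N a (f b x)"
    and "f b 0 = 0"
  using linear_betweenD[OF hom_linear[OF f]] linear_between_diff[OF hom_linear[OF f]]
    linear_between_zero[OF hom_linear[OF f]] zn_piece[OF M] by auto

lemma zn_hom_sum:
  assumes M: "is_zn_module M" and f: "zn_hom M N f" and "\<And>i. i \<in> I \<Longrightarrow> g i \<in> piece M b"
  shows "f b (sum g I) = (\<Sum>i\<in>I. f b (g i))"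
  using assms(3)
proof (induction I rule: infinite_finite_induct)
  case (insert i I)
  then show ?case using zn_hom_apply(2)[OF M f, of "g i" b "sum g I"] zn_piece(5)[OF M, of I g b]
    by simp
qed (auto simp: zn_hom_apply(5)[OF M f])

lemma zn_homI:
  assumes "\<And>b x. x \<in> piece M b \<Longrightarrow> f b x \<in> piece N b"
    and "\<And>b x y. x \<in> piece M b \<Longrightarrow> y \<in> piece M b \<Longrightarrow> f b (x + y) = f b x + f b y"
    and "\<And>b x a. x \<in> piece M b \<Longrightarrow> f b (scl M a x) = scl N a (f b x)"
    and "\<And>b c x. b \<le> c \<Longrightarrow> x \<in> piece M b \<Longrightarrow> f c (str M b c x) = str N b c (f b x)"
  shows "zn_hom M N f"
  using assms by (auto simp: zn_hom_def linear_between_def)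

lemma zn_hom_comp:
  assumes "zn_hom M N f" "zn_hom N P g"
  shows "zn_hom M P (\<lambda>b x. g b (f b x))"
  using assms by (fastforce simp: zn_hom_def linear_between_def image_subset_iff)

lemma zn_hom_cong:
  assumes M: "is_zn_module M" and "zn_hom M N f" "\<And>b x. x \<in> piece M b \<Longrightarrow> g b x = f b x"
  shows "zn_hom M N g"
  using assms zn_piece[OF M] zn_str(1)[OF M] by (simp add: zn_hom_def linear_between_def image_subset_iff)

lemma zn_hom_diff:
  assumes M: "is_zn_module M" and N: "is_zn_module N" and f: "zn_hom M N f" and g: "zn_hom M N g"
  shows "zn_hom M N (\<lambda>b x. f b x - g b x)"
proof -
  interpret N: vector_space "scl N" by (rule zn_vector_space[OF N])
  show ?thesis
    using zn_hom_apply[OF M f] zn_hom_apply[OF M g] hom_nat[OF f] hom_nat[OF g] zn_piece[OF N] zn_str[OF N]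
    by (intro zn_homI) (simp_all add: N.scale_right_diff_distrib)
qed

lemma zn_isoI:
  assumes "zn_hom M N f" "\<And>b. bij_betw (f b) (piece M b) (piece N b)"
  shows "zn_iso M N f"
  using assms by (auto simp: zn_iso_def zn_inj_def zn_surj_def bij_betw_def)

lemma zn_isoD:
  assumes "zn_iso M N f"
  shows "zn_hom M N f" "bij_betw (f b) (piece M b) (piece N b)"
    "x \<in> piece M b \<Longrightarrow> y \<in> piece M b \<Longrightarrow> f b x = f b y \<longleftrightarrow> x = y"
  using assms by (auto simp: zn_iso_def zn_inj_def zn_surj_def bij_betw_def inj_on_def)

lemma zn_iso_refl: "zn_iso M M (\<lambda>b x. x)"
  by (auto simp: zn_iso_def zn_hom_def linear_between_def zn_inj_def zn_surj_def)

lemma zn_iso_trans: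
  assumes "zn_iso M N f" "zn_iso N P g"
  shows "zn_iso M P (\<lambda>b x. g b (f b x))"
  using assms zn_hom_comp[of M N f P g] bij_betw_trans[OF zn_isoD(2)[OF assms(1)] zn_isoD(2)[OF assms(2)]]
  by (intro zn_isoI) (auto simp: zn_iso_def o_def)

lemma zn_iso_inverse:
  assumes M: "is_zn_module M" and f: "zn_iso M N f"
  obtains g where "zn_iso N M g" "\<And>b x. x \<in> piece M b \<Longrightarrow> g b (f b x) = x"
    "\<And>b y. y \<in> piece N b \<Longrightarrow> f b (g b y) = y"
proof -
  note h = zn_isoD(1)[OF f] and bij = zn_isoD(2)[OF f]
  define g where "g b = inv_into (piece M b) (f b)" for b
  have bg: "bij_betw (g b) (piece N b) (piece M b)" for b
    unfolding g_def using bij by (rule bij_betw_inv_into)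
  have gf: "g b (f b x) = x" if "x \<in> piece M b" for b x
    unfolding g_def using bij_betw_inv_into_left[OF bij that] .
  have fg: "f b (g b y) = y" if "y \<in> piece N b" for b y
    unfolding g_def using bij_betw_inv_into_right[OF bij that] .
  have gin: "g b y \<in> piece M b" if "y \<in> piece N b" for b y
    using bg that by (meson bij_betwE)
  have "zn_hom N M g"
  proof (rule zn_homI)
    fix b c :: "int ^ 'c" and x y a
    assume x: "x \<in> piece N b"
    show "g b x \<in> piece M b" by (rule gin[OF x])
    show "g b (x + y) = g b x + g b y" if y: "y \<in> piece N b"
      using gf[of "g b x + g b y" b] zn_hom_apply(2)[OF M h gin gin, OF x y] fg[OF x] fg[OF y]
        zn_piece(2)[OF M gin gin, OF x y] by simp
    show "g b (scl N a x) = scl M a (g b x)"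
      using gf[of "scl M a (g b x)" b] zn_hom_apply(4)[OF M h gin, OF x, of a] fg[OF x]
        zn_piece(4)[OF M gin, OF x] by simp
    show "g c (str N b c x) = str M b c (g b x)" if bc: "b \<le> c"
      using gf[of "str M b c (g b x)" c] hom_nat[OF h bc gin[OF x]] fg[OF x] zn_str(1)[OF M bc gin[OF x]]
      by simp
  qed
  then show thesis using that zn_isoI[OF _ bg] gf fg by blast
qed

lemma zn_isomorphic_sym:
  assumes "is_zn_module M" "zn_isomorphic M N"
  shows "zn_isomorphic N M"
  using assms zn_iso_inverse unfolding zn_isomorphic_def by metis

lemma zn_isomorphic_trans:
  assumes "zn_isomorphic M N" "zn_isomorphic N P"
  shows "zn_isomorphic M P"
  using assms zn_iso_trans unfolding zn_isomorphic_def by blast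

text \<open>Stability of the kernels under the structure maps makes the induced maps on the images
  independent of the chosen preimages. The maps in different degrees are otherwise unrelated, so
  they may be chosen degree by degree.\<close>

lemma quotient_module:
  fixes t :: "'k::field \<Rightarrow> 'w::ab_group_add \<Rightarrow> 'w"
  assumes M: "is_zn_module M" and t: "vector_space t"
    and lin: "\<And>b. linear_between (scl M) t (piece M b) UNIV (\<pi> b)"
    and ker: "\<And>b c x. b \<le> c \<Longrightarrow> x \<in> piece M b \<Longrightarrow> \<pi> b x = 0 \<Longrightarrow> \<pi> c (str M b c x) = 0"
  obtains C where "is_zn_module C" "scl C = t" "\<And>b. piece C b = \<pi> b ` piece M b"
    "zn_hom M C \<pi>" "zn_surj M C \<pi>"
proof -
  define C where "C = \<lparr>scl = t, piece = \<lambda>b. \<pi> b ` piece M b,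
    str = \<lambda>b c y. \<pi> c (str M b c (inv_into (piece M b) (\<pi> b) y))\<rparr>"
  have sC: "scl C = t" and pC: "piece C b = \<pi> b ` piece M b" for b by (simp_all add: C_def)
  note L = linear_betweenD[OF lin]
  have str: "str C b c (\<pi> b x) = \<pi> c (str M b c x)" if bc: "b \<le> c" and x: "x \<in> piece M b" for b c x
  proof -
    let ?x = "inv_into (piece M b) (\<pi> b) (\<pi> b x)"
    have m: "?x \<in> piece M b" "\<pi> b ?x = \<pi> b x"
      using x by (auto simp: inv_into_into f_inv_into_f)
    have "\<pi> b (?x - x) = 0" using linear_between_diff[OF lin, of ?x x b] zn_piece(3)[OF M m(1) x] x m by simp
    then have "\<pi> c (str M b c (?x - x)) = 0" using ker[OF bc zn_piece(3)[OF M m(1) x]] by simp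
    then have "\<pi> c (str M b c ?x) - \<pi> c (str M b c x) = 0"
      using zn_str(1,3)[OF M bc] m x linear_between_diff[OF lin, of "str M b c ?x" "str M b c x" c]
        zn_piece(3)[OF M] by simp
    then show ?thesis by (simp add: C_def)
  qed
  have "is_zn_module C"
    unfolding is_zn_module_def
  proof (intro conjI allI impI ballI)
    show "vector_space (scl C)" using t sC by simp
    show "module.subspace (scl C) (piece C b)" for b
      unfolding sC pC by (rule subspace_linear_image[OF zn_vector_space[OF M] t zn_subspace[OF M] lin])
    show "linear_between (scl C) (scl C) (piece C b) (piece C c) (str C b c)" if bc: "b \<le> c" for b c
      unfolding linear_between_def pC sC ball_simps image_subset_iff
    proof (intro conjI ballI allI)
      fix x y a assume xy: "x \<in> piece M b" "y \<in> piece M b"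
      note m = zn_str(1)[OF M bc xy(1)] zn_str(1)[OF M bc xy(2)]
      show "str C b c (\<pi> b x) \<in> \<pi> c ` piece M c" using str[OF bc xy(1)] m by simp
      show "str C b c (\<pi> b x + \<pi> b y) = str C b c (\<pi> b x) + str C b c (\<pi> b y)"
        using str[OF bc xy(1)] str[OF bc xy(2)] str[OF bc zn_piece(2)[OF M xy]] L(2)[OF xy] L(2)[OF m]
          zn_str(2)[OF M bc xy] by simp
      show "str C b c (t a (\<pi> b x)) = t a (str C b c (\<pi> b x))"
        using str[OF bc xy(1)] str[OF bc zn_piece(4)[OF M xy(1), of a]] L(3)[OF xy(1), of a]
          L(3)[OF m(1), of a] zn_str(4)[OF M bc xy(1), of a] by simp
    qed
    fix b c d x assume "x \<in> piece C b"
    then obtain y where y: "y \<in> piece M b" "x = \<pi> b y" by (auto simp: pC)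
    show "str C b b x = x" using y str[of b b] str_id[OF M] by simp
    show "str C c d (str C b c x) = str C b d x" if "b \<le> c" "c \<le> d"
      using y str that order_trans[OF that] str_comp[OF M that] zn_str(1)[OF M that(1)] by simp
  qed
  moreover have "zn_hom M C \<pi>"
    using L str by (intro zn_homI) (auto simp: pC sC)
  moreover have "zn_surj M C \<pi>" by (simp add: zn_surj_def pC)
  ultimately show thesis using that sC pC by blast
qed

lemma zn_kernel_simps [simp]:
  "scl (zn_kernel M f) = scl M" "str (zn_kernel M f) = str M"
  "piece (zn_kernel M f) b = {x \<in> piece M b. f b x = 0}"
  by (simp_all add: zn_kernel_def)

lemma zn_image_simps [simp]:
  "scl (zn_image M N f) = scl N" "str (zn_image M N f) = str N"
  "piece (zn_image M N f) b = f b ` piece M b"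
  by (simp_all add: zn_image_def)

lemma zn_submodule:
  assumes N: "is_zn_module N" and "scl S = scl N" "str S = str N"
    and "\<And>b. piece S b \<subseteq> piece N b" "\<And>b. module.subspace (scl N) (piece S b)"
    and "\<And>b c x. b \<le> c \<Longrightarrow> x \<in> piece S b \<Longrightarrow> str N b c x \<in> piece S c"
  shows "is_zn_module S"
  unfolding is_zn_module_def
proof (intro conjI allI impI ballI)
  show "vector_space (scl S)" "module.subspace (scl S) (piece S b)" for b
    using assms zn_vector_space[OF N] by simp_all
  show "linear_between (scl S) (scl S) (piece S b) (piece S c) (str S b c)" if bc: "b \<le> c" for b c
    unfolding linear_between_def using bc assms(2-4,6) zn_str(2,4)[OF N bc] by (auto simp: subset_iff)
  fix b c d x assume x: "x \<in> piece S b"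
  show "str S b b x = x" using str_id[OF N] assms(3,4) x by auto
  show "str S c d (str S b c x) = str S b d x" if "b \<le> c" "c \<le> d"
    using str_comp[OF N that] assms(3,4) x by auto
qed

lemma zn_module_kernel:
  assumes M: "is_zn_module M" and N: "is_zn_module N" and f: "zn_hom M N f"
  shows "is_zn_module (zn_kernel M f)"
proof (rule zn_submodule[OF M])
  interpret M: vector_space "scl M" by (rule zn_vector_space[OF M])
  interpret N: vector_space "scl N" by (rule zn_vector_space[OF N])
  show "M.subspace (piece (zn_kernel M f) b)" for b
    unfolding M.subspace_def using zn_piece[OF M] zn_hom_apply[OF M f] by auto
  show "str M b c x \<in> piece (zn_kernel M f) c" if "b \<le> c" "x \<in> piece (zn_kernel M f) b" for b c x
    using that zn_str[OF M that(1)] zn_str[OF N that(1)] hom_nat[OF f that(1)] by auto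
qed auto

lemma zn_module_image:
  assumes M: "is_zn_module M" and N: "is_zn_module N" and f: "zn_hom M N f"
  shows "is_zn_module (zn_image M N f)"
proof (rule zn_submodule[OF N])
  show "piece (zn_image M N f) b \<subseteq> piece N b" for b using zn_hom_apply(1)[OF M f] by auto
  show "module.subspace (scl N) (piece (zn_image M N f) b)" for b
    using subspace_linear_image[OF zn_vector_space[OF M] zn_vector_space[OF N] zn_subspace[OF M] hom_linear[OF f]]
    by simp
  show "str N b c x \<in> piece (zn_image M N f) c" if "b \<le> c" "x \<in> piece (zn_image M N f) b" for b c x
    using that zn_str(1)[OF M that(1)] hom_nat[OF f that(1)] by (force simp: image_iff)
qed auto

lemma zn_hom_kernel:
  assumes "zn_hom M N f" shows "zn_hom (zn_kernel M g) N f"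
  using assms by (simp add: zn_hom_def linear_between_def image_subset_iff)

lemma zn_hom_into_kernel:
  assumes "zn_hom M N f" "\<And>b x. x \<in> piece M b \<Longrightarrow> g b (f b x) = 0"
  shows "zn_hom M (zn_kernel N g) f"
  using assms by (simp add: zn_hom_def linear_between_def image_subset_iff)

lemma zn_hom_from_kernel:
  assumes "zn_hom M (zn_kernel N g) f"
  shows "zn_hom M N f"
  using assms by (simp add: zn_hom_def linear_between_def image_subset_iff)

lemma zn_hom_descend:
  assumes M: "is_zn_module M" and C: "is_zn_module C" and q: "zn_hom M C q" "zn_surj M C q"
    and P: "is_zn_module P" and f: "zn_hom M P f"
    and ker: "\<And>b x. x \<in> piece M b \<Longrightarrow> q b x = 0 \<Longrightarrow> f b x = 0"
  obtains g where "zn_hom C P g" "\<And>b x. x \<in> piece M b \<Longrightarrow> g b (q b x) = f b x"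
proof -
  define g where "g b y = f b (inv_into (piece M b) (q b) y)" for b y
  have sur: "q b ` piece M b = piece C b" for b using q(2) by (auto simp: zn_surj_def)
  have eq: "f b x = f b y" if "x \<in> piece M b" "y \<in> piece M b" "q b x = q b y" for b x y
    using ker[of "x - y" b] that zn_hom_apply(3)[OF M q(1), of x b y] zn_hom_apply(3)[OF M f, of x b y]
      zn_piece(3)[OF M] by simp
  have g: "g b (q b x) = f b x" if "x \<in> piece M b" for b x
    unfolding g_def using that by (intro eq) (auto simp: inv_into_into f_inv_into_f)
  have "zn_hom C P g"
  proof (rule zn_homI)
    fix b c :: "int ^ 'c" and x y a
    assume "x \<in> piece C b"
    then obtain u where u: "u \<in> piece M b" "x = q b u" using sur by blast
    show "g b x \<in> piece P b" using u g zn_hom_apply(1)[OF M f] by simp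
    show "g b (x + y) = g b x + g b y" if y: "y \<in> piece C b"
    proof -
      obtain v where v: "v \<in> piece M b" "y = q b v" using sur y by blast
      show ?thesis using u v g g[OF zn_piece(2)[OF M u(1) v(1)]] zn_hom_apply(2)[OF M f u(1) v(1)]
        zn_hom_apply(2)[OF M q(1) u(1) v(1)] by simp
    qed
    show "g b (scl C a x) = scl P a (g b x)"
      using u g g[OF zn_piece(4)[OF M u(1)]] zn_hom_apply(4)[OF M f u(1)] zn_hom_apply(4)[OF M q(1) u(1)]
      by metis
    show "g c (str C b c x) = str P b c (g b x)" if bc: "b \<le> c"
      using u g g[OF zn_str(1)[OF M bc u(1)]] hom_nat[OF f bc u(1)] hom_nat[OF q(1) bc u(1)] by simp
  qed
  then show thesis using that g by blast
qed

section \<open>Closure properties of finitely determined modules and clamping to a box\<close>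

text \<open>The half-open condition singles out, for \<open>0 \<le> L\<close>, exactly the unit
  steps in direction \<open>i\<close> whose two ends have the same \<open>i\<close>-th coordinate
  after clamping to \<open>[-L, L]\<close>. A single symmetric radius makes bounds for several
  modules comparable.\<close>

definition determined_in :: "int \<Rightarrow> ('k::field, 'v::ab_group_add, 'n::finite) zn_module \<Rightarrow> bool" where
  "determined_in L M \<longleftrightarrow> (\<forall>i b. b $ i < - L \<or> L \<le> b $ i \<longrightarrow>
     bij_betw (str M b (b + axis i 1)) (piece M b) (piece M (b + axis i 1)))"

lemma determined_in_mono: "determined_in L M \<Longrightarrow> L \<le> L' \<Longrightarrow> determined_in L' M"
  unfolding determined_in_def by (meson less_le_trans neg_le_iff_le order_trans)

lemma le_add_axis: "(b :: int ^ 'n::finite) \<le> b + axis i 1"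
  by (simp add: less_eq_vec_def axis_def)

lemma finitely_determined_iff:
  "finitely_determined M \<longleftrightarrow> zn_finite M \<and> (\<exists>L\<ge>0. determined_in L M)"
proof
  assume M: "finitely_determined M"
  then obtain lo hi :: "'c \<Rightarrow> int" where lh: "\<And>i b. b $ i \<notin> {lo i..hi i} \<Longrightarrow>
        bij_betw (str M b (b + axis i 1)) (piece M b) (piece M (b + axis i 1))"
    unfolding finitely_determined_def by metis
  \<comment> \<open>One radius serves all coordinates; the added 1 makes the estimate strict, so
    that a coordinate equal to \<open>L\<close> already exceeds \<open>hi i\<close>.\<close>
  define L where "L = (\<Sum>i\<in>UNIV. \<bar>lo i\<bar> + \<bar>hi i\<bar>) + 1"
  have "\<bar>lo i\<bar> + \<bar>hi i\<bar> < L" for i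
    unfolding L_def using member_le_sum[of i UNIV "\<lambda>i. \<bar>lo i\<bar> + \<bar>hi i\<bar>"] by auto
  then have "b $ i \<notin> {lo i..hi i}" if "b $ i < - L \<or> L \<le> b $ i" for i b
    using that by (smt (verit) atLeastAtMost_iff)
  then have "determined_in L M" using lh unfolding determined_in_def by blast
  moreover have "L \<ge> 0" unfolding L_def by (simp add: sum_nonneg)
  ultimately show "zn_finite M \<and> (\<exists>L\<ge>0. determined_in L M)"
    using M by (auto simp: finitely_determined_def)
next
  assume "zn_finite M \<and> (\<exists>L\<ge>0. determined_in L M)"
  then obtain L where "zn_finite M" and L: "determined_in L M" by blast
  moreover have "bij_betw (str M b (b + axis i 1)) (piece M b) (piece M (b + axis i 1))"
    if "b $ i \<notin> {- L..L - 1}" for i b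
    using L that unfolding determined_in_def by (smt (verit) atLeastAtMost_iff)
  ultimately show "finitely_determined M"
    unfolding finitely_determined_def by blast
qed

lemma finitely_determinedE:
  assumes "finitely_determined M"
  obtains L where "L \<ge> 0" "\<And>L'. L' \<ge> L \<Longrightarrow> determined_in L' M"
  using assms finitely_determined_iff determined_in_mono by blast

lemma zn_finite_kernel:
  assumes M: "is_zn_module M" and N: "is_zn_module N" and f: "zn_hom M N f" and "zn_finite M"
  shows "zn_finite (zn_kernel M f)"
  unfolding zn_finite_def
proof
  fix b
  obtain B where "finite B" "module.span (scl M) B = piece M b" using assms unfolding zn_finite_def by blast
  moreover have "module.subspace (scl M) {x \<in> piece M b. f b x = 0}"
    using zn_subspace[OF zn_module_kernel[OF M N f], of b] by simp
  ultimately obtain C where "finite C" "module.span (scl M) C = {x \<in> piece M b. f b x = 0}"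
    using finite_basis_subspace[OF zn_vector_space[OF M], of _ "piece M b" B] by (metis (lifting) mem_Collect_eq subsetI)
  then show "\<exists>B. finite B \<and> module.span (scl (zn_kernel M f)) B = piece (zn_kernel M f) b"
    by auto
qed

lemma zn_finite_surj:
  assumes M: "is_zn_module M" and N: "is_zn_module N" and f: "zn_hom M N f" "zn_surj M N f" and "zn_finite M"
  shows "zn_finite N"
  unfolding zn_finite_def
proof
  fix b
  obtain B where "finite B" "module.span (scl M) B = piece M b" using assms unfolding zn_finite_def by blast
  then show "\<exists>B. finite B \<and> module.span (scl N) B = piece N b"
    using finite_span_linear_image[OF zn_vector_space[OF M] zn_vector_space[OF N] zn_subspace[OF M] hom_linear[OF f(1)]]
      f(2) unfolding zn_surj_def by metis
qed

text \<open>A diagram chase: the structure map of \<open>M\<close> restricts to the kernels, and a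
  preimage of a kernel element is again in the kernel because the structure map of \<open>N\<close>
  is injective.\<close>

lemma determined_in_kernel:
  fixes M :: "('k::field, 'v::ab_group_add, 'n::finite) zn_module"
  assumes M: "is_zn_module M" and N: "is_zn_module N" and f: "zn_hom M N f"
    and d: "determined_in L M" "determined_in L N"
  shows "determined_in L (zn_kernel M f)"
  unfolding determined_in_def
proof (intro allI impI)
  fix i :: 'n and b :: "int ^ 'n" assume b: "b $ i < - L \<or> L \<le> b $ i"
  let ?c = "b + axis i 1"
  have bM: "bij_betw (str M b ?c) (piece M b) (piece M ?c)"
    and bN: "bij_betw (str N b ?c) (piece N b) (piece N ?c)"
    using d b unfolding determined_in_def by blast+
  have *: "f b x = 0" if "x \<in> piece M b" "f ?c (str M b ?c x) = 0" for x
  proof (rule inj_onD[OF bij_betw_imp_inj_on[OF bN]])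
    show "str N b ?c (f b x) = str N b ?c 0"
      using that hom_nat[OF f le_add_axis that(1), of i] zn_str(5)[OF N le_add_axis] by simp
  qed (use that zn_hom_apply(1)[OF M f] zn_piece(1)[OF N] in auto)
  have **: "f ?c (str M b ?c x) = 0" if "x \<in> piece M b" "f b x = 0" for x
    using that hom_nat[OF f le_add_axis that(1), of i] zn_str(5)[OF N le_add_axis] by simp
  show "bij_betw (str (zn_kernel M f) b ?c) (piece (zn_kernel M f) b) (piece (zn_kernel M f) ?c)"
  proof (simp, intro bij_betw_imageI)
    show "inj_on (str M b ?c) {x \<in> piece M b. f b x = 0}"
      using bM inj_on_subset unfolding bij_betw_def by fastforce
    have "x \<in> str M b ?c ` {x \<in> piece M b. f b x = 0}" if x: "x \<in> piece M ?c" "f ?c x = 0" for x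
    proof -
      obtain y where y: "y \<in> piece M b" "x = str M b ?c y"
        using x(1) bM unfolding bij_betw_def by blast
      then show ?thesis using x(2) * by blast
    qed
    then show "str M b ?c ` {x \<in> piece M b. f b x = 0} = {x \<in> piece M ?c. f ?c x = 0}"
      using ** zn_str(1)[OF M le_add_axis] by blast
  qed
qed

lemma determined_in_image:
  fixes M :: "('k::field, 'v::ab_group_add, 'n::finite) zn_module"
  assumes M: "is_zn_module M" and N: "is_zn_module N" and f: "zn_hom M N f"
    and d: "determined_in L M" "determined_in L N"
  shows "determined_in L (zn_image M N f)"
  unfolding determined_in_def
proof (intro allI impI)
  fix i :: 'n and b :: "int ^ 'n" assume b: "b $ i < - L \<or> L \<le> b $ i"
  let ?c = "b + axis i 1"
  have bM: "str M b ?c ` piece M b = piece M ?c" and bN: "inj_on (str N b ?c) (piece N b)"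
    using d b unfolding determined_in_def bij_betw_def by blast+
  have "str N b ?c ` f b ` piece M b = f ?c ` str M b ?c ` piece M b"
    using hom_nat[OF f le_add_axis] by (force simp: image_iff)
  moreover have "f b ` piece M b \<subseteq> piece N b" using zn_hom_apply(1)[OF M f] by auto
  ultimately show "bij_betw (str (zn_image M N f) b ?c) (piece (zn_image M N f) b) (piece (zn_image M N f) ?c)"
    using bM bN inj_on_subset by (auto simp: bij_betw_def)
qed

text \<open>For injectivity on the quotient, a difference that becomes a relation after the step is
  then the image of an element of \<open>K\<close>; surjectivity in \<open>K\<close> pulls that
  element back, and injectivity in \<open>M\<close> shows that the difference was a relation
  already.\<close>

lemma determined_in_cokernel:
  fixes M :: "('k::field, 'v::ab_group_add, 'n::finite) zn_module"
  assumes K: "is_zn_module K" and M: "is_zn_module M" and f: "zn_hom K M f" and C: "is_cokernel K M f C q"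
    and d: "determined_in L K" "determined_in L M"
  shows "determined_in L C"
  unfolding determined_in_def
proof (intro allI impI)
  fix i :: 'n and b :: "int ^ 'n" assume b: "b $ i < - L \<or> L \<le> b $ i"
  let ?c = "b + axis i 1"
  have bK: "bij_betw (str K b ?c) (piece K b) (piece K ?c)" and bM: "bij_betw (str M b ?c) (piece M b) (piece M ?c)"
    using d b unfolding determined_in_def by blast+
  have q: "is_zn_module C" "zn_hom M C q" "\<And>b. q b ` piece M b = piece C b"
    and ex: "\<And>b. f b ` piece K b = {x \<in> piece M b. q b x = 0}"
    using C by (auto simp: is_cokernel_def zn_surj_def exact_at_def)
  have "str C b ?c ` q b ` piece M b = q ?c ` str M b ?c ` piece M b"
    using hom_nat[OF q(2) le_add_axis] by (force simp: image_iff)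
  then have sur: "str C b ?c ` piece C b = piece C ?c"
    using q(3) bM by (simp add: bij_betw_def)
  have "inj_on (str C b ?c) (piece C b)"
  proof (rule inj_onI)
    fix u v assume "u \<in> piece C b" "v \<in> piece C b" and e: "str C b ?c u = str C b ?c v"
    then have "u \<in> q b ` piece M b" "v \<in> q b ` piece M b" using q(3) by simp_all
    then obtain x y where xy: "x \<in> piece M b" "y \<in> piece M b" "u = q b x" "v = q b y" by auto
    let ?z = "x - y"
    have z: "?z \<in> piece M b" using zn_piece(3)[OF M] xy by blast
    have "q ?c (str M b ?c ?z) = 0"
      using e xy hom_nat[OF q(2) le_add_axis z, of i] zn_hom_apply(3)[OF M q(2) xy(1,2)]
        zn_str(3)[OF q(1) le_add_axis] zn_hom_apply(1)[OF M q(2)] by simp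
    then have "str M b ?c ?z \<in> f ?c ` piece K ?c"
      using zn_str(1)[OF M le_add_axis z] by (simp add: ex)
    then have "str M b ?c ?z \<in> f ?c ` str K b ?c ` piece K b"
      using bK by (simp add: bij_betw_def)
    then obtain w where w: "w \<in> piece K b" "str M b ?c ?z = f ?c (str K b ?c w)"
      by auto
    then have "str M b ?c ?z = str M b ?c (f b w)" using hom_nat[OF f le_add_axis w(1)] by simp
    then have "?z = f b w"
      using inj_onD[OF bij_betw_imp_inj_on[OF bM] _ z zn_hom_apply(1)[OF K f w(1)]] by simp
    then have "?z \<in> f b ` piece K b" using w by simp
    then have "q b ?z = 0" by (simp add: ex)
    then show "u = v" using xy zn_hom_apply(3)[OF M q(2) xy(1,2)] by simp
  qed
  then show "bij_betw (str C b ?c) (piece C b) (piece C ?c)" using sur by (simp add: bij_betw_def)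
qed

lemma finitely_determined_kernel:
  assumes "is_zn_module M" "is_zn_module N" "zn_hom M N f" "finitely_determined M" "finitely_determined N"
  shows "finitely_determined (zn_kernel M f)"
proof -
  obtain K L where "K \<ge> 0" "L \<ge> 0" "determined_in K M" "determined_in L N"
    using assms finitely_determined_iff by metis
  then have "max K L \<ge> 0" "determined_in (max K L) M" "determined_in (max K L) N"
    using determined_in_mono by fastforce+
  then show ?thesis
    using determined_in_kernel[OF assms(1-3)] zn_finite_kernel[OF assms(1-3)] assms(4)
    unfolding finitely_determined_iff by blast
qed

lemma finitely_determined_image:
  assumes "is_zn_module M" "is_zn_module N" "zn_hom M N f" "finitely_determined M" "finitely_determined N"
  shows "finitely_determined (zn_image M N f)"
proof -
  obtain K L where "K \<ge> 0" "L \<ge> 0" "determined_in K M" "determined_in L N"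
    using assms finitely_determined_iff by metis
  then have "max K L \<ge> 0" "determined_in (max K L) M" "determined_in (max K L) N"
    using determined_in_mono by fastforce+
  moreover have "zn_hom M (zn_image M N f) f" "zn_surj M (zn_image M N f) f"
    using assms(3) by (auto simp: zn_hom_def linear_between_def zn_surj_def)
  ultimately show ?thesis
    using determined_in_image[OF assms(1-3)] zn_finite_surj[OF assms(1) zn_module_image[OF assms(1-3)]] assms(4)
    unfolding finitely_determined_iff by blast
qed

lemma finitely_determined_cokernel:
  assumes "is_zn_module K" "is_zn_module M" "zn_hom K M f" "is_cokernel K M f C q"
    "finitely_determined K" "finitely_determined M"
  shows "finitely_determined C"
proof -
  obtain J L where "J \<ge> 0" "L \<ge> 0" "determined_in J K" "determined_in L M"
    using assms finitely_determined_iff by metis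
  then have "max J L \<ge> 0" "determined_in (max J L) K" "determined_in (max J L) M"
    using determined_in_mono by fastforce+
  then show ?thesis
    using determined_in_cokernel[OF assms(1-4)] zn_finite_surj[OF assms(2), of C q] assms(4,6)
    unfolding finitely_determined_iff is_cokernel_def by blast
qed

lemma finitely_determined_iso:
  fixes M :: "('k::field, 'v::ab_group_add, 'n::finite) zn_module"
  assumes M: "is_zn_module M" and N: "is_zn_module N" and f: "zn_iso M N f" and "finitely_determined M"
  shows "finitely_determined N"
proof -
  obtain L where L: "L \<ge> 0" "determined_in L M" using assms finitely_determined_iff by blast
  have h: "zn_hom M N f" "zn_surj M N f" using f by (auto simp: zn_iso_def)
  have "determined_in L N"
    unfolding determined_in_def
  proof (intro allI impI)
    fix i :: 'n and b :: "int ^ 'n" assume b: "b $ i < - L \<or> L \<le> b $ i"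
    let ?c = "b + axis i 1"
    have bM: "bij_betw (str M b ?c) (piece M b) (piece M ?c)"
      using L b unfolding determined_in_def by blast
    have "bij_betw (f ?c \<circ> str M b ?c) (piece M b) (piece N ?c)"
      using bij_betw_trans[OF bM zn_isoD(2)[OF f]] .
    then have "bij_betw (str N b ?c \<circ> f b) (piece M b) (piece N ?c)"
      by (rule bij_betw_cong[THEN iffD1, rotated]) (simp add: hom_nat[OF h(1) le_add_axis])
    then show "bij_betw (str N b ?c) (piece N b) (piece N ?c)"
      using bij_betw_comp_iff[OF zn_isoD(2)[OF f]] by blast
  qed
  then show ?thesis
    using zn_finite_surj[OF M N h] assms L unfolding finitely_determined_iff by blast
qed

section \<open>Retracting all degrees onto a box\<close>

definition bclamp :: "int \<Rightarrow> int ^ 'n::finite \<Rightarrow> int ^ 'n" where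
  "bclamp L b = (\<chi> i. max (- L) (min L (b $ i)))"

lemma bclamp_mono: "b \<le> c \<Longrightarrow> bclamp L b \<le> bclamp L c"
  by (simp add: bclamp_def less_eq_vec_def) (smt (verit))

lemma bclamp_bclamp [simp]: "bclamp L (bclamp L b) = bclamp L b"
  by (auto simp: bclamp_def vec_eq_iff max_def min_def)

text \<open>Equality instead of isomorphism: an element of degree \<open>b\<close> literally is an
  element of degree \<open>bclamp L b\<close>, so homomorphisms and covers can be computed inside
  the box without transport maps.\<close>

definition clamped :: "int \<Rightarrow> ('k, 'v, 'n::finite) zn_module \<Rightarrow> bool" where
  "clamped L M \<longleftrightarrow> (\<forall>b. piece M b = piece M (bclamp L b)) \<and>
     (\<forall>b c. b \<le> c \<longrightarrow> (\<forall>x\<in>piece M b. str M b c x = str M (bclamp L b) (bclamp L c) x))"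

definition clamp_module :: "int \<Rightarrow> ('k, 'v, 'n::finite) zn_module \<Rightarrow> ('k, 'v, 'n) zn_module" where
  "clamp_module L M = M\<lparr>piece := \<lambda>b. piece M (bclamp L b), str := \<lambda>b c. str M (bclamp L b) (bclamp L c)\<rparr>"

lemma clamp_module_simps [simp]:
  "scl (clamp_module L M) = scl M" "piece (clamp_module L M) b = piece M (bclamp L b)"
  "str (clamp_module L M) b c = str M (bclamp L b) (bclamp L c)"
  by (simp_all add: clamp_module_def)

lemma clamped_clamp_module: "clamped L (clamp_module L M)"
  by (simp add: clamped_def)

lemma zn_module_clamp_module:
  assumes M: "is_zn_module M"
  shows "is_zn_module (clamp_module L M)"
  unfolding is_zn_module_def clamp_module_simps
  by (intro conjI allI impI ballI zn_moduleD[OF M] bclamp_mono)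

lemma clampedD:
  assumes "clamped L M"
  shows "piece M (bclamp L b) = piece M b"
    and "b \<le> c \<Longrightarrow> x \<in> piece M b \<Longrightarrow> str M (bclamp L b) (bclamp L c) x = str M b c x"
  using assms unfolding clamped_def by simp_all

text \<open>In general \<open>b\<close> and \<open>bclamp L b\<close> are incomparable, since
  clamping raises some coordinates and lowers others. Raising only the coordinates below
  \<open>-L\<close> gives, for \<open>0 \<le> L\<close>, a common upper bound with the same clamped
  value, through which the two degrees are compared.\<close>

definition raise :: "int \<Rightarrow> int ^ 'n::finite \<Rightarrow> int ^ 'n" where
  "raise L b = (\<chi> i. max (- L) (b $ i))"

lemma raise: "b \<le> raise L b" "0 \<le> L \<Longrightarrow> bclamp L b \<le> raise L b" "bclamp L (raise L b) = bclamp L b"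
  "b \<le> c \<Longrightarrow> raise L b \<le> raise L c"
  by (auto simp: raise_def bclamp_def less_eq_vec_def vec_eq_iff le_max_iff_disj min_le_iff_disj)
    (metis linear order_trans)

lemma clamped_str_same:
  assumes M: "is_zn_module M" and c: "clamped L M" and "b \<le> d" "bclamp L b = bclamp L d" "x \<in> piece M b"
  shows "str M b d x = x"
  using assms clampedD[OF c] str_id[OF M] by metis

text \<open>Naturality along the two inequalities into \<open>raise L b\<close>, where the structure
  maps of both modules act as the identity, forces the values of \<open>f\<close> in the degrees
  \<open>b\<close> and \<open>bclamp L b\<close> to agree.\<close>

lemma clamped_hom:
  assumes M: "is_zn_module M" and N: "is_zn_module N" and c: "clamped L M" "clamped L N" and L: "0 \<le> L"
    and f: "zn_hom M N f" and x: "x \<in> piece M b"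
  shows "f (bclamp L b) x = f b x"
proof -
  have x': "x \<in> piece M (bclamp L b)" using x clampedD(1)[OF c(1)] by simp
  note s = clamped_str_same[OF M c(1)] clamped_str_same[OF N c(2)]
  note r = raise(1)[of b L] raise(2)[OF L, of b] raise(3)[of L b]
  have "f (raise L b) x = f b x"
    using hom_nat[OF f r(1) x] s(1)[OF r(1) _ x] s(2)[OF r(1) _ zn_hom_apply(1)[OF M f x]] r(3) by simp
  moreover have "f (raise L b) x = f (bclamp L b) x"
    using hom_nat[OF f r(2) x'] s(1)[OF r(2) _ x'] s(2)[OF r(2) _ zn_hom_apply(1)[OF M f x']] r(3) by simp
  ultimately show ?thesis by simp
qed

text \<open>Walk from \<open>b\<close> to \<open>c\<close> by unit steps, by induction on the total
  distance. The coordinate hypothesis says that every moving coordinate stays on one side of the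
  box, so each step is one of the bijections provided by \<open>determined_in\<close>.\<close>

lemma determined_in_bij:
  assumes M: "is_zn_module M" and d: "determined_in L M"
  shows "b \<le> c \<Longrightarrow> (\<And>i. b $ i = c $ i \<or> c $ i \<le> - L \<or> L \<le> b $ i)
    \<Longrightarrow> bij_betw (str M b c) (piece M b) (piece M c)"
proof (induction "nat (\<Sum>i\<in>UNIV. c $ i - b $ i)" arbitrary: b rule: less_induct)
  case less
  show ?case
  proof (cases "b = c")
    case True
    then show ?thesis using str_id[OF M] by (auto simp: bij_betw_def inj_on_def image_iff)
  next
    case False
    have le: "b $ j \<le> c $ j" for j using less.prems(1) by (simp add: less_eq_vec_def)
    obtain i where i: "b $ i < c $ i" using False le by (metis order_le_less vec_eq_iff)
    let ?b = "b + axis i 1"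
    have b': "?b $ j = (if j = i then b $ i + 1 else b $ j)" for j by (simp add: axis_def)
    have bc: "?b \<le> c" unfolding less_eq_vec_def using b' le i by auto
    have "(\<Sum>j\<in>UNIV. c $ j - ?b $ j) < (\<Sum>j\<in>UNIV. c $ j - b $ j)"
      by (rule sum_strict_mono_ex1) (use b' in auto)
    moreover have "0 < (\<Sum>j\<in>UNIV. c $ j - b $ j)"
      using sum_strict_mono_ex1[of UNIV "\<lambda>_. 0" "\<lambda>j. c $ j - b $ j"] le i by auto
    ultimately have lt: "nat (\<Sum>j\<in>UNIV. c $ j - ?b $ j) < nat (\<Sum>j\<in>UNIV. c $ j - b $ j)" by simp
    have "?b $ j = c $ j \<or> c $ j \<le> - L \<or> L \<le> ?b $ j" for j
      using less.prems(2)[of j] b'[of j] i by (auto split: if_splits)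
    from less.hyps[OF lt bc this] have "bij_betw (str M ?b c) (piece M ?b) (piece M c)" .
    moreover have "b $ i < - L \<or> L \<le> b $ i" using less.prems(2)[of i] i by auto
    then have "bij_betw (str M b ?b) (piece M b) (piece M ?b)"
      using d unfolding determined_in_def by blast
    ultimately have "bij_betw (str M ?b c \<circ> str M b ?b) (piece M b) (piece M c)"
      by (rule bij_betw_trans[rotated])
    then show ?thesis
      by (rule bij_betw_cong[THEN iffD1, rotated]) (simp add: str_comp[OF M le_add_axis bc])
  qed
qed

text \<open>The components of \<open>M\<close> in the degrees \<open>b\<close> and
  \<open>bclamp L b\<close> both map bijectively to the one in degree \<open>raise L b\<close>;
  going up along the first map and down along the second is the required isomorphism.\<close>

lemma iso_clamp_module:
  assumes M: "is_zn_module M" and d: "determined_in L M" and L: "0 \<le> L"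
  obtains \<theta> where "zn_iso M (clamp_module L M) \<theta>"
proof -
  let ?c = "bclamp L" and ?u = "raise L"
  note r = raise(1)[of _ L] raise(2)[OF L] raise(4)[of _ _ L]
  have b1: "bij_betw (str M b (?u b)) (piece M b) (piece M (?u b))" for b
    by (rule determined_in_bij[OF M d r(1)]) (auto simp: raise_def)
  have b2: "bij_betw (str M (?c b) (?u b)) (piece M (?c b)) (piece M (?u b))" for b
    by (rule determined_in_bij[OF M d r(2)]) (use L in \<open>auto simp: raise_def bclamp_def\<close>)
  define \<theta> where "\<theta> b = inv_into (piece M (?c b)) (str M (?c b) (?u b)) \<circ> str M b (?u b)" for b
  have bij: "bij_betw (\<theta> b) (piece M b) (piece M (?c b))" for b
    unfolding \<theta>_def using bij_betw_trans[OF b1 bij_betw_inv_into[OF b2]] .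
  have th: "str M (?c b) (?u b) (\<theta> b x) = str M b (?u b) x" if "x \<in> piece M b" for b x
    unfolding \<theta>_def using that bij_betw_inv_into_right[OF b2] zn_str(1)[OF M r(1)] by simp
  have thin: "\<theta> b x \<in> piece M (?c b)" if "x \<in> piece M b" for b x
    using bij that by (meson bij_betwE)
  \<comment> \<open>The value of \<open>\<theta>\<close> is pinned down by its image in degree
    \<open>raise L b\<close>, so linearity and naturality need only be checked there.\<close>
  have uniq: "y = \<theta> b x" if "x \<in> piece M b" "y \<in> piece M (?c b)" "str M (?c b) (?u b) y = str M b (?u b) x" for b x y
    using that b2[of b] th[OF that(1)] thin[OF that(1)] unfolding bij_betw_def inj_on_def by metis
  have "zn_hom M (clamp_module L M) \<theta>"
  proof (rule zn_homI, unfold clamp_module_simps)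
    fix b c :: "int ^ 'c" and x y a assume x: "x \<in> piece M b"
    show "\<theta> b x \<in> piece M (?c b)" by (rule thin[OF x])
    show "\<theta> b (x + y) = \<theta> b x + \<theta> b y" if y: "y \<in> piece M b"
      by (rule uniq[symmetric])
        (use x y th thin zn_str[OF M r(1)] zn_str[OF M r(2)] zn_piece[OF M] in auto)
    show "\<theta> b (scl M a x) = scl M a (\<theta> b x)"
      by (rule uniq[symmetric])
        (use x th thin zn_str[OF M r(1)] zn_str[OF M r(2)] zn_piece[OF M] in auto)
    show "\<theta> c (str M b c x) = str M (?c b) (?c c) (\<theta> b x)" if bc: "b \<le> c"
    proof (rule uniq[symmetric])
      show "str M b c x \<in> piece M c" by (rule zn_str(1)[OF M bc x])
      show "str M (?c b) (?c c) (\<theta> b x) \<in> piece M (?c c)" by (rule zn_str(1)[OF M bclamp_mono[OF bc] thin[OF x]])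
      have "str M (?c c) (?u c) (str M (?c b) (?c c) (\<theta> b x)) = str M (?c b) (?u c) (\<theta> b x)"
        by (rule str_comp[OF M bclamp_mono[OF bc] r(2) thin[OF x]])
      also have "\<dots> = str M (?u b) (?u c) (str M (?c b) (?u b) (\<theta> b x))"
        by (rule str_comp[OF M r(2) r(3)[OF bc] thin[OF x], symmetric])
      also have "\<dots> = str M b (?u c) x"
        unfolding th[OF x] by (rule str_comp[OF M r(1) r(3)[OF bc] x])
      also have "\<dots> = str M c (?u c) (str M b c x)"
        by (rule str_comp[OF M bc r(1) x, symmetric])
      finally show "str M (?c c) (?u c) (str M (?c b) (?c c) (\<theta> b x)) = str M c (?u c) (str M b c x)" .
    qed
  qed
  then show thesis using that zn_isoI[of M "clamp_module L M" \<theta>] bij by simp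
qed

section \<open>Flat modules as free modules over a box\<close>

lemma axis_of_nat_in_face: "i \<in> T \<Longrightarrow> axis i (int k) \<in> face T"
proof (induction k)
  case 0
  have "axis i (int 0) = 0" by (simp add: vec_eq_iff axis_def)
  then show ?case using face.zero by metis
next
  case (Suc k)
  have "axis i (int (Suc k)) = axis i (int k) + axis i 1" by (simp add: vec_eq_iff axis_def)
  then show ?case using Suc face.add by metis
qed

text \<open>Adjoining inverses to the generators of a face yields all integral vectors supported on
  \<open>T\<close>; this turns both kinds of regions into systems of inequalities on the coordinates
  outside \<open>T\<close>.\<close>

lemma group_closure_face:
  "group_closure (face T) = {z :: int ^ 'n::finite. \<forall>i. i \<notin> T \<longrightarrow> z $ i = 0}"
proof (intro set_eqI iffI)
  fix z :: "int ^ 'n" assume "z \<in> group_closure (face T)"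
  then show "z \<in> {z. \<forall>i. i \<notin> T \<longrightarrow> z $ i = 0}"
  proof induction
    case (base s)
    have "\<forall>i. i \<notin> T \<longrightarrow> a $ i = 0" if "a \<in> face T" for a :: "int ^ 'n"
      using that by induction (auto simp: axis_def)
    then show ?case using base by auto
  qed auto
next
  fix z :: "int ^ 'n" assume z: "z \<in> {z. \<forall>i. i \<notin> T \<longrightarrow> z $ i = 0}"
  have pos: "axis i (int k) \<in> group_closure (face T)" if "i \<in> T" for i k
    using axis_of_nat_in_face[OF that] by (intro group_closure.base) simp
  have ax: "axis i (z $ i) \<in> group_closure (face T)" if "i \<in> T" for i
  proof (cases "0 \<le> z $ i")
    case True
    then show ?thesis using pos[OF that, of "nat (z $ i)"] by simp
  next
    case False
    then have "axis i (z $ i) = - axis i (int (nat (- z $ i)))" by (simp add: vec_eq_iff axis_def)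
    then show ?thesis using pos[OF that, of "nat (- z $ i)"] by simp
  qed
  have "(\<Sum>i\<in>S. axis i (z $ i)) \<in> group_closure (face T)" if "finite S" "S \<subseteq> T" for S
    using that by induction (auto intro: group_closure_add ax)
  moreover have "(\<Sum>i\<in>T. axis i (z $ i)) = z"
    using z by (auto simp: vec_eq_iff axis_def sum.delta if_distrib cong: if_cong)
  ultimately show "z \<in> group_closure (face T)" by (metis finite_class.finite order_refl)
qed

lemma flat_region_eq: "flat_region b T = {c. \<forall>i. i \<notin> T \<longrightarrow> b $ i \<le> c $ i}"
proof (intro set_eqI iffI)
  fix c assume "c \<in> flat_region b T"
  then show "c \<in> {c. \<forall>i. i \<notin> T \<longrightarrow> b $ i \<le> c $ i}"
    by (auto simp: flat_region_def group_closure_face pos_cone_def less_eq_vec_def)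
next
  fix c assume c: "c \<in> {c. \<forall>i. i \<notin> T \<longrightarrow> b $ i \<le> c $ i}"
  define z where "z = (\<chi> i. if i \<in> T then c $ i - b $ i else 0)"
  have "z \<in> group_closure (face T)" "c - b - z \<in> pos_cone" "c = b + z + (c - b - z)"
    using c by (auto simp: z_def group_closure_face pos_cone_def less_eq_vec_def)
  then show "c \<in> flat_region b T" unfolding flat_region_def by blast
qed

lemma injective_region_eq: "injective_region b T = {c. \<forall>i. i \<notin> T \<longrightarrow> c $ i \<le> b $ i}"
proof (intro set_eqI iffI)
  fix c assume "c \<in> injective_region b T"
  then show "c \<in> {c. \<forall>i. i \<notin> T \<longrightarrow> c $ i \<le> b $ i}"
    by (auto simp: injective_region_def group_closure_face pos_cone_def less_eq_vec_def)
next
  fix c assume c: "c \<in> {c. \<forall>i. i \<notin> T \<longrightarrow> c $ i \<le> b $ i}"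
  define z where "z = (\<chi> i. if i \<in> T then c $ i - b $ i else 0)"
  have "z \<in> group_closure (face T)" "b + z - c \<in> pos_cone" "c = b + z - (b + z - c)"
    using c by (auto simp: z_def group_closure_face pos_cone_def less_eq_vec_def)
  then show "c \<in> injective_region b T" unfolding injective_region_def by blast
qed

lemma indicator_module_simps [simp]:
  "scl (indicator_module S) = (*)" "piece (indicator_module S) b = (if b \<in> S then UNIV else {0})"
  "str (indicator_module S) b c x = (if b \<in> S \<and> c \<in> S then x else 0)"
  by (simp_all add: indicator_module_def)

lemma zn_module_indicator:
  assumes "\<And>b c d. b \<le> c \<Longrightarrow> c \<le> d \<Longrightarrow> b \<in> S \<Longrightarrow> d \<in> S \<Longrightarrow> c \<in> S"
  shows "is_zn_module (indicator_module S :: ('k::field, 'k, 'n::finite) zn_module)"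
proof -
  interpret vector_space "(*) :: 'k \<Rightarrow> 'k \<Rightarrow> 'k" by (rule vector_space_mult)
  show ?thesis
    unfolding is_zn_module_def using assms vector_space_mult by (auto simp: linear_between_def)
qed

lemma direct_sum_simps [simp]:
  "scl (direct_sum m M) = (\<lambda>c x i. scl (M i) c (x i))"
  "piece (direct_sum m M) b = {x. (\<forall>i<m. x i \<in> piece (M i) b) \<and> (\<forall>i\<ge>m. x i = 0)}"
  "str (direct_sum m M) b c = (\<lambda>x i. if i < m then str (M i) b c (x i) else 0)"
  by (simp_all add: direct_sum_def)

lemma zn_module_direct_sum:
  assumes M: "\<And>i. is_zn_module (M i)"
  shows "is_zn_module (direct_sum m M)"
proof -
  have vs: "vector_space (\<lambda>c x i. scl (M i) c (x i))"
  proof -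
    have "vector_space (scl (M i))" for i by (rule zn_vector_space[OF M])
    then show ?thesis unfolding vector_space_def by (simp add: fun_eq_iff)
  qed
  interpret vector_space "\<lambda>c x i. scl (M i) c (x i)" by fact
  have 0: "scl (M i) c 0 = 0" for i c
    by (rule module.scale_zero_right) (use zn_vector_space[OF M] in \<open>simp add: module_iff_vector_space\<close>)
  show ?thesis
    unfolding is_zn_module_def direct_sum_simps
  proof (intro conjI allI impI ballI)
    show "vector_space (\<lambda>c x i. scl (M i) c (x i))" by fact
    show "subspace {x. (\<forall>i<m. x i \<in> piece (M i) b) \<and> (\<forall>i\<ge>m. x i = 0)}" for b
      unfolding subspace_def using zn_piece[OF M] 0 by auto
    show "linear_between (\<lambda>c x i. scl (M i) c (x i)) (\<lambda>c x i. scl (M i) c (x i))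
        {x. (\<forall>i<m. x i \<in> piece (M i) b) \<and> (\<forall>i\<ge>m. x i = 0)}
        {x. (\<forall>i<m. x i \<in> piece (M i) c) \<and> (\<forall>i\<ge>m. x i = 0)}
        (\<lambda>x i. if i < m then str (M i) b c (x i) else 0)" if "b \<le> c" for b c
      unfolding linear_between_def using zn_str[OF M that] 0 by (auto simp: fun_eq_iff)
  qed (use str_id[OF M] str_comp[OF M] in \<open>auto simp: fun_eq_iff\<close>)
qed

text \<open>Scalars are required to agree at every index, not only below \<open>m\<close>, because
  the scalar multiplication of \<open>direct_sum\<close> acts coordinatewise without a
  cut-off.\<close>

lemma direct_sum_cong:
  assumes "\<And>i. i < m \<Longrightarrow> M i = M' i" "\<And>i. scl (M i) = scl (M' i)"
  shows "direct_sum m M = direct_sum m M'"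
  unfolding direct_sum_def using assms by (auto simp: fun_eq_iff)

lemma zn_module_direct_sum_indicator:
  assumes "\<And>i b c d. b \<le> c \<Longrightarrow> c \<le> d \<Longrightarrow> b \<in> S i \<Longrightarrow> d \<in> S i \<Longrightarrow> c \<in> S i"
  shows "is_zn_module (direct_sum m (\<lambda>i. indicator_module (S i) :: ('k::field, 'k, 'n::finite) zn_module))"
  by (intro zn_module_direct_sum zn_module_indicator) (fact assms)

text \<open>
  A coordinate of \<open>\<beta> j\<close> equal to \<open>-L\<close> stands for a direction in which the summand is invariant.
\<close>

definition free_module :: "int \<Rightarrow> nat \<Rightarrow> (nat \<Rightarrow> int ^ 'n::finite) \<Rightarrow> ('k::field, 'n) std_module" where
  "free_module L m \<beta> = direct_sum m (\<lambda>j. indicator_module {c. \<beta> j \<le> bclamp L c})"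

lemma zn_module_free: "is_zn_module (free_module L m \<beta> :: ('k::field, 'n::finite) std_module)"
  unfolding free_module_def
  by (rule zn_module_direct_sum_indicator) (use bclamp_mono order_trans in blast)

lemma free_module_simps [simp]:
  "scl (free_module L m \<beta>) = (\<lambda>a x i. a * x i)"
  "piece (free_module L m \<beta>) c = {x. \<forall>i. x i \<noteq> 0 \<longrightarrow> i < m \<and> \<beta> i \<le> bclamp L c}"
  unfolding free_module_def by (auto simp: not_less[symmetric])

text \<open>A generator present in degree \<open>c\<close> stays present in every larger degree, so
  no coordinate is ever lost.\<close>

lemma str_free_module:
  assumes "c \<le> d" "x \<in> piece (free_module L m \<beta>) c"
  shows "str (free_module L m \<beta>) c d x = x"
  using assms(2) order_trans[OF _ bclamp_mono[OF assms(1), of L]]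
  by (auto simp: free_module_def fun_eq_iff split: if_splits)

lemma clamped_free_module: "clamped L (free_module L m \<beta> :: ('k::field, 'n::finite) std_module)"
  unfolding clamped_def
proof (intro conjI allI impI ballI)
  let ?F = "free_module L m \<beta> :: ('k, 'n) std_module"
  show "piece ?F b = piece ?F (bclamp L b)" for b by simp
  fix b c x assume bc: "b \<le> c" and x: "x \<in> piece ?F b"
  then have "x \<in> piece ?F (bclamp L b)" by simp
  then show "str ?F b c x = str ?F (bclamp L b) (bclamp L c) x"
    by (simp add: str_free_module[OF bc x] str_free_module[OF bclamp_mono[OF bc]] del: free_module_simps)
qed

text \<open>Since \<open>bclamp L c\<close> never drops below \<open>-L\<close>, a bound
  \<open>-L\<close> imposes no condition and can encode an invariant direction. Genuine bounds must
  therefore be strictly larger, whereas a genuine bound equal to \<open>L\<close> is harmless: a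
  clamped coordinate reaches \<open>L\<close> only if the coordinate itself does.\<close>

lemma free_region:
  assumes "\<And>i. i \<notin> T \<Longrightarrow> - L < b $ i \<and> b $ i \<le> L"
  shows "flat_region b T = {c. (\<chi> i. if i \<in> T then - L else b $ i) \<le> bclamp L c}"
  unfolding flat_region_eq less_eq_vec_def bclamp_def
  using assms by (auto simp: le_max_iff_disj) (smt (verit))+

lemma region_free:
  assumes "bclamp L \<beta> = \<beta>"
  shows "{c. \<beta> \<le> bclamp L c} = flat_region \<beta> {i. \<beta> $ i = - L}"
proof -
  have "- L \<le> \<beta> $ i \<and> (\<beta> $ i \<le> L \<or> \<beta> $ i = - L)" for i
    using arg_cong[OF assms, of "\<lambda>v. v $ i"] by (auto simp: bclamp_def)
  then show ?thesis
    unfolding flat_region_eq less_eq_vec_def bclamp_def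
    by (auto simp: le_max_iff_disj) (smt (verit))+
qed

lemma flat_summands_free:
  assumes "\<And>j. j < m \<Longrightarrow> bclamp L (\<beta> j) = \<beta> j"
  shows "flat_summands (free_module L m \<beta> :: ('k::field, 'n::finite) std_module) m"
proof -
  have "free_module L m \<beta> = direct_sum m (\<lambda>j. indicator_module (flat_region (\<beta> j) {i. \<beta> j $ i = - L}) :: ('k, 'k, 'n) zn_module)"
    unfolding free_module_def using region_free[OF assms] by (intro direct_sum_cong) auto
  then have "zn_isomorphic (free_module L m \<beta> :: ('k, 'n) std_module)
    (direct_sum m (\<lambda>j. indicator_module (flat_region (\<beta> j) {i. \<beta> j $ i = - L})))"
    using zn_iso_refl unfolding zn_isomorphic_def by metis
  then show ?thesis unfolding flat_summands_def
    by (intro conjI zn_module_free exI[of _ \<beta>] exI[of _ "\<lambda>j. {i. \<beta> j $ i = - L}"])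
qed

text \<open>All sufficiently large radii are covered because several modules have to be placed in
  the same box. The generator degrees vary with \<open>L'\<close>, as the mark \<open>-L'\<close>
  for an invariant direction does.\<close>

lemma flat_summandsE:
  fixes F :: "('k::field, 'f::ab_group_add, 'n::finite) zn_module"
  assumes F: "flat_summands F m"
  obtains L where "L \<ge> 0" "\<And>L'. L' \<ge> L \<Longrightarrow> \<exists>\<beta> a. (\<forall>j<m. bclamp L' (\<beta> j) = \<beta> j) \<and>
    zn_iso F (free_module L' m \<beta> :: ('k, 'n) std_module) a"
proof -
  obtain b T a where a: "zn_iso F (direct_sum m (\<lambda>i. indicator_module (flat_region (b i) (T i)) :: ('k, 'k, 'n) zn_module)) a"
    using F unfolding flat_summands_def zn_isomorphic_def by blast
  \<comment> \<open>The added 1 keeps every finite bound strictly above \<open>-L\<close>, where it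
    cannot be mistaken for the mark of an invariant direction.\<close>
  define L where "L = (\<Sum>j<m. \<Sum>i\<in>UNIV. \<bar>b j $ i\<bar>) + 1"
  have bd: "\<bar>b j $ i\<bar> < L" if "j < m" for i j
  proof -
    have "\<bar>b j $ i\<bar> \<le> (\<Sum>i\<in>UNIV. \<bar>b j $ i\<bar>)" by (rule member_le_sum) auto
    also have "\<dots> \<le> (\<Sum>j<m. \<Sum>i\<in>UNIV. \<bar>b j $ i\<bar>)"
      by (rule member_le_sum[where f = "\<lambda>j. \<Sum>i\<in>UNIV. \<bar>b j $ i\<bar>"]) (use that in \<open>auto simp: sum_nonneg\<close>)
    finally show ?thesis by (simp add: L_def)
  qed
  have L0: "L \<ge> 0" unfolding L_def by (simp add: sum_nonneg)
  have "\<exists>\<beta> a. (\<forall>j<m. bclamp L' (\<beta> j) = \<beta> j) \<and> zn_iso F (free_module L' m \<beta> :: ('k, 'n) std_module) a"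
    if L': "L' \<ge> L" for L'
  proof -
    define \<beta> where "\<beta> j = (\<chi> i. if i \<in> T j then - L' else b j $ i)" for j
    have bd': "- L' < b j $ i \<and> b j $ i \<le> L'" if "j < m" for i j using bd[OF that, of i] L' by linarith
    have "bclamp L' (\<beta> j) = \<beta> j" if "j < m" for j
      using bd'[OF that] L0 L' by (auto simp: bclamp_def \<beta>_def vec_eq_iff max_def min_def) (smt (verit))+
    moreover have "free_module L' m \<beta> = direct_sum m (\<lambda>i. indicator_module (flat_region (b i) (T i)) :: ('k, 'k, 'n) zn_module)"
      unfolding free_module_def
    proof (rule direct_sum_cong)
      show "indicator_module {c. \<beta> j \<le> bclamp L' c} = indicator_module (flat_region (b j) (T j))" if "j < m" for j
        unfolding \<beta>_def using free_region[of "T j" L' "b j"] bd'[OF that] by simp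
    qed simp
    ultimately show ?thesis using a by metis
  qed
  then show thesis using that L0 by blast
qed

lemma clamped_determined_in:
  fixes M :: "('k::field, 'v::ab_group_add, 'n::finite) zn_module"
  assumes M: "is_zn_module M" and c: "clamped L M" and L: "0 \<le> L"
  shows "determined_in L M"
  unfolding determined_in_def
proof (intro allI impI)
  fix i :: 'n and b :: "int ^ 'n" assume b: "b $ i < - L \<or> L \<le> b $ i"
  have e: "bclamp L b = bclamp L (b + axis i 1)"
    using b L by (auto simp: bclamp_def vec_eq_iff axis_def max_def min_def)
  have "piece M b = piece M (b + axis i 1)" using clampedD(1)[OF c] e by metis
  then show "bij_betw (str M b (b + axis i 1)) (piece M b) (piece M (b + axis i 1))"
    using clamped_str_same[OF M c le_add_axis e] by (auto simp: bij_betw_def inj_on_def image_iff)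
qed

section \<open>Homomorphisms out of free modules over the box\<close>

definition unit_vec :: "nat \<Rightarrow> nat \<Rightarrow> 'k::field" where
  "unit_vec j = (\<lambda>i. if i = j then 1 else 0)"

lemma unit_vec_expand:
  fixes x :: "nat \<Rightarrow> 'k::field"
  assumes "\<And>i. x i \<noteq> 0 \<Longrightarrow> i < m"
  shows "x = (\<Sum>j<m. (\<lambda>i. x j * unit_vec j i))"
proof
  fix i
  have s: "(\<Sum>j\<in>J. (\<lambda>i. x j * unit_vec j i)) i = (\<Sum>j\<in>J. x j * unit_vec j i)" if "finite J" for J
    using that by induction auto
  show "x i = (\<Sum>j<m. (\<lambda>i. x j * unit_vec j i)) i"
    unfolding s[OF finite_lessThan] using assms[of i]
    by (auto simp: unit_vec_def if_distrib cong: if_cong)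
qed

lemma zn_finite_free: "zn_finite (free_module L m \<beta> :: ('k::field, 'n::finite) std_module)"
  unfolding zn_finite_def
proof
  fix c
  let ?F = "free_module L m \<beta> :: ('k, 'n) std_module"
  interpret vector_space "scl ?F" by (rule zn_vector_space[OF zn_module_free])
  let ?B = "unit_vec ` {j. j < m \<and> \<beta> j \<le> bclamp L c} :: (nat \<Rightarrow> 'k) set"
  have "?B \<subseteq> piece ?F c" by (auto simp: unit_vec_def split: if_splits)
  moreover have "x \<in> span ?B" if x: "x \<in> piece ?F c" for x
  proof -
    have e: "x = (\<Sum>j<m. scl ?F (x j) (unit_vec j))" using unit_vec_expand[of x m] x by simp
    show ?thesis
      by (subst e, rule span_sum)
        (use x in \<open>metis (mono_tags, lifting) image_eqI scale_zero_left span_base span_scale span_zero lessThan_iff mem_Collect_eq free_module_simps(2)\<close>)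
  qed
  ultimately have "span ?B = piece ?F c"
    using span_subspace[of ?B "piece ?F c"] zn_subspace[OF zn_module_free] by blast
  then show "\<exists>B. finite B \<and> span B = piece ?F c" by (intro exI[of _ ?B]) simp
qed

lemma finitely_determined_free: "0 \<le> L \<Longrightarrow> finitely_determined (free_module L m \<beta> :: ('k::field, 'n::finite) std_module)"
  unfolding finitely_determined_iff
  using zn_finite_free clamped_determined_in[OF zn_module_free clamped_free_module] by blast

lemma finitely_determined_flat:
  fixes F :: "('k::field, 'f::ab_group_add, 'n::finite) zn_module"
  assumes "flat_summands F m"
  shows "finitely_determined F"
proof -
  obtain L \<beta> a where "L \<ge> 0" "zn_iso F (free_module L m \<beta> :: ('k, 'n) std_module) a"
    using flat_summandsE[OF assms] by (metis order_refl)
  moreover have F: "is_zn_module F" using assms by (simp add: flat_summands_def)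
  ultimately show ?thesis
    by (metis zn_iso_inverse finitely_determined_iso zn_module_free finitely_determined_free)
qed

section \<open>Minimal free covers\<close>

lemma zn_str_sum:
  assumes M: "is_zn_module M" and bc: "b \<le> c" and "\<And>i. i \<in> I \<Longrightarrow> g i \<in> piece M b"
  shows "str M b c (sum g I) = (\<Sum>i\<in>I. str M b c (g i))"
  using assms(3)
proof (induction I rule: infinite_finite_induct)
  case (insert i I)
  then show ?case using zn_str(2)[OF M bc, of "g i" "sum g I"] zn_piece(5)[OF M, of I g b]
    by simp
qed (auto simp: zn_str(5)[OF M bc])

text \<open>The linear extension of sending generator \<open>j\<close> to \<open>v j\<close>. The
  value is transported to \<open>bclamp L c\<close> and not to \<open>c\<close>, since
  \<open>\<beta> j \<le> c\<close> can fail in an invariant direction; for clamped \<open>N\<close>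
  the two components coincide.\<close>

definition free_map :: "int \<Rightarrow> nat \<Rightarrow> (nat \<Rightarrow> int ^ 'n::finite) \<Rightarrow> ('k::field, 'v::ab_group_add, 'n) zn_module
    \<Rightarrow> (nat \<Rightarrow> 'v) \<Rightarrow> int ^ 'n \<Rightarrow> (nat \<Rightarrow> 'k) \<Rightarrow> 'v" where
  "free_map L m \<beta> N v c x =
     (\<Sum>j<m. if \<beta> j \<le> bclamp L c then scl N (x j) (str N (\<beta> j) (bclamp L c) (v j)) else 0)"

lemma zn_hom_free_map:
  fixes N :: "('k::field, 'v::ab_group_add, 'n::finite) zn_module"
  assumes N: "is_zn_module N" and c: "clamped L N" and v: "\<And>j. j < m \<Longrightarrow> v j \<in> piece N (\<beta> j)"
  shows "zn_hom (free_module L m \<beta>) N (free_map L m \<beta> N v)"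
proof (rule zn_homI)
  interpret vector_space "scl N" by (rule zn_vector_space[OF N])
  have s: "str N (\<beta> j) (bclamp L c) (v j) \<in> piece N c" if "j < m" "\<beta> j \<le> bclamp L c" for j c
    using zn_str(1)[OF N that(2) v[OF that(1)]] clampedD(1)[OF c] by simp
  fix b d :: "int ^ 'n" and x y :: "nat \<Rightarrow> 'k" and a :: 'k
  show "free_map L m \<beta> N v b x \<in> piece N b"
    unfolding free_map_def using s zn_piece[OF N] by (intro zn_piece(5)[OF N]) auto
  show "free_map L m \<beta> N v b (x + y) = free_map L m \<beta> N v b x + free_map L m \<beta> N v b y"
    unfolding free_map_def sum.distrib[symmetric] by (intro sum.cong) (auto simp: scale_left_distrib)
  show "free_map L m \<beta> N v b (scl (free_module L m \<beta>) a x) = scl N a (free_map L m \<beta> N v b x)"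
    unfolding free_map_def scale_sum_right by (intro sum.cong) auto
  assume bd: "b \<le> d" and x: "x \<in> piece (free_module L m \<beta> :: ('k, 'n) std_module) b"
  let ?g = "\<lambda>c j. if \<beta> j \<le> bclamp L c then scl N (x j) (str N (\<beta> j) (bclamp L c) (v j)) else 0"
  have g: "?g b j \<in> piece N b" if "j < m" for j
    using s[OF that] zn_piece[OF N] by auto
  have s1: "str N b d (sum (?g b) {..<m}) = (\<Sum>j<m. str N b d (?g b j))"
    by (rule zn_str_sum[OF N bd]) (use g in auto)
  have s2: "str N b d (?g b j) = ?g d j" if j: "j < m" for j
  proof (cases "\<beta> j \<le> bclamp L b")
    case True
    then have le: "\<beta> j \<le> bclamp L d" using bclamp_mono[OF bd] order_trans by blast
    have "str N b d (str N (\<beta> j) (bclamp L b) (v j)) = str N (\<beta> j) (bclamp L d) (v j)"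
      using clampedD(2)[OF c bd s[OF j True]] str_comp[OF N True bclamp_mono[OF bd] v[OF j]] by simp
    then show ?thesis using True le zn_str(4)[OF N bd s[OF j True]] by simp
  next
    case False
    then have "x j = 0" using x by auto
    then show ?thesis using False zn_str(5)[OF N bd] by simp
  qed
  have "str N b d (sum (?g b) {..<m}) = sum (?g d) {..<m}"
    unfolding s1 by (rule sum.cong) (simp_all only: lessThan_iff s2)
  then show "free_map L m \<beta> N v d (str (free_module L m \<beta>) b d x) = str N b d (free_map L m \<beta> N v b x)"
    unfolding str_free_module[OF bd x] free_map_def by simp
qed

lemma unit_vec_in_free: "j < m \<Longrightarrow> \<beta> j \<le> bclamp L c \<Longrightarrow> unit_vec j \<in> piece (free_module L m \<beta>) c"
  by (auto simp: unit_vec_def split: if_splits)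

text \<open>Each unit vector comes from its own degree \<open>\<beta> j\<close> by a structure map,
  so naturality determines its image in degree \<open>bclamp L c\<close>, and
  \<open>clamped_hom\<close> carries this over to \<open>c\<close>. Hence the values on generators
  determine the homomorphism.\<close>

lemma free_hom_eq:
  fixes N :: "('k::field, 'v::ab_group_add, 'n::finite) zn_module"
  assumes N: "is_zn_module N" and cl: "clamped L N" and L: "0 \<le> L" and f: "zn_hom (free_module L m \<beta>) N f"
    and box: "\<And>j. j < m \<Longrightarrow> bclamp L (\<beta> j) = \<beta> j"
    and x: "x \<in> piece (free_module L m \<beta>) c"
  shows "f c x = free_map L m \<beta> N (\<lambda>j. f (\<beta> j) (unit_vec j)) c x"
proof -
  let ?F = "free_module L m \<beta> :: ('k, 'n) std_module"
  interpret N: vector_space "scl N" by (rule zn_vector_space[OF N])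
  let ?g = "\<lambda>j. (\<lambda>i. x j * unit_vec j i) :: nat \<Rightarrow> 'k"
  have g: "?g j \<in> piece ?F c" for j using x by (auto simp: unit_vec_def split: if_splits)
  have "x = (\<Sum>j<m. ?g j)" using unit_vec_expand[of x m] x by simp
  then have "f c x = (\<Sum>j<m. f c (?g j))"
    using zn_hom_sum[OF zn_module_free f, of "{..<m}" ?g c] g by simp
  also have "\<dots> = free_map L m \<beta> N (\<lambda>j. f (\<beta> j) (unit_vec j)) c x"
    unfolding free_map_def
  proof (rule sum.cong[OF refl])
    fix j assume "j \<in> {..<m}"
    then have j: "j < m" by simp
    show "f c (?g j) = (if \<beta> j \<le> bclamp L c then scl N (x j) (str N (\<beta> j) (bclamp L c) (f (\<beta> j) (unit_vec j))) else 0)"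
    proof (cases "\<beta> j \<le> bclamp L c")
      case True
      have u: "unit_vec j \<in> piece ?F c" "unit_vec j \<in> piece ?F (\<beta> j)"
        using unit_vec_in_free[of j m \<beta> L c] unit_vec_in_free[of j m \<beta> L "\<beta> j"] True j box[OF j] by simp_all
      have "f c (?g j) = scl N (x j) (f c (unit_vec j))"
        using zn_hom_apply(4)[OF zn_module_free f u(1), of "x j"] by simp
      moreover have "f c (unit_vec j) = str N (\<beta> j) (bclamp L c) (f (\<beta> j) (unit_vec j))"
        using hom_nat[OF f True u(2)] str_free_module[OF True u(2)]
          clamped_hom[OF zn_module_free N clamped_free_module cl L f u(1)] by simp
      ultimately show ?thesis using True by simp
    next
      case False
      then have "x j = 0" using x by auto
      then have "?g j = 0" by (simp add: fun_eq_iff)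
      then show ?thesis using False zn_hom_apply(5)[OF zn_module_free f] by simp
    qed
  qed
  finally show ?thesis .
qed

text \<open>Projectivity relative to clamped modules: lift the image of each generator in its own
  degree, extend by \<open>free_map\<close>, and compare on generators. The restriction to clamped
  modules is essential, as a module with an invariant direction need not be projective.\<close>

lemma free_lift:
  fixes M :: "('k::field, 'v::ab_group_add, 'n::finite) zn_module"
    and N :: "('k, 'w::ab_group_add, 'n) zn_module"
  assumes M: "is_zn_module M" "clamped L M" and N: "is_zn_module N" "clamped L N" and L: "0 \<le> L"
    and box: "\<And>j. j < m \<Longrightarrow> bclamp L (\<beta> j) = \<beta> j"
    and q: "zn_hom M N q" "zn_surj M N q" and h: "zn_hom (free_module L m \<beta>) N h"
  obtains g where "zn_hom (free_module L m \<beta>) M g"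
    "\<And>c x. x \<in> piece (free_module L m \<beta>) c \<Longrightarrow> q c (g c x) = h c x"
proof -
  let ?F = "free_module L m \<beta> :: ('k, 'n) std_module"
  have u: "unit_vec j \<in> piece ?F (\<beta> j)" if "j < m" for j
    using unit_vec_in_free[of j m \<beta> L "\<beta> j"] that box[OF that] by simp
  have "\<exists>v. v \<in> piece M (\<beta> j) \<and> q (\<beta> j) v = h (\<beta> j) (unit_vec j)" if "j < m" for j
    using q(2) zn_hom_apply(1)[OF zn_module_free h u[OF that]] unfolding zn_surj_def by (metis imageE)
  then obtain v where v: "\<And>j. j < m \<Longrightarrow> v j \<in> piece M (\<beta> j)"
    "\<And>j. j < m \<Longrightarrow> q (\<beta> j) (v j) = h (\<beta> j) (unit_vec j)" by metis
  let ?g = "free_map L m \<beta> M v"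
  have g: "zn_hom ?F M ?g" by (rule zn_hom_free_map[OF M v(1)])
  interpret vector_space "scl M" by (rule zn_vector_space[OF M(1)])
  have gu: "?g (\<beta> j) (unit_vec j) = v j" if j: "j < m" for j
  proof -
    have "?g (\<beta> j) (unit_vec j) = (\<Sum>i<m. if i = j then v j else 0)"
      unfolding free_map_def unit_vec_def
      by (rule sum.cong) (use box[OF j] str_id[OF M(1) v(1)[OF j]] in auto)
    then show ?thesis using j by simp
  qed
  have "q c (?g c x) = h c x" if x: "x \<in> piece ?F c" for c x
  proof -
    have "q c (?g c x) = free_map L m \<beta> N (\<lambda>j. q (\<beta> j) (?g (\<beta> j) (unit_vec j))) c x"
      by (rule free_hom_eq[OF N L zn_hom_comp[OF g q(1)] box x])
    also have "\<dots> = free_map L m \<beta> N (\<lambda>j. h (\<beta> j) (unit_vec j)) c x"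
      unfolding free_map_def[of L m \<beta> N] by (rule sum.cong) (simp_all add: gu v(2))
    finally show ?thesis using free_hom_eq[OF N L h box x] by simp
  qed
  then show thesis using that g by blast
qed

lemma finite_box: "finite {b :: int ^ 'n::finite. bclamp L b = b}"
proof (rule finite_subset)
  show "{b :: int ^ 'n. bclamp L b = b} \<subseteq> vec_lambda ` (UNIV \<rightarrow>\<^sub>E {- L..max (- L) L})"
  proof
    fix b :: "int ^ 'n" assume "b \<in> {b. bclamp L b = b}"
    then have "b $ i = max (- L) (min L (b $ i))" for i by (simp add: bclamp_def vec_eq_iff)
    then have "b $ i \<in> {- L..max (- L) L}" for i
      by (metis atLeastAtMost_iff max.cobounded1 max.mono min.cobounded1 order_refl)
    then have "vec_nth b \<in> UNIV \<rightarrow>\<^sub>E {- L..max (- L) L}" by auto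
    then show "b \<in> vec_lambda ` (UNIV \<rightarrow>\<^sub>E {- L..max (- L) L})" by (metis image_eqI vec_nth_inverse)
  qed
  show "finite (vec_lambda ` (UNIV \<rightarrow>\<^sub>E {- L..max (- L) L}))" by (intro finite_imageI finite_PiE) auto
qed

text \<open>The box has finitely many degrees and each component is finite-dimensional, so finitely
  many generators suffice: one for each element of a spanning set in each box degree.\<close>

lemma free_cover_exists:
  fixes N :: "('k::field, 'v::ab_group_add, 'n::finite) zn_module"
  assumes N: "is_zn_module N" and cl: "clamped L N" and fin: "zn_finite N" and L: "0 \<le> L"
  obtains m \<beta> p where "\<And>j. j < m \<Longrightarrow> bclamp L (\<beta> j) = \<beta> j" "zn_hom (free_module L m \<beta>) N p"
    "zn_surj (free_module L m \<beta> :: ('k, 'n) std_module) N p"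
proof -
  obtain B where B: "\<And>b. finite (B b)" "\<And>b. module.span (scl N) (B b) = piece N b"
    using fin unfolding zn_finite_def by metis
  interpret vector_space "scl N" by (rule zn_vector_space[OF N])
  let ?P = "SIGMA b:{b. bclamp L b = b}. B b"
  have "finite ?P" using finite_box B by auto
  then obtain h :: "nat \<Rightarrow> _" where h: "bij_betw h {0..<card ?P} ?P"
    using ex_bij_betw_nat_finite by blast
  let ?m = "card ?P" and ?\<beta> = "fst \<circ> h" and ?v = "snd \<circ> h"
  let ?F = "free_module L ?m ?\<beta> :: ('k, 'n) std_module"
  have hP: "h j \<in> ?P" if "j < ?m" for j using bij_betwE[OF h] that by auto
  have hP1: "bclamp L (?\<beta> j) = ?\<beta> j" and hP2: "?v j \<in> B (?\<beta> j)" if "j < ?m" for j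
    using hP[OF that] by (cases "h j"; simp)+
  have v: "?v j \<in> piece N (?\<beta> j)" if "j < ?m" for j
    using span_base[OF hP2[OF that]] B(2) by blast
  let ?p = "free_map L ?m ?\<beta> N ?v"
  have p: "zn_hom ?F N ?p" by (rule zn_hom_free_map[OF N cl v])
  have "piece N c \<subseteq> ?p c ` piece ?F c" for c
  proof -
    have "w \<in> ?p c ` piece ?F c" if w: "w \<in> B (bclamp L c)" for w
    proof -
      have "(bclamp L c, w) \<in> ?P" using w by simp
      then have "(bclamp L c, w) \<in> h ` {0..<?m}" using bij_betw_imp_surj_on[OF h] by simp
      then obtain j where j: "j < ?m" "h j = (bclamp L c, w)" by auto
      have "?p c (unit_vec j) = (\<Sum>i<?m. if i = j then ?v j else 0)"
        unfolding free_map_def unit_vec_def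
        by (rule sum.cong) (use j str_id[OF N v[OF j(1)]] in auto)
      then have "?p c (unit_vec j) = w" using j by simp
      moreover have "unit_vec j \<in> piece ?F c" using unit_vec_in_free[of j ?m ?\<beta> L c] j by simp
      ultimately show ?thesis by blast
    qed
    moreover have "subspace (?p c ` piece ?F c)"
      by (rule subspace_linear_image[OF zn_vector_space[OF zn_module_free] zn_vector_space[OF N]
            zn_subspace[OF zn_module_free] hom_linear[OF p]])
    ultimately have "span (B (bclamp L c)) \<subseteq> ?p c ` piece ?F c" by (intro span_minimal) auto
    then show ?thesis using B(2) clampedD(1)[OF cl] by simp
  qed
  then have "zn_surj ?F N ?p" unfolding zn_surj_def using zn_hom_apply(1)[OF zn_module_free p] by blast
  then show thesis using that[of ?m ?\<beta> ?p] hP1 p by blast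
qed

text \<open>For \<open>b\<close> in the box, the simple module at \<open>b\<close> of the poset of
  box degrees, spread out over the fibre of the clamping map so that it is itself clamped. For other
  \<open>b\<close> it is zero.\<close>

definition skyscraper :: "int \<Rightarrow> int ^ 'n::finite \<Rightarrow> ('k::field, 'k, 'n) zn_module" where
  "skyscraper L b = indicator_module {c. bclamp L c = b}"

lemma zn_module_skyscraper: "is_zn_module (skyscraper L b :: ('k::field, 'k, 'n::finite) zn_module)"
  unfolding skyscraper_def
proof (rule zn_module_indicator)
  fix a c d :: "int ^ 'n"
  assume "a \<le> c" "c \<le> d" "a \<in> {c. bclamp L c = b}" "d \<in> {c. bclamp L c = b}"
  then show "c \<in> {c. bclamp L c = b}"
    using bclamp_mono[of a c L] bclamp_mono[of c d L] by simp
qed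

lemma clamped_skyscraper: "clamped L (skyscraper L b)"
  by (simp add: clamped_def skyscraper_def)

text \<open>
  In a free cover with the least number of summands the kernel lies in the radical: if a
  relation involved the generator \<open>j\<close> in the degree of \<open>j\<close>, that generator could be dropped.
\<close>

lemma minimal_free_cover_kernel:
  fixes N :: "('k::field, 'v::ab_group_add, 'n::finite) zn_module" and \<beta> :: "nat \<Rightarrow> int ^ 'n"
  assumes N: "is_zn_module N" and cl: "clamped L N" and L: "0 \<le> L"
    and box: "\<And>j. j < m \<Longrightarrow> bclamp L (\<beta> j) = \<beta> j"
    and p: "zn_hom (free_module L m \<beta>) N p" "zn_surj (free_module L m \<beta>) N p"
    and min: "\<And>(F :: ('k, 'n) std_module) p' m'. flat_cover N F p' \<Longrightarrow> flat_summands F m' \<Longrightarrow> m \<le> m'"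
    and h: "zn_hom (free_module L m \<beta>) (skyscraper L b) h"
    and x: "x \<in> piece (free_module L m \<beta>) c" and px: "p c x = 0"
  shows "h c x = 0"
proof (rule ccontr)
  let ?F = "free_module L m \<beta> :: ('k, 'n) std_module"
  let ?S = "skyscraper L b :: ('k, 'k, 'n) zn_module"
  note F = zn_module_free[of L m \<beta>, where ?'k = 'k] and clF = clamped_free_module[of L m \<beta>, where ?'k = 'k]
  interpret N: vector_space "scl N" by (rule zn_vector_space[OF N])
  assume "h c x \<noteq> 0"
  then have cb: "bclamp L c = b"
    using zn_hom_apply(1)[OF F h x] by (auto simp: skyscraper_def split: if_splits)
  have bb: "bclamp L b = b" using cb bclamp_bclamp by metis
  have xb: "x \<in> piece ?F b" using x cb bb by simp
  have hx: "h b x \<noteq> 0" and pxb: "p b x = 0"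
    using \<open>h c x \<noteq> 0\<close> clamped_hom[OF F zn_module_skyscraper clF clamped_skyscraper L h x]
      px clamped_hom[OF F N clF cl L p(1) x] cb by simp_all
  \<comment> \<open>A generator whose degree is not \<open>b\<close> is sent by \<open>h\<close> to
    a zero component, so only generators of degree exactly \<open>b\<close> can account for the
    nonzero value.\<close>
  have "\<exists>j<m. \<beta> j = b \<and> x j \<noteq> 0"
  proof (rule ccontr)
    assume none: "\<not> ?thesis"
    have "h b x = free_map L m \<beta> ?S (\<lambda>j. h (\<beta> j) (unit_vec j)) b x"
      by (rule free_hom_eq[OF zn_module_skyscraper clamped_skyscraper L h box xb])
    also have "\<dots> = 0"
      unfolding free_map_def by (rule sum.neutral) (use none box in \<open>auto simp: skyscraper_def\<close>)
    finally show False using hx by simp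
  qed
  then obtain j where j: "j < m" "\<beta> j = b" "x j \<noteq> 0" by blast
  \<comment> \<open>Generator \<open>j\<close> is dropped: \<open>\<sigma>\<close> renumbers the
    remaining ones and \<open>\<iota>\<close> embeds the smaller free module.\<close>
  define \<sigma> where "\<sigma> i = (if i < j then i else Suc i)" for i
  define \<iota> :: "int ^ 'n \<Rightarrow> (nat \<Rightarrow> 'k) \<Rightarrow> nat \<Rightarrow> 'k" where
    "\<iota> c y = (\<lambda>i. if i < j then y i else if i = j then 0 else y (i - 1))" for c y
  let ?F' = "free_module L (m - 1) (\<beta> \<circ> \<sigma>) :: ('k, 'n) std_module"
  have \<iota>in: "\<iota> c y \<in> piece ?F c" if "y \<in> piece ?F' c" for c y
  proof -
    have "i < m \<and> \<beta> i \<le> bclamp L c" if "\<iota> c y i \<noteq> 0" for i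
    proof (cases "i < j")
      case True
      then show ?thesis using that \<open>y \<in> piece ?F' c\<close> j(1) by (fastforce simp: \<iota>_def \<sigma>_def)
    next
      case False
      then have "i > j" "y (i - 1) \<noteq> 0" using that by (auto simp: \<iota>_def split: if_splits)
      then have "i - 1 < m - 1 \<and> \<beta> (\<sigma> (i - 1)) \<le> bclamp L c" "\<sigma> (i - 1) = i"
        using \<open>y \<in> piece ?F' c\<close> by (auto simp: \<sigma>_def)
      then show ?thesis using \<open>i > j\<close> by auto
    qed
    then show ?thesis by simp
  qed
  have \<iota>: "zn_hom ?F' ?F \<iota>"
  proof (rule zn_homI[OF \<iota>in], assumption)
    fix b c y assume bc: "b \<le> c" and y: "y \<in> piece ?F' b"
    show "\<iota> c (str ?F' b c y) = str ?F b c (\<iota> b y)"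
      using str_free_module[OF bc y] str_free_module[OF bc \<iota>in[OF y]] by (simp add: \<iota>_def)
  qed (auto simp: \<iota>_def fun_eq_iff)
  let ?p' = "\<lambda>c y. p c (\<iota> c y)"
  have "piece N c \<subseteq> ?p' c ` piece ?F' c" for c
  proof
    fix y assume "y \<in> piece N c"
    then have "y \<in> p c ` piece ?F c" using p(2) by (simp add: zn_surj_def del: free_module_simps)
    then obtain z where z: "z \<in> piece ?F c" "y = p c z" by blast
    \<comment> \<open>The relation \<open>x\<close> has a nonzero coordinate at \<open>j\<close>, so
      this multiple of it cancels the \<open>j\<close>-th coordinate of \<open>z\<close> without
      changing the image in \<open>N\<close>.\<close>
    define t where "t = z j / x j"
    let ?tx = "\<lambda>i. t * x i"
    \<comment> \<open>In general \<open>x\<close> may be absent from degree \<open>c\<close>. If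
      \<open>z j = 0\<close>, the multiple is zero; otherwise generator \<open>j\<close> is present
      in degree \<open>c\<close>, and then so is everything of degree \<open>b\<close>.\<close>
    have tx: "?tx \<in> piece ?F c \<and> p c ?tx = 0"
    proof (cases "z j = 0")
      case True
      then have "?tx = 0" by (simp add: t_def fun_eq_iff)
      then show ?thesis using zn_piece(1)[OF F] zn_hom_apply(5)[OF F p(1)] by metis
    next
      case False
      then have le: "b \<le> bclamp L c" using z(1) j by auto
      have xc: "x \<in> piece ?F c" using xb bb le order_trans by auto
      have "p (bclamp L c) x = 0"
        using hom_nat[OF p(1) le xb] str_free_module[OF le xb] pxb zn_str(5)[OF N le] by simp
      then have "p c x = 0" using clamped_hom[OF F N clF cl L p(1) xc] by simp
      then show ?thesis using zn_piece(4)[OF F xc, of t] zn_hom_apply(4)[OF F p(1) xc, of t] by simp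
    qed
    define w where "w = z - ?tx"
    have w: "w \<in> piece ?F c" "p c w = y"
      unfolding w_def using zn_piece(3)[OF F z(1) conjunct1[OF tx]]
        zn_hom_apply(3)[OF F p(1) z(1) conjunct1[OF tx]] conjunct2[OF tx] z(2) by simp_all
    have wj: "w j = 0" using j by (simp add: w_def t_def)
    have "\<iota> c (w \<circ> \<sigma>) = w" using wj by (auto simp: \<iota>_def \<sigma>_def fun_eq_iff)
    moreover have "w \<circ> \<sigma> \<in> piece ?F' c"
    proof -
      have "i < m - 1" if "w (\<sigma> i) \<noteq> 0" for i
      proof -
        have "\<sigma> i < m" using that w(1) by auto
        then show ?thesis using j(1) by (auto simp: \<sigma>_def split: if_splits)
      qed
      then show ?thesis using w(1) by auto
    qed
    ultimately show "y \<in> ?p' c ` piece ?F' c" using w(2) by (intro image_eqI[of _ _ "w \<circ> \<sigma>"]) simp_all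
  qed
  moreover have p': "zn_hom ?F' N ?p'" by (rule zn_hom_comp[OF \<iota> p(1)])
  ultimately have sur: "zn_surj ?F' N ?p'"
    unfolding zn_surj_def using zn_hom_apply(1)[OF zn_module_free p'] by blast
  have "bclamp L ((\<beta> \<circ> \<sigma>) i) = (\<beta> \<circ> \<sigma>) i" if "i < m - 1" for i
    using box[of "\<sigma> i"] that by (auto simp: \<sigma>_def)
  from flat_summands_free[of "m - 1", OF this] have fs: "flat_summands ?F' (m - 1)" .
  then have "flat_cover N ?F' ?p'"
    using p' sur unfolding flat_cover_def finite_flat_def by blast
  then have "m \<le> m - 1" using min fs by blast
  then show False using j(1) by simp
qed

text \<open>
  If \<open>\<phi>\<close> were not surjective, then its cokernel would map onto a skyscraper at a minimal degree;
  but such a map kills the image of \<open>\<phi>\<close> and, by minimality, the kernel of \<open>p\<close>.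
\<close>

lemma minimal_free_cover_surj:
  fixes N :: "('k::field, 'v::ab_group_add, 'n::finite) zn_module" and \<beta> \<beta>' :: "nat \<Rightarrow> int ^ 'n"
  assumes N: "is_zn_module N" and cl: "clamped L N" and L: "0 \<le> L"
    and box: "\<And>j. j < m \<Longrightarrow> bclamp L (\<beta> j) = \<beta> j"
    and p: "zn_hom (free_module L m \<beta>) N p" "zn_surj (free_module L m \<beta>) N p"
    and min: "\<And>(F :: ('k, 'n) std_module) p' m'. flat_cover N F p' \<Longrightarrow> flat_summands F m' \<Longrightarrow> m \<le> m'"
    and \<phi>: "zn_hom (free_module L m' \<beta>') (free_module L m \<beta>) \<phi>"
    and sur: "zn_surj (free_module L m' \<beta>') N (\<lambda>c x. p c (\<phi> c x))"
  shows "zn_surj (free_module L m' \<beta>' :: ('k, 'n) std_module) (free_module L m \<beta>) \<phi>"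
proof (rule ccontr)
  let ?G = "free_module L m \<beta> :: ('k, 'n) std_module" and ?F = "free_module L m' \<beta>' :: ('k, 'n) std_module"
  note F = zn_module_free[of L m' \<beta>', where ?'k = 'k] and clF = clamped_free_module[of L m' \<beta>', where ?'k = 'k]
  note G = zn_module_free[of L m \<beta>, where ?'k = 'k] and clG = clamped_free_module[of L m \<beta>, where ?'k = 'k]
  \<comment> \<open>The image of \<open>\<phi>\<close> is constant along the fibres of clamping, so
    a failure of surjectivity already occurs in the finite box and can be taken at a minimal
    degree.\<close>
  have fc: "\<phi> (bclamp L c) ` piece ?F (bclamp L c) = \<phi> c ` piece ?F c" for c
    using clampedD(1)[OF clF] clamped_hom[OF F G clF clG L \<phi>] by force
  assume "\<not> zn_surj ?F ?G \<phi>"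
  then obtain c0 where c0: "\<phi> c0 ` piece ?F c0 \<noteq> piece ?G c0" unfolding zn_surj_def by blast
  define X where "X = {b. bclamp L b = b \<and> \<phi> b ` piece ?F b \<noteq> piece ?G b}"
  have "finite X" by (rule finite_subset[OF _ finite_box[of L]]) (auto simp: X_def)
  moreover have "bclamp L c0 \<in> X"
    unfolding X_def mem_Collect_eq fc clampedD(1)[OF clG] using c0 by simp
  ultimately obtain b where b: "b \<in> X" and bmin: "\<And>c. c \<in> X \<Longrightarrow> c \<le> b \<Longrightarrow> c = b"
    using finite_has_minimal[of X] by auto
  have bb: "bclamp L b = b" using b by (simp add: X_def)
  have "\<phi> b ` piece ?F b \<subseteq> piece ?G b" using zn_hom_apply(1)[OF F \<phi>] by blast
  then obtain x where x: "x \<in> piece ?G b" "x \<notin> \<phi> b ` piece ?F b" using b X_def by blast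
  have "module.subspace (scl ?G) (\<phi> b ` piece ?F b)"
    by (rule subspace_linear_image[OF zn_vector_space[OF F] zn_vector_space[OF G] zn_subspace[OF F] hom_linear[OF \<phi>]])
  then obtain \<psi> where \<psi>: "Vector_Spaces.linear (scl ?G) (*) \<psi>" "\<And>y. y \<in> \<phi> b ` piece ?F b \<Longrightarrow> \<psi> y = 0" "\<psi> x = 1"
    using functional_separation[OF zn_vector_space[OF G] _ x(2)] by blast
  have \<psi>l: "\<psi> (u + v) = \<psi> u + \<psi> v" "\<psi> (scl ?G a u) = a * \<psi> u" for u v a
    using \<psi>(1) unfolding Vector_Spaces.linear_iff by blast+
  define h where "h c y = (if bclamp L c = b then \<psi> y else 0)" for c y
  let ?S = "skyscraper L b :: ('k, 'k, 'n) zn_module"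
  have h: "zn_hom ?G ?S h"
  proof (rule zn_homI)
    fix c d y assume cd: "c \<le> d" and y: "y \<in> piece ?G c"
    \<comment> \<open>Naturality of \<open>h\<close> rests on the minimality of \<open>b\<close>:
      whatever arrives from a strictly smaller box degree lies in the image of
      \<open>\<phi>\<close>, where \<open>\<psi>\<close> vanishes.\<close>
    have "\<psi> y = 0" if "bclamp L d = b" "bclamp L c \<noteq> b"
    proof -
      have le: "bclamp L c \<le> b" using bclamp_mono[OF cd, of L] that by simp
      then have "bclamp L c \<notin> X" using bmin that by blast
      then have "y \<in> \<phi> (bclamp L c) ` piece ?F (bclamp L c)"
        using y clampedD(1)[OF clG] unfolding X_def by simp
      then obtain u where u: "u \<in> piece ?F (bclamp L c)" "y = \<phi> (bclamp L c) u" by blast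
      have "\<phi> b (str ?F (bclamp L c) b u) = y"
        using hom_nat[OF \<phi> le u(1)] u zn_hom_apply(1)[OF F \<phi> u(1)] str_free_module[OF le, of y L m \<beta>] by simp
      then show ?thesis using \<psi>(2) zn_str(1)[OF F le u(1)] by blast
    qed
    then show "h d (str ?G c d y) = str ?S c d (h c y)"
      unfolding str_free_module[OF cd y] by (auto simp: h_def skyscraper_def)
  qed (use \<psi>l in \<open>auto simp: h_def skyscraper_def\<close>)
  \<comment> \<open>Surjectivity onto \<open>N\<close> gives \<open>u\<close> with
    \<open>x - \<phi> b u\<close> in the kernel of \<open>p\<close>. Minimality makes
    \<open>h\<close> vanish there, while \<open>h\<close> is 1 at \<open>x\<close> and 0 at
    \<open>\<phi> b u\<close>.\<close>
  have "p b x \<in> (\<lambda>x. p b (\<phi> b x)) ` piece ?F b"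
    using sur zn_hom_apply(1)[OF G p(1) x(1)] unfolding zn_surj_def by blast
  then obtain u where u: "u \<in> piece ?F b" "p b x = p b (\<phi> b u)" by blast
  have \<phi>u: "\<phi> b u \<in> piece ?G b" by (rule zn_hom_apply(1)[OF F \<phi> u(1)])
  have "h b (x - \<phi> b u) = 0"
    by (rule minimal_free_cover_kernel[OF N cl L box p min h])
      (use zn_piece(3)[OF G x(1) \<phi>u] zn_hom_apply(3)[OF G p(1) x(1) \<phi>u] u in auto)
  then have "h b x = h b (\<phi> b u)" using zn_hom_apply(3)[OF G h x(1) \<phi>u] by simp
  then show False using \<psi>(2)[of "\<phi> b u"] u(1) \<psi>(3) bb by (simp add: h_def)
qed

section \<open>Minimal flat covers: existence and uniqueness\<close>

lemma zn_iso_sym: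
  assumes "is_zn_module M" "zn_iso M N f"
  shows "\<exists>g. zn_iso N M g"
  by (rule zn_iso_inverse[OF assms]) (rule exI)

text \<open>The image of a basis still spans, hence cannot have fewer elements than the basis; so it
  remains independent, and the map is injective.\<close>

lemma finite_dim_surj_inj:
  fixes s :: "'k::field \<Rightarrow> 'v::ab_group_add \<Rightarrow> 'v"
  assumes s: "vector_space s" and V: "module.subspace s V" and B: "finite B" "module.span s B = V"
    and f: "linear_between s s V V f" and sur: "f ` V = V"
  shows "inj_on f V"
proof -
  obtain f' where f': "Vector_Spaces.linear s s f'" "\<And>x. x \<in> V \<Longrightarrow> f' x = f x"
    using linear_between_extend[OF s s V f] by blast
  interpret vector_space_pair s s using s by (simp add: vector_space_pair_def)
  interpret Vector_Spaces.linear s s f' by fact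
  obtain C where C: "finite C" "vs1.span C = V" "vs1.independent C" "C \<subseteq> V"
    using finite_basis_subspace[OF s V order_refl B] by blast
  have sp: "vs1.span (f' ` C) = V"
    using span_image[of C] C(2) f'(2) sur by (metis image_cong)
  have le: "card C \<le> card D" if "finite D" "vs1.span D = V" for D
    using vs1.independent_span_bound[OF that(1) C(3)] C(4) that(2) by simp
  have eq: "card (f' ` C) = card C"
    using le[of "f' ` C"] sp C(1) card_image_le[OF C(1), of f'] by simp
  have "vs1.independent (f' ` C)"
  proof
    assume "vs1.dependent (f' ` C)"
    then obtain a where a: "a \<in> f' ` C" "a \<in> vs1.span (f' ` C - {a})"
      unfolding vs1.dependent_def by blast
    have "vs1.span (f' ` C - {a}) = V"
      using vs1.span_redundant[OF a(2)] a(1) sp by (simp add: insert_absorb)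
    then have "card C \<le> card (f' ` C - {a})" using le C(1) by simp
    then show False using eq a(1) C(1) card_Diff1_less[of "f' ` C" a] by simp
  qed
  moreover have "inj_on f' C" using eq_card_imp_inj_on[OF C(1) eq] .
  ultimately have "inj_on f' V" using inj_on_span_iff_independent_image C(2) by blast
  then show ?thesis using inj_on_cong[of V f' f] f'(2) by blast
qed

text \<open>The composite is a surjective endomorphism of each finite-dimensional component, hence
  injective. This yields uniqueness without comparing numbers of summands or decompositions.\<close>

lemma zn_iso_of_two_surjections:
  assumes M: "is_zn_module M" "zn_finite M" and N: "is_zn_module N"
    and f: "zn_hom M N f" "zn_surj M N f" and g: "zn_hom N M g" "zn_surj N M g"
  shows "zn_iso M N f"
proof (rule zn_isoI[OF f(1)])
  fix b
  obtain B where B: "finite B" "module.span (scl M) B = piece M b" using M unfolding zn_finite_def by blast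
  have "(\<lambda>x. g b (f b x)) ` piece M b = piece M b"
    using f(2) g(2) unfolding zn_surj_def by (metis image_image)
  then have "inj_on (\<lambda>x. g b (f b x)) (piece M b)"
    by (rule finite_dim_surj_inj[OF zn_vector_space[OF M(1)] zn_subspace[OF M(1)] B
          hom_linear[OF zn_hom_comp[OF f(1) g(1)]]])
  then have "inj_on (f b) (piece M b)" by (auto simp: inj_on_def)
  then show "bij_betw (f b) (piece M b) (piece N b)"
    using f(2) by (simp add: bij_betw_def zn_surj_def)
qed

lemma zn_surj_comp: "zn_surj M N f \<Longrightarrow> zn_surj N P g \<Longrightarrow> zn_surj M P (\<lambda>b x. g b (f b x))"
  unfolding zn_surj_def by (metis image_image)

lemma flat_cover_target:
  assumes "flat_cover N F p" "zn_iso N N' \<theta>"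
  shows "flat_cover N' F (\<lambda>b x. \<theta> b (p b x))"
  using assms zn_hom_comp[of F N p N' \<theta>] zn_surj_comp[of F N p N' \<theta>] by (simp add: flat_cover_def zn_iso_def)

lemma flat_cover_cong:
  assumes "flat_cover N F p" "\<And>b x. x \<in> piece F b \<Longrightarrow> p' b x = p b x"
  shows "flat_cover N F p'"
proof -
  have "is_zn_module F" using assms(1) by (auto simp: flat_cover_def finite_flat_def flat_summands_def)
  then have "zn_hom F N p'" using zn_hom_cong[of F N p p'] assms by (simp add: flat_cover_def)
  moreover have "zn_surj F N p'" using assms unfolding flat_cover_def zn_surj_def by (metis image_cong)
  ultimately show ?thesis using assms(1) by (simp add: flat_cover_def)
qed

lemma minimal_flat_cover_cong:
  assumes "minimal_flat_cover N F p" "\<And>b x. x \<in> piece F b \<Longrightarrow> p' b x = p b x"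
  shows "minimal_flat_cover N F p'"
  using assms flat_cover_cong[of N F p p'] unfolding minimal_flat_cover_def by blast

text \<open>The half of minimality that concerns only \<open>N\<close>. It can be transported along
  isomorphisms of \<open>N\<close>, independently of any particular cover.\<close>

definition flat_cover_bound :: "('k::field, 'v::ab_group_add, 'n::finite) zn_module \<Rightarrow> nat \<Rightarrow> bool" where
  "flat_cover_bound N m \<longleftrightarrow> (\<forall>(F :: ('k, 'n) std_module) p m'.
     flat_cover N F p \<and> flat_summands F m' \<longrightarrow> m \<le> m')"

lemma minimal_flat_cover_iff:
  "minimal_flat_cover N F p \<longleftrightarrow> flat_cover N F p \<and> (\<exists>m. flat_summands F m \<and> flat_cover_bound N m)"
  by (simp add: minimal_flat_cover_def flat_cover_bound_def)

lemma flat_cover_bound_iso: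
  assumes N: "is_zn_module N" and th: "zn_iso N N' \<theta>" and b: "flat_cover_bound N m"
  shows "flat_cover_bound N' m"
proof -
  obtain \<theta>' where "zn_iso N' N \<theta>'" using zn_iso_sym[OF N th] by blast
  then have "flat_cover N F (\<lambda>b x. \<theta>' b (p b x))" if "flat_cover N' F p" for F :: "('a, 'c) std_module" and p
    using flat_cover_target[OF that] by blast
  then show ?thesis using b unfolding flat_cover_bound_def by blast
qed

lemma minimal_flat_cover_target:
  assumes "is_zn_module N" "zn_iso N N' \<theta>" "minimal_flat_cover N F p"
  shows "minimal_flat_cover N' F (\<lambda>b x. \<theta> b (p b x))"
  using assms(3) flat_cover_target[OF _ assms(2)] flat_cover_bound_iso[OF assms(1,2)]
  unfolding minimal_flat_cover_iff by auto

lemma flat_cover_module: "flat_cover N F p \<Longrightarrow> is_zn_module F"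
  by (auto simp: flat_cover_def finite_flat_def flat_summands_def)

lemma minimal_flat_coverD:
  assumes "minimal_flat_cover N F p"
  shows "is_zn_module F" "zn_hom F N p" "zn_surj F N p" "finite_flat F" "finitely_determined F" "flat_cover N F p"
  using assms flat_cover_module[of N F p] finitely_determined_flat[of F]
  by (auto simp: minimal_flat_cover_def flat_cover_def finite_flat_def)

text \<open>Clamping provides one free cover, so some number of summands occurs; a cover attaining
  the least such number is minimal.\<close>

lemma minimal_flat_cover_exists:
  fixes N :: "('k::field, 'v::ab_group_add, 'n::finite) zn_module"
  assumes N: "is_zn_module N" and fd: "finitely_determined N"
  obtains F :: "('k, 'n) std_module" and p where "minimal_flat_cover N F p"
proof -
  obtain L where L: "L \<ge> 0" "determined_in L N" using fd unfolding finitely_determined_iff by auto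
  obtain \<kappa> where \<kappa>: "zn_iso N (clamp_module L N) \<kappa>" using iso_clamp_module[OF N L(2,1)] by blast
  note C = zn_module_clamp_module[OF N, of L]
  obtain \<kappa>' where \<kappa>': "zn_iso (clamp_module L N) N \<kappa>'" using zn_iso_sym[OF N \<kappa>] by blast
  have "zn_finite (clamp_module L N)"
    using finitely_determined_iso[OF N C \<kappa> fd] by (simp add: finitely_determined_def)
  then obtain m \<beta> p where mp: "\<And>j. j < m \<Longrightarrow> bclamp L (\<beta> j) = \<beta> j"
    "zn_hom (free_module L m \<beta>) (clamp_module L N) p"
    "zn_surj (free_module L m \<beta> :: ('k, 'n) std_module) (clamp_module L N) p"
    using free_cover_exists[OF C clamped_clamp_module _ L(1)] by blast
  let ?P = "\<lambda>m. \<exists>(F :: ('k, 'n) std_module) p. flat_cover N F p \<and> flat_summands F m"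
  have fs: "flat_summands (free_module L m \<beta> :: ('k, 'n) std_module) m" by (rule flat_summands_free[OF mp(1)])
  then have "flat_cover (clamp_module L N) (free_module L m \<beta> :: ('k, 'n) std_module) p"
    using mp by (auto simp: flat_cover_def finite_flat_def)
  then have "?P m" using flat_cover_target[OF _ \<kappa>'] fs by blast
  then have "?P (LEAST m. ?P m)" by (rule LeastI)
  then obtain F :: "('k, 'n) std_module" and p where Fp: "flat_cover N F p" "flat_summands F (LEAST m. ?P m)" by blast
  moreover have "flat_cover_bound N (LEAST m. ?P m)"
    unfolding flat_cover_bound_def by (intro allI impI Least_le) blast
  ultimately show thesis using that unfolding minimal_flat_cover_iff by blast
qed

text \<open>Relative projectivity of the source gives the lift, and minimality of the target makes
  it surjective.\<close>

lemma minimal_free_covers_lift: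
  fixes N :: "('k::field, 'v::ab_group_add, 'n::finite) zn_module" and \<beta> \<beta>' :: "nat \<Rightarrow> int ^ 'n"
  assumes N: "is_zn_module N" and cl: "clamped L N" and L: "0 \<le> L"
    and box: "\<And>j. j < m \<Longrightarrow> bclamp L (\<beta> j) = \<beta> j" and box': "\<And>j. j < m' \<Longrightarrow> bclamp L (\<beta>' j) = \<beta>' j"
    and p: "zn_hom (free_module L m \<beta>) N p" "zn_surj (free_module L m \<beta>) N p"
    and p': "zn_hom (free_module L m' \<beta>') N p'" "zn_surj (free_module L m' \<beta>') N p'"
    and b: "flat_cover_bound N m'"
  obtains \<phi> where "zn_hom (free_module L m \<beta>) (free_module L m' \<beta>') \<phi>"
    "zn_surj (free_module L m \<beta> :: ('k, 'n) std_module) (free_module L m' \<beta>') \<phi>"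
    "\<And>c x. x \<in> piece (free_module L m \<beta>) c \<Longrightarrow> p' c (\<phi> c x) = p c x"
proof -
  obtain \<phi> where \<phi>: "zn_hom (free_module L m \<beta>) (free_module L m' \<beta>') \<phi>"
    "\<And>c x. x \<in> piece (free_module L m \<beta>) c \<Longrightarrow> p' c (\<phi> c x) = p c x"
    using free_lift[OF zn_module_free clamped_free_module N cl L box p' p(1)] by blast
  have "zn_surj (free_module L m \<beta>) N (\<lambda>c x. p' c (\<phi> c x))"
    using p(2) \<phi>(2) unfolding zn_surj_def by (metis image_cong)
  then have "zn_surj (free_module L m \<beta> :: ('k, 'n) std_module) (free_module L m' \<beta>') \<phi>"
    using b unfolding flat_cover_bound_def
    by (intro minimal_free_cover_surj[OF N cl L box' p' _ \<phi>(1)]) blast+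
  then show thesis using that \<phi> by blast
qed

lemma minimal_flat_cover_unique:
  fixes N :: "('k::field, 'v::ab_group_add, 'n::finite) zn_module"
    and F :: "('k, 'f::ab_group_add, 'n) zn_module" and F' :: "('k, 'g::ab_group_add, 'n) zn_module"
  assumes N: "is_zn_module N" and fd: "finitely_determined N"
    and p: "minimal_flat_cover N F p" and p': "minimal_flat_cover N F' p'"
  obtains \<alpha> where "zn_iso F F' \<alpha>" "\<And>b x. x \<in> piece F b \<Longrightarrow> p' b (\<alpha> b x) = p b x"
proof -
  note pD = minimal_flat_coverD[OF p] and pD' = minimal_flat_coverD[OF p']
  obtain m m' where m: "flat_summands F m" "flat_cover_bound N m"
    and m': "flat_summands F' m'" "flat_cover_bound N m'"
    using p p' unfolding minimal_flat_cover_iff by blast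
  obtain L1 where L1: "L1 \<ge> 0" "\<And>L'. L' \<ge> L1 \<Longrightarrow> determined_in L' N"
    using finitely_determinedE[OF fd] by blast
  obtain L2 where L2: "\<And>L'. L' \<ge> L2 \<Longrightarrow> \<exists>\<beta> a. (\<forall>j<m. bclamp L' (\<beta> j) = \<beta> j) \<and>
    zn_iso F (free_module L' m \<beta> :: ('k, 'n) std_module) a" using flat_summandsE[OF m(1)] by blast
  obtain L3 where L3: "\<And>L'. L' \<ge> L3 \<Longrightarrow> \<exists>\<beta> a. (\<forall>j<m'. bclamp L' (\<beta> j) = \<beta> j) \<and>
    zn_iso F' (free_module L' m' \<beta> :: ('k, 'n) std_module) a" using flat_summandsE[OF m'(1)] by blast
  \<comment> \<open>One radius has to serve \<open>N\<close> and both covers, as lifts are available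
    only between modules clamped to the same box.\<close>
  define L where "L = max L1 (max L2 L3)"
  have L: "0 \<le> L" "L1 \<le> L" "L2 \<le> L" "L3 \<le> L" using L1(1) by (auto simp: L_def)
  obtain \<beta> a where \<beta>: "\<And>j. j < m \<Longrightarrow> bclamp L (\<beta> j) = \<beta> j"
    and a: "zn_iso F (free_module L m \<beta> :: ('k, 'n) std_module) a" using L2[OF L(3)] by blast
  obtain \<beta>' a' where \<beta>': "\<And>j. j < m' \<Longrightarrow> bclamp L (\<beta>' j) = \<beta>' j"
    and a': "zn_iso F' (free_module L m' \<beta>' :: ('k, 'n) std_module) a'" using L3[OF L(4)] by blast
  let ?G = "free_module L m \<beta> :: ('k, 'n) std_module" and ?G' = "free_module L m' \<beta>' :: ('k, 'n) std_module"
  note G = zn_module_free[of L m \<beta>, where ?'k = 'k] and G' = zn_module_free[of L m' \<beta>', where ?'k = 'k]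
  obtain \<kappa> where \<kappa>: "zn_iso N (clamp_module L N) \<kappa>" using iso_clamp_module[OF N L1(2)[OF L(2)] L(1)] by blast
  let ?C = "clamp_module L N"
  note C = zn_module_clamp_module[OF N, of L] clamped_clamp_module[of L N]
  obtain ai where ai: "zn_iso ?G F ai" "\<And>b x. x \<in> piece F b \<Longrightarrow> ai b (a b x) = x"
    "\<And>b x. x \<in> piece ?G b \<Longrightarrow> a b (ai b x) = x"
    by (rule zn_iso_inverse[OF pD(1) a]) (rule that; assumption)
  obtain ai' where ai': "zn_iso ?G' F' ai'" using zn_iso_sym[OF pD'(1) a'] by blast
  define P where "P = (\<lambda>b x. \<kappa> b (p b (ai b x)))"
  define P' where "P' = (\<lambda>b x. \<kappa> b (p' b (ai' b x)))"
  have hP: "zn_hom ?G ?C P" "zn_surj ?G ?C P"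
    unfolding P_def using zn_hom_comp[OF zn_hom_comp[OF zn_isoD(1)[OF ai(1)] pD(2)] zn_isoD(1)[OF \<kappa>]]
      zn_surj_comp[OF zn_surj_comp[of ?G F ai N p] , of ?C \<kappa>] pD(3) ai(1) \<kappa> by (simp_all add: zn_iso_def)
  have hP': "zn_hom ?G' ?C P'" "zn_surj ?G' ?C P'"
    unfolding P'_def using zn_hom_comp[OF zn_hom_comp[OF zn_isoD(1)[OF ai'(1)] pD'(2)] zn_isoD(1)[OF \<kappa>]]
      zn_surj_comp[OF zn_surj_comp[of ?G' F' ai' N p'] , of ?C \<kappa>] pD'(3) ai'(1) \<kappa> by (simp_all add: zn_iso_def)
  have bC: "flat_cover_bound ?C m" "flat_cover_bound ?C m'" using flat_cover_bound_iso[OF N \<kappa>] m m' by blast+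
  obtain \<phi> where \<phi>: "zn_hom ?G ?G' \<phi>" "zn_surj ?G ?G' \<phi>" "\<And>c x. x \<in> piece ?G c \<Longrightarrow> P' c (\<phi> c x) = P c x"
    by (rule minimal_free_covers_lift[OF C L(1) \<beta> \<beta>' hP hP' bC(2)]) (assumption+, (rule that; assumption))
  obtain \<psi> where \<psi>: "zn_hom ?G' ?G \<psi>" "zn_surj ?G' ?G \<psi>"
    "\<And>c x. x \<in> piece ?G' c \<Longrightarrow> P c (\<psi> c x) = P' c x"
    by (rule minimal_free_covers_lift[OF C L(1) \<beta>' \<beta> hP' hP bC(1)]) (assumption+, (rule that; assumption))
  \<comment> \<open>The map \<open>\<psi>\<close> only certifies that \<open>\<phi>\<close> is
    bijective; \<open>\<phi>\<close> already commutes with the covers.\<close>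
  have iso: "zn_iso ?G ?G' \<phi>" by (rule zn_iso_of_two_surjections[OF G zn_finite_free G' \<phi>(1,2) \<psi>(1,2)])
  define \<alpha> where "\<alpha> = (\<lambda>b x. ai' b (\<phi> b (a b x)))"
  have al: "zn_iso F F' \<alpha>" unfolding \<alpha>_def by (rule zn_iso_trans[OF zn_iso_trans[OF a iso] ai'(1)])
  have "p' b (\<alpha> b x) = p b x" if x: "x \<in> piece F b" for b x
  proof -
    have ax: "a b x \<in> piece ?G b" by (rule zn_hom_apply(1)[OF pD(1) zn_isoD(1)[OF a] x])
    have "\<kappa> b (p' b (\<alpha> b x)) = \<kappa> b (p b x)"
      using \<phi>(3)[OF ax] ai(2)[OF x] by (simp add: P_def P'_def \<alpha>_def)
    then show ?thesis
      using zn_isoD(3)[OF \<kappa> zn_hom_apply(1)[OF pD'(1,2) zn_hom_apply(1)[OF pD(1) zn_isoD(1)[OF al] x]]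
          zn_hom_apply(1)[OF pD(1,2) x]] by blast
  qed
  then show thesis using that al by blast
qed

text \<open>The form used in inductions, where the modules being covered are successive kernels,
  identified only up to an isomorphism \<open>\<theta>\<close>.\<close>

lemma minimal_flat_cover_unique_iso:
  fixes N :: "('k::field, 'v::ab_group_add, 'n::finite) zn_module"
    and F :: "('k, 'f::ab_group_add, 'n) zn_module" and F' :: "('k, 'g::ab_group_add, 'n) zn_module"
  assumes N: "is_zn_module N" and fd: "finitely_determined N" and N': "is_zn_module N'"
    and th: "zn_iso N N' \<theta>" and p: "minimal_flat_cover N F p" and p': "minimal_flat_cover N' F' p'"
  obtains \<alpha> where "zn_iso F F' \<alpha>" "\<And>b x. x \<in> piece F b \<Longrightarrow> p' b (\<alpha> b x) = \<theta> b (p b x)"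
  by (rule minimal_flat_cover_unique[OF N' finitely_determined_iso[OF N N' th fd]
        minimal_flat_cover_target[OF N th p] p']) (rule that; assumption)

section \<open>Vanishing of Ext into skyscrapers\<close>

text \<open>
  The modules that filter a skyscraper: in the coordinates \<open>A\<close> the support is the single value
  \<open>b $ i\<close>, in the others it extends down to infinity.
\<close>

definition slab :: "int \<Rightarrow> 'n set \<Rightarrow> int ^ 'n::finite \<Rightarrow> (int ^ 'n) set" where
  "slab L A b = {c. \<forall>i. if i \<in> A then bclamp L c $ i = b $ i else bclamp L c $ i \<le> b $ i}"

definition slab_module :: "int \<Rightarrow> 'n set \<Rightarrow> int ^ 'n::finite \<Rightarrow> ('k::field, 'k, 'n) zn_module" where
  "slab_module L A b = indicator_module (slab L A b)"

lemma zn_module_slab: "is_zn_module (slab_module L A b :: ('k::field, 'k, 'n::finite) zn_module)"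
  unfolding slab_module_def
proof (rule zn_module_indicator)
  fix a c d :: "int ^ 'n"
  assume ac: "a \<le> c" "c \<le> d" "a \<in> slab L A b" "d \<in> slab L A b"
  have "bclamp L a $ i \<le> bclamp L c $ i" "bclamp L c $ i \<le> bclamp L d $ i" for i
    using bclamp_mono[OF ac(1), of L] bclamp_mono[OF ac(2), of L] by (auto simp: less_eq_vec_def)
  then show "c \<in> slab L A b" using ac(3,4) unfolding slab_def by (smt (verit) mem_Collect_eq)
qed

lemma clamped_slab: "clamped L (slab_module L A b)"
proof -
  have "bclamp L c \<in> slab L A b \<longleftrightarrow> c \<in> slab L A b" for c by (simp add: slab_def)
  then show ?thesis by (simp add: clamped_def slab_module_def)
qed

lemma slab_UNIV: "slab_module L UNIV b = skyscraper L b"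
  by (simp add: slab_module_def slab_def skyscraper_def vec_eq_iff)

lemma slab_module_simps [simp]:
  "scl (slab_module L A b) = (*)" "piece (slab_module L A b) c = (if c \<in> slab L A b then UNIV else {0})"
  "str (slab_module L A b) c d x = (if c \<in> slab L A b \<and> d \<in> slab L A b then x else 0)"
  by (simp_all add: slab_module_def)

text \<open>The sets behind a short exact sequence with submodule on
  \<open>slab L (insert a A) b\<close>, middle term on \<open>slab L A b\<close> and quotient on
  \<open>slab L A (b - axis a 1)\<close>: an integer equals \<open>b $ a\<close> iff it is at most
  \<open>b $ a\<close> but not at most \<open>b $ a - 1\<close>.\<close>

lemma slab_insert:
  assumes "a \<notin> A"
  shows "slab L (insert a A) b = slab L A b - slab L A (b - axis a 1)"
    "slab L A (b - axis a 1) \<subseteq> slab L A b"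
proof -
  let ?P = "\<lambda>c b. (\<forall>i\<in>A. bclamp L c $ i = b $ i) \<and> (\<forall>i. i \<notin> A \<and> i \<noteq> a \<longrightarrow> bclamp L c $ i \<le> b $ i)"
  have e: "(b - axis a 1) $ i = (if i = a then b $ i - 1 else b $ i)" for i by (simp add: axis_def)
  have 1: "c \<in> slab L A b \<longleftrightarrow> ?P c b \<and> bclamp L c $ a \<le> b $ a" for c b
    unfolding slab_def mem_Collect_eq using assms by metis
  have 2: "c \<in> slab L (insert a A) b \<longleftrightarrow> ?P c b \<and> bclamp L c $ a = b $ a" for c
    unfolding slab_def mem_Collect_eq using assms by (metis insert_iff)
  have "?P c (b - axis a 1) = ?P c b" for c unfolding e using assms by auto
  then have 3: "c \<in> slab L A (b - axis a 1) \<longleftrightarrow> ?P c b \<and> bclamp L c $ a \<le> b $ a - 1" for c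
    unfolding 1 using e[of a] by simp
  show "slab L (insert a A) b = slab L A b - slab L A (b - axis a 1)"
    unfolding set_eq_iff Diff_iff 1[of _ b] 2 3 by auto
  show "slab L A (b - axis a 1) \<subseteq> slab L A b"
    unfolding subset_iff 1[of _ b] 3 by auto
qed

text \<open>With the bounds \<open>b - axis a 1\<close> compared to the bounds \<open>b\<close>,
  this is downward closure of the smaller slab, which makes restriction to it a natural quotient
  map.\<close>

lemma slab_down:
  assumes "c \<le> d" "d \<in> slab L A b" "c \<in> slab L A b'" "\<And>i. i \<in> A \<Longrightarrow> b $ i = b' $ i"
  shows "c \<in> slab L A b"
proof -
  have "bclamp L c $ i \<le> bclamp L d $ i" for i
    using bclamp_mono[OF assms(1), of L] by (auto simp: less_eq_vec_def)
  then show ?thesis using assms(2-4) unfolding slab_def mem_Collect_eq by (metis (full_types) order_trans)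
qed

text \<open>Fixing one more coordinate at its upper bound cuts out an upward closed part, which
  makes the inclusion of the corresponding module natural.\<close>

lemma slab_up:
  assumes "a \<notin> A" "c \<le> d" "c \<in> slab L (insert a A) b" "d \<in> slab L A b"
  shows "d \<in> slab L (insert a A) b"
proof -
  have "bclamp L c $ a \<le> bclamp L d $ a"
    using bclamp_mono[OF assms(2), of L] by (auto simp: less_eq_vec_def)
  then show ?thesis using assms unfolding slab_def mem_Collect_eq by (metis insert_iff order_antisym)
qed

text \<open>Lowering coordinates can push the bound \<open>b\<close> below the box, in which case
  nothing is left. Otherwise the slab consists of the degrees clamped below a single box degree, so
  homomorphisms from clamped modules into its module are functionals in that one degree.\<close>

lemma slab_empty_cases:
  fixes b :: "int ^ 'n::finite"
  assumes "0 \<le> L"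
  obtains "slab L {} b = {}" | b0 where "bclamp L b0 = b0" "\<And>c. c \<in> slab L {} b \<longleftrightarrow> bclamp L c \<le> b0"
proof (cases "\<forall>i. - L \<le> b $ i")
  case True
  have "c \<in> slab L {} b \<longleftrightarrow> bclamp L c \<le> bclamp L b" for c
    unfolding slab_def less_eq_vec_def bclamp_def using True assms
    by (auto simp: max_def min_def) (smt (verit))+
  then show thesis using that(2) bclamp_bclamp by blast
next
  case False
  then obtain i where "b $ i < - L" by (metis not_le)
  then have "slab L {} b = {}" unfolding slab_def bclamp_def by (auto simp: max_def) (smt (verit))
  then show thesis by (rule that(1))
qed

text \<open>The terms \<open>0\<close> to \<open>K\<close> of a resolution, with all generators in
  one box. Minimality is recorded in the form in which it is used: homomorphisms to skyscrapers
  vanish on the kernels of the differentials.\<close>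

locale free_complex =
  fixes L :: int and m :: "nat \<Rightarrow> nat" and \<beta> :: "nat \<Rightarrow> nat \<Rightarrow> int ^ 'n::finite"
    and d :: "nat \<Rightarrow> int ^ 'n \<Rightarrow> (nat \<Rightarrow> 'k::field) \<Rightarrow> nat \<Rightarrow> 'k" and K :: nat
  assumes L: "0 \<le> L"
    and box: "\<And>i j. i \<le> K \<Longrightarrow> j < m i \<Longrightarrow> bclamp L (\<beta> i j) = \<beta> i j"
    and hom: "\<And>i. i < K \<Longrightarrow> zn_hom (free_module L (m (Suc i)) (\<beta> (Suc i))) (free_module L (m i) (\<beta> i)) (d i)"
    and exact: "\<And>i c x. Suc i < K \<Longrightarrow> x \<in> piece (free_module L (m (Suc i)) (\<beta> (Suc i))) c \<Longrightarrow>
      d i c x = 0 \<longleftrightarrow> x \<in> d (Suc i) c ` piece (free_module L (m (Suc (Suc i))) (\<beta> (Suc (Suc i)))) c"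
    and minimal: "\<And>i b h c x. Suc i < K \<Longrightarrow> zn_hom (free_module L (m (Suc i)) (\<beta> (Suc i))) (skyscraper L b) h \<Longrightarrow>
      x \<in> piece (free_module L (m (Suc i)) (\<beta> (Suc i))) c \<Longrightarrow> d i c x = 0 \<Longrightarrow> h c x = (0::'k)"
begin

abbreviation G :: "nat \<Rightarrow> ('k, 'n) std_module" where "G i \<equiv> free_module L (m i) (\<beta> i)"

lemma d_d: "Suc i < K \<Longrightarrow> x \<in> piece (G (Suc (Suc i))) c \<Longrightarrow> d i c (d (Suc i) c x) = 0"
  using exact[of i "d (Suc i) c x" c] zn_hom_apply(1)[OF zn_module_free hom[of "Suc i"]] by blast

text \<open>Vanishing of the higher Ext groups into a slab module, by induction on the number of
  bounded coordinates; without bounded coordinates the slab module is injective.\<close>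

lemma cocycle_factors:
  assumes "finite A"
  shows "card A \<le> k \<Longrightarrow> Suc k < K \<Longrightarrow> zn_hom (G (Suc k)) (slab_module L A b) g \<Longrightarrow>
    (\<And>c x. x \<in> piece (G (Suc (Suc k))) c \<Longrightarrow> g c (d (Suc k) c x) = (0::'k)) \<Longrightarrow>
    \<exists>h. zn_hom (G k) (slab_module L A b) h \<and> (\<forall>c. \<forall>x\<in>piece (G (Suc k)) c. g c x = h c (d k c x))"
  using assms
proof (induction A arbitrary: k b g rule: finite_induct)
  case empty
  note g = empty.prems(3)
  have dk: "zn_hom (G (Suc k)) (G k) (d k)" using hom empty.prems(2) by simp
  have gker: "g c x = 0" if "x \<in> piece (G (Suc k)) c" "d k c x = 0" for c x
    using exact[OF empty.prems(2) that(1)] that(2) empty.prems(4) by blast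
  from L show ?case
  proof (cases rule: slab_empty_cases[of L b])
    case 1
    have "g c x = 0" if "x \<in> piece (G (Suc k)) c" for c x
      using zn_hom_apply(1)[OF zn_module_free g that] 1 by simp
    moreover have "zn_hom (G k) (slab_module L {} b) (\<lambda>c x. 0)" by (rule zn_homI) auto
    ultimately show ?thesis by (intro exI[of _ "\<lambda>c x. 0"]) simp
  next
    case (2 b0)
    \<comment> \<open>A homomorphism into this slab module is a functional in degree
      \<open>b0\<close>, so factoring \<open>g\<close> through \<open>d k\<close> is linear algebra
      in that one degree.\<close>
    let ?V = "piece (G (Suc k)) b0" and ?s = "scl (G k)"
    have lin: "linear_between ?s (*) ?V UNIV (g b0)"
      using hom_linear[OF g, of b0] by (auto simp: linear_between_def)
    obtain \<psi> where \<psi>: "Vector_Spaces.linear ?s (*) \<psi>" "\<And>x. x \<in> ?V \<Longrightarrow> \<psi> (d k b0 x) = g b0 x"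
    proof (rule functional_factor[of ?s ?s ?V _ "d k b0" "g b0"])
      show "vector_space ?s" by (rule zn_vector_space[OF zn_module_free])
      then show "vector_space ?s" .
      show "module.subspace ?s ?V" using zn_subspace[OF zn_module_free[of L "m (Suc k)"]] by simp
      show "linear_between ?s ?s ?V (piece (G k) b0) (d k b0)" using hom_linear[OF dk, of b0] by simp
    qed (use lin gker in auto)
    have \<psi>l: "\<psi> (u + v) = \<psi> u + \<psi> v" "\<psi> (?s a u) = a * \<psi> u" for u v a
      using \<psi>(1) unfolding Vector_Spaces.linear_iff by blast+
    define h where "h c y = (if bclamp L c \<le> b0 then \<psi> y else 0)" for c y
    have "zn_hom (G k) (slab_module L {} b) h"
    proof (rule zn_homI)
      fix c e y assume ce: "c \<le> e" and y: "y \<in> piece (G k) c"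
      have "bclamp L c \<le> b0" if "bclamp L e \<le> b0" using that bclamp_mono[OF ce, of L] by simp
      then show "h e (str (G k) c e y) = str (slab_module L {} b) c e (h c y)"
        unfolding str_free_module[OF ce y] by (auto simp: h_def 2(2))
    qed (use \<psi>l in \<open>auto simp: h_def 2(2)\<close>)
    moreover have "g c x = h c (d k c x)" if x: "x \<in> piece (G (Suc k)) c" for c x
    proof (cases "bclamp L c \<le> b0")
      case True
      have xc: "x \<in> piece (G (Suc k)) (bclamp L c)" using x by simp
      have xb: "x \<in> ?V" using zn_str(1)[OF zn_module_free True xc] str_free_module[OF True xc] by simp
      have "g b0 x = g (bclamp L c) x"
        using hom_nat[OF g True xc] str_free_module[OF True xc] 2 True by simp
      also have "\<dots> = g c x"
        by (rule clamped_hom[OF zn_module_free zn_module_slab clamped_free_module clamped_slab L g x])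
      finally have 1: "g b0 x = g c x" .
      have "d k b0 x = d k (bclamp L c) x"
        using hom_nat[OF dk True xc] str_free_module[OF True xc]
          str_free_module[OF True zn_hom_apply(1)[OF zn_module_free dk xc]] by simp
      also have "\<dots> = d k c x"
        by (rule clamped_hom[OF zn_module_free zn_module_free clamped_free_module clamped_free_module L dk x])
      finally show ?thesis using 1 \<psi>(2)[OF xb] True by (simp add: h_def)
    next
      case False
      then show ?thesis using zn_hom_apply(1)[OF zn_module_free g x] by (simp add: h_def 2(2))
    qed
    ultimately show ?thesis by blast
  qed
next
  case (insert a A)
  note g = insert.prems(3) and aA = insert.hyps(2)
  \<comment> \<open>Dimension shifting along the slab sequence: the middle term is treated in
    position \<open>k\<close>, the quotient in position \<open>k'\<close>. Dropping \<open>a\<close>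
    from the set of coordinates leaves room for both.\<close>
  obtain k' where k': "k = Suc k'" using insert.prems(1) insert.hyps(1,2) by (cases k) auto
  have cA: "card A \<le> k" "card A \<le> k'" using insert.prems(1) insert.hyps(1,2) k' by auto
  have K: "Suc k' < K" using insert.prems(2) k' by simp
  let ?b = "b - axis a 1"
  let ?S = "\<lambda>A b. slab_module L A b :: ('k, 'k, 'n) zn_module"
  note sl = slab_insert[OF aA, of L b]
  have dk: "zn_hom (G (Suc k)) (G k) (d k)" using hom insert.prems(2) by simp
  have dk': "zn_hom (G k) (G k') (d k')" using hom K k' by simp
  have inc: "zn_hom (?S (insert a A) b) (?S A b) (\<lambda>c x. x)"
  proof (rule zn_homI)
    fix c e :: "int ^ 'n" and x assume ce: "c \<le> e" and x: "x \<in> piece (?S (insert a A) b) c"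
    show "str (?S (insert a A) b) c e x = str (?S A b) c e x"
      using slab_up[OF aA ce, of L b] sl x by (auto split: if_splits)
  qed (use sl in \<open>auto split: if_splits\<close>)
  have q: "zn_hom (?S A b) (?S A ?b) (\<lambda>c x. if c \<in> slab L A ?b then x else 0)"
  proof (rule zn_homI)
    fix c e :: "int ^ 'n" and x assume ce: "c \<le> e" and x: "x \<in> piece (?S A b) c"
    have "c \<in> slab L A ?b" if "e \<in> slab L A ?b" "c \<in> slab L A b"
      by (rule slab_down[OF ce that]) (use aA in \<open>auto simp: axis_def\<close>)
    then show "(if e \<in> slab L A ?b then str (?S A b) c e x else 0) =
      str (?S A ?b) c e (if c \<in> slab L A ?b then x else 0)" using sl x by auto
  qed auto
  have qs: "zn_surj (?S A b) (?S A ?b) (\<lambda>c x. if c \<in> slab L A ?b then x else 0)"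
    unfolding zn_surj_def using sl(2) by auto
  \<comment> \<open>Composed with the inclusion into the larger slab module, \<open>g\<close>
    becomes \<open>h\<close> after \<open>d k\<close> by the first use of the induction hypothesis;
    the values of \<open>h\<close> may still leave the submodule.\<close>
  have "zn_hom (G (Suc k)) (?S A b) g" using zn_hom_comp[OF g inc] by simp
  then obtain h where h: "zn_hom (G k) (?S A b) h"
    "\<And>c x. x \<in> piece (G (Suc k)) c \<Longrightarrow> g c x = h c (d k c x)"
    using insert.IH[OF cA(1) insert.prems(2), of b g] insert.prems(4) by blast
  \<comment> \<open>The quotient part of \<open>h\<close> is a cocycle, because \<open>g\<close>
    takes values in the submodule and dies in the quotient. The second use of the induction
    hypothesis, one position lower, factors it through \<open>d k'\<close>.\<close>
  let ?qh = "\<lambda>c x. if c \<in> slab L A ?b then h c x else 0"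
  have qh: "zn_hom (G (Suc k')) (?S A ?b) ?qh" using zn_hom_comp[OF h(1) q] k' by simp
  have "?qh c (d (Suc k') c x) = 0" if x: "x \<in> piece (G (Suc (Suc k'))) c" for c x
    using h(2)[of x c] x k' zn_hom_apply(1)[OF zn_module_free g, of x c] sl by auto
  then obtain h' where h': "zn_hom (G k') (?S A ?b) h'"
    "\<And>c x. x \<in> piece (G (Suc k')) c \<Longrightarrow> ?qh c x = h' c (d k' c x)"
    using insert.IH[OF cA(2) K qh] by blast
  have box': "bclamp L (\<beta> k' j) = \<beta> k' j" if "j < m k'" for j using box that K by simp
  \<comment> \<open>Since \<open>G k'\<close> is free, the factor lifts from the quotient to the
    larger slab module.\<close>
  obtain h'' where h'': "zn_hom (G k') (?S A b) h''"
    "\<And>c x. x \<in> piece (G k') c \<Longrightarrow> (if c \<in> slab L A ?b then h'' c x else 0) = h' c x"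
    by (rule free_lift[OF zn_module_slab clamped_slab zn_module_slab clamped_slab L box' q qs h'(1)])
      (assumption, (rule that; assumption))
  \<comment> \<open>The corrected map has zero quotient part, hence lands in the submodule; the
    correction disappears after \<open>d k\<close> because consecutive differentials compose to
    zero.\<close>
  let ?f = "\<lambda>c x. h c x - h'' c (d k' c x)"
  have f: "zn_hom (G k) (?S A b) ?f"
    by (rule zn_hom_diff[OF zn_module_free zn_module_slab h(1) zn_hom_comp[OF dk' h''(1)]])
  have fz: "?f c x \<in> piece (?S (insert a A) b) c" if x: "x \<in> piece (G k) c" for c x
  proof -
    have "?qh c x = (if c \<in> slab L A ?b then h'' c (d k' c x) else 0)"
      using h'(2)[of x c] h''(2)[OF zn_hom_apply(1)[OF zn_module_free dk' x]] x k' by simp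
    then show ?thesis using zn_hom_apply(1)[OF zn_module_free f x] sl by (auto split: if_splits)
  qed
  have "zn_hom (G k) (?S (insert a A) b) ?f"
  proof (rule zn_homI)
    fix c e x assume ce: "c \<le> e" and x: "x \<in> piece (G k) c"
    have xe: "str (G k) c e x \<in> piece (G k) e" by (rule zn_str(1)[OF zn_module_free ce x])
    show "?f e (str (G k) c e x) = str (?S (insert a A) b) c e (?f c x)"
      using hom_nat[OF f ce x] fz[OF x] fz[OF xe] sl slab_up[OF aA ce, of L b]
      by (auto split: if_splits)
  qed (use fz zn_hom_apply[OF zn_module_free f] in auto)
  moreover have "g c x = ?f c (d k c x)" if x: "x \<in> piece (G (Suc k)) c" for c x
    using h(2)[OF x] d_d[OF K, of x c] x k' zn_hom_apply(5)[OF zn_module_free h''(1)] by simp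
  ultimately show ?case by blast
qed

text \<open>Minimality is used twice. It makes the coordinate function of the first generator of
  \<open>G (Suc k)\<close> a cocycle, so that it factors as \<open>h\<close> after
  \<open>d k\<close>; and it makes \<open>h\<close> vanish on the image of \<open>d k\<close>, which
  lies in the kernel of the next differential. The coordinate is then zero on its own
  generator.\<close>

lemma vanishing:
  assumes k: "CARD('n) \<le> k" "Suc k < K"
  shows "m (Suc k) = 0"
proof (rule ccontr)
  assume "m (Suc k) \<noteq> 0"
  then have j: "0 < m (Suc k)" by simp
  obtain k' where k': "k = Suc k'" using k(1) by (cases k) auto
  define b where "b = \<beta> (Suc k) 0"
  have bb: "bclamp L b = b" unfolding b_def using box[of "Suc k" 0] j k by simp
  define g :: "int ^ 'n \<Rightarrow> (nat \<Rightarrow> 'k) \<Rightarrow> 'k" where "g c x = (if bclamp L c = b then x 0 else 0)" for c x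
  have g: "zn_hom (G (Suc k)) (skyscraper L b) g"
  proof (rule zn_homI)
    fix c e x assume ce: "c \<le> e" and x: "x \<in> piece (G (Suc k)) c"
    \<comment> \<open>If coordinate 0 were nonzero in degree \<open>c\<close>, then
      \<open>b \<le> bclamp L c \<le> bclamp L e = b\<close>.\<close>
    have "x 0 = 0" if "bclamp L e = b" "bclamp L c \<noteq> b"
      using that x bclamp_mono[OF ce, of L] b_def by fastforce
    then show "g e (str (G (Suc k)) c e x) = str (skyscraper L b) c e (g c x)"
      unfolding str_free_module[OF ce x] by (auto simp: g_def skyscraper_def)
  qed (auto simp: g_def skyscraper_def)
  have "g c (d (Suc k) c x) = 0" if x: "x \<in> piece (G (Suc (Suc k))) c" for c x
    by (rule minimal[OF k(2) g _ d_d[OF k(2) x]])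
      (use zn_hom_apply(1)[OF zn_module_free hom[OF k(2)] x] in simp)
  then obtain h where h: "zn_hom (G k) (skyscraper L b) h"
    "\<And>c x. x \<in> piece (G (Suc k)) c \<Longrightarrow> g c x = h c (d k c x)"
    using cocycle_factors[of UNIV k b g] k g unfolding slab_UNIV by auto
  have u: "unit_vec 0 \<in> piece (G (Suc k)) b" using j bb by (auto simp: unit_vec_def b_def split: if_splits)
  have "h b (d k b (unit_vec 0)) = 0"
  proof (rule minimal[of k' b h])
    show "d k b (unit_vec 0) \<in> piece (G (Suc k')) b"
      using zn_hom_apply(1)[OF zn_module_free hom[of k] u] k k' by simp
    show "d k' b (d k b (unit_vec 0)) = 0" using d_d[of k' "unit_vec 0" b] u k k' by simp
  qed (use h(1) k k' in auto)
  then show False using h(2)[OF u] bb by (simp add: g_def unit_vec_def)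
qed

end

section \<open>Flat presentations and resolutions\<close>

text \<open>The radical property for a cover that is only isomorphic to a free one: \<open>N\<close>
  is replaced by its clamped copy, and the cover is precomposed with the isomorphism.\<close>

lemma minimal_flat_cover_kills:
  fixes N :: "('k::field, 'v::ab_group_add, 'n::finite) zn_module" and \<beta> :: "nat \<Rightarrow> int ^ 'n"
  assumes N: "is_zn_module N" and dN: "determined_in L N" and L: "0 \<le> L"
    and p: "flat_cover N F p" and bd: "flat_cover_bound N m"
    and box: "\<And>j. j < m \<Longrightarrow> bclamp L (\<beta> j) = \<beta> j" and ai: "zn_iso (free_module L m \<beta>) F ai"
    and h: "zn_hom (free_module L m \<beta>) (skyscraper L b) h"
    and x: "x \<in> piece (free_module L m \<beta>) c" and px: "p c (ai c x) = 0"
  shows "h c x = (0::'k)"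
proof -
  obtain \<kappa> where \<kappa>: "zn_iso N (clamp_module L N) \<kappa>" using iso_clamp_module[OF N dN L] by blast
  let ?C = "clamp_module L N"
  have F: "is_zn_module F" by (rule flat_cover_module[OF p])
  have p1: "zn_hom F N p" "zn_surj F N p" using p by (simp_all add: flat_cover_def)
  define P where "P = (\<lambda>b x. \<kappa> b (p b (ai b x)))"
  have hP: "zn_hom (free_module L m \<beta>) ?C P"
    unfolding P_def by (rule zn_hom_comp[OF zn_hom_comp[OF zn_isoD(1)[OF ai] p1(1)] zn_isoD(1)[OF \<kappa>]])
  have sP: "zn_surj (free_module L m \<beta>) ?C P"
    unfolding P_def using zn_surj_comp[OF zn_surj_comp[OF _ p1(2)], of _ ai ?C \<kappa>] ai \<kappa> by (simp add: zn_iso_def)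
  have bC: "flat_cover_bound ?C m" by (rule flat_cover_bound_iso[OF N \<kappa> bd])
  have "P c x = 0" using px zn_hom_apply(5)[OF N zn_isoD(1)[OF \<kappa>]] by (simp add: P_def)
  then show ?thesis
    using bC unfolding flat_cover_bound_def
    by (intro minimal_free_cover_kernel[OF zn_module_clamp_module[OF N] clamped_clamp_module L box hP sP _ h x]) blast+
qed

text \<open>A single index for both kinds of kernels: \<open>F (Suc i)\<close> covers
  \<open>syzygy F \<epsilon> d i\<close>, whether this is the kernel of the augmentation or of a
  differential.\<close>

definition syzygy :: "(nat \<Rightarrow> ('k, 'f, 'n::finite) zn_module) \<Rightarrow> (int ^ 'n \<Rightarrow> 'f \<Rightarrow> 'v::zero)
    \<Rightarrow> (nat \<Rightarrow> int ^ 'n \<Rightarrow> 'f \<Rightarrow> 'f::zero) \<Rightarrow> nat \<Rightarrow> ('k, 'f, 'n) zn_module" where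
  "syzygy F \<epsilon> d i = (case i of 0 \<Rightarrow> zn_kernel (F 0) \<epsilon> | Suc j \<Rightarrow> zn_kernel (F (Suc j)) (d j))"

lemma syzygy_simps [simp]:
  "syzygy F \<epsilon> d 0 = zn_kernel (F 0) \<epsilon>" "syzygy F \<epsilon> d (Suc j) = zn_kernel (F (Suc j)) (d j)"
  by (simp_all add: syzygy_def)

lemma syzygy_piece: "piece (syzygy F \<epsilon> d i) b \<subseteq> piece (F i) b"
  by (cases i) auto

lemma zn_hom_from_syzygy: "zn_hom M (syzygy F \<epsilon> d i) f \<Longrightarrow> zn_hom M (F i) f"
  by (cases i) (auto intro: zn_hom_from_kernel)

context
  fixes N :: "('k::field, 'v::ab_group_add, 'n::finite) zn_module"
    and F :: "nat \<Rightarrow> ('k, 'f::ab_group_add, 'n) zn_module"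
    and \<epsilon> :: "int ^ 'n \<Rightarrow> 'f \<Rightarrow> 'v" and d :: "nat \<Rightarrow> int ^ 'n \<Rightarrow> 'f \<Rightarrow> 'f"
  assumes N: "is_zn_module N" "finitely_determined N"
    and F0: "finite_flat (F 0)" "zn_hom (F 0) N \<epsilon>"
    and cover: "\<And>i. minimal_flat_cover (syzygy F \<epsilon> d i) (F (Suc i)) (d i)"
begin

lemma resolution_term: "finite_flat (F i)" "is_zn_module (F i)" "finitely_determined (F i)"
proof -
  show 1: "finite_flat (F i)" using F0 minimal_flat_coverD(4)[OF cover] by (cases i) auto
  then show "is_zn_module (F i)" "finitely_determined (F i)"
    using finitely_determined_flat by (auto simp: finite_flat_def flat_summands_def)
qed

lemma syzygy_determined: "is_zn_module (syzygy F \<epsilon> d i) \<and> finitely_determined (syzygy F \<epsilon> d i)"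
proof (induction i)
  case 0
  then show ?case
    using zn_module_kernel[OF resolution_term(2) N(1) F0(2)]
      finitely_determined_kernel[OF resolution_term(2) N(1) F0(2) resolution_term(3) N(2)] by simp
next
  case (Suc i)
  note c = minimal_flat_coverD[OF cover[of i]]
  show ?case
    using zn_module_kernel[OF c(1) _ c(2)] finitely_determined_kernel[OF c(1) _ c(2,5)] Suc by simp
qed

text \<open>A finite stretch of the sequence is moved into a common box, where
  \<open>vanishing\<close> applies. The hypotheses speak about each cover separately, so that the
  lemma can be applied to a sequence still under construction, whose finiteness it then
  supplies.\<close>

lemma minimal_flat_resolution_vanishing:
  assumes k: "CARD('n) < k"
  shows "zero_module (F k)"
proof -
  note cD = minimal_flat_coverD[OF cover]
  have "\<exists>m. flat_summands (F i) m \<and> (case i of 0 \<Rightarrow> True | Suc j \<Rightarrow> flat_cover_bound (syzygy F \<epsilon> d j) m)" for i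
    using F0(1) cover[unfolded minimal_flat_cover_iff] unfolding finite_flat_def by (cases i) auto
  then obtain m where m: "\<And>i. flat_summands (F i) (m i)" and "\<And>i. case i of 0 \<Rightarrow> True | Suc j \<Rightarrow> flat_cover_bound (syzygy F \<epsilon> d j) (m i)"
    by metis
  from this(2)[of "Suc _"] have bound: "\<And>j. flat_cover_bound (syzygy F \<epsilon> d j) (m (Suc j))" by simp
  let ?ok = "\<lambda>L i. determined_in L (syzygy F \<epsilon> d i) \<and>
    (\<exists>\<beta> a. (\<forall>j<m i. bclamp L (\<beta> j) = \<beta> j) \<and> zn_iso (F i) (free_module L (m i) \<beta> :: ('k, 'n) std_module) a)"
  have "\<exists>L0. \<forall>L\<ge>L0. ?ok L i" for i
  proof -
    obtain L1 where L1: "\<And>L. L \<ge> L1 \<Longrightarrow> determined_in L (syzygy F \<epsilon> d i)"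
      using finitely_determinedE[OF conjunct2[OF syzygy_determined[of i]]] by blast
    obtain L2 where "\<And>L. L \<ge> L2 \<Longrightarrow> \<exists>\<beta> a. (\<forall>j<m i. bclamp L (\<beta> j) = \<beta> j) \<and>
        zn_iso (F i) (free_module L (m i) \<beta> :: ('k, 'n) std_module) a"
      by (rule flat_summandsE[OF m[of i]]) (rule that; assumption)
    then have "\<forall>L\<ge>max L1 L2. ?ok L i" using L1 by simp
    then show ?thesis ..
  qed
  then obtain L0 where L0: "\<And>i L. L \<ge> L0 i \<Longrightarrow> ?ok L i" by metis
  \<comment> \<open>The argument at \<open>F k\<close> also involves the differential arriving from
    \<open>F (Suc k)\<close>, so the stretch ends one term later.\<close>
  define K where "K = Suc k"
  define L where "L = (\<Sum>i\<le>K. \<bar>L0 i\<bar>)"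
  have L: "0 \<le> L" unfolding L_def by (simp add: sum_nonneg)
  have "L0 i \<le> L" if "i \<le> K" for i
  proof -
    have "\<bar>L0 i\<bar> \<le> L" unfolding L_def by (rule member_le_sum[of i _ "\<lambda>i. \<bar>L0 i\<bar>"]) (use that in auto)
    then show ?thesis by simp
  qed
  then have ok: "?ok L i" if "i \<le> K" for i using that L0 by blast
  let ?R = "\<lambda>i \<beta> a. (\<forall>j<m i. bclamp L (\<beta> j) = \<beta> j) \<and>
      zn_iso (F i) (free_module L (m i) \<beta> :: ('k, 'n) std_module) a"
  have "\<forall>i\<in>{..K}. \<exists>\<beta>. \<exists>a. ?R i \<beta> a" using ok by simp
  from bchoice[OF this] obtain \<beta> where "\<forall>i\<in>{..K}. \<exists>a. ?R i (\<beta> i) a" ..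
  from bchoice[OF this] obtain a where R: "\<forall>i\<in>{..K}. ?R i (\<beta> i) (a i)" ..
  have \<beta>: "\<And>i j. i \<le> K \<Longrightarrow> j < m i \<Longrightarrow> bclamp L (\<beta> i j) = \<beta> i j"
    and a: "\<And>i. i \<le> K \<Longrightarrow> zn_iso (F i) (free_module L (m i) (\<beta> i) :: ('k, 'n) std_module) (a i)"
    using R by simp_all
  let ?G = "\<lambda>i. free_module L (m i) (\<beta> i) :: ('k, 'n) std_module"
  have "\<exists>ai. i \<le> K \<longrightarrow> zn_iso (?G i) (F i) ai \<and> (\<forall>b. \<forall>x\<in>piece (F i) b. ai b (a i b x) = x)
    \<and> (\<forall>b. \<forall>x\<in>piece (?G i) b. a i b (ai b x) = x)" for i
  proof (cases "i \<le> K")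
    case True
    obtain g where "zn_iso (?G i) (F i) g" "\<And>b x. x \<in> piece (F i) b \<Longrightarrow> g b (a i b x) = x"
      "\<And>b y. y \<in> piece (?G i) b \<Longrightarrow> a i b (g b y) = y"
      by (rule zn_iso_inverse[OF resolution_term(2) a[OF True]]) (rule that; assumption)
    then show ?thesis by (intro exI[of _ g]) simp
  qed blast
  then obtain ai where ai: "\<And>i. i \<le> K \<Longrightarrow> zn_iso (?G i) (F i) (ai i)"
    and aia: "\<And>i b x. i \<le> K \<Longrightarrow> x \<in> piece (F i) b \<Longrightarrow> ai i b (a i b x) = x"
    and aai: "\<And>i b x. i \<le> K \<Longrightarrow> x \<in> piece (?G i) b \<Longrightarrow> a i b (ai i b x) = x" by metis
  have hd: "zn_hom (F (Suc i)) (F i) (d i)" for i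
    by (rule zn_hom_from_syzygy[OF cD(2)])
  \<comment> \<open>The differentials are conjugated into the free models; kernels and images
    correspond because the comparison maps are bijective.\<close>
  define d' where "d' i = (\<lambda>b x. a i b (d i b (ai (Suc i) b x)))" for i
  have aiin: "ai i b x \<in> piece (F i) b" if "i \<le> K" "x \<in> piece (?G i) b" for i b x
    by (rule zn_hom_apply(1)[OF zn_module_free zn_isoD(1)[OF ai[OF that(1)]] that(2)])
  have ain: "a i b x \<in> piece (?G i) b" if "i \<le> K" "x \<in> piece (F i) b" for i b x
    by (rule zn_hom_apply(1)[OF resolution_term(2) zn_isoD(1)[OF a[OF that(1)]] that(2)])
  have din: "d i b x \<in> piece (F i) b" if "x \<in> piece (F (Suc i)) b" for i b x
    by (rule zn_hom_apply(1)[OF resolution_term(2) hd that])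
  have a0: "a i b x = 0 \<longleftrightarrow> x = 0" if "i \<le> K" "x \<in> piece (F i) b" for i b x
    using zn_isoD(3)[OF a[OF that(1)] that(2) zn_piece(1)[OF resolution_term(2)]]
      zn_hom_apply(5)[OF resolution_term(2) zn_isoD(1)[OF a[OF that(1)]], of b] by simp
  have d'0: "d' i c x = 0 \<longleftrightarrow> d i c (ai (Suc i) c x) = 0" if "i < K" "x \<in> piece (?G (Suc i)) c" for i c x
    unfolding d'_def by (rule a0) (use that din aiin[of "Suc i"] in auto)
  have ker: "d (Suc i) c ` piece (F (Suc (Suc i))) c = {x \<in> piece (F (Suc i)) c. d i c x = 0}" for i c
    using cD(3)[of "Suc i"] by (simp add: zn_surj_def)
  interpret free_complex L m \<beta> d' K
  proof
    show "0 \<le> L" by (rule L)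
    show "bclamp L (\<beta> i j) = \<beta> i j" if "i \<le> K" "j < m i" for i j using \<beta> that by blast
    show "zn_hom (?G (Suc i)) (?G i) (d' i)" if "i < K" for i
      unfolding d'_def
      by (rule zn_hom_comp[OF zn_hom_comp[OF zn_isoD(1)[OF ai] hd] zn_isoD(1)[OF a]]) (use that in auto)
    show "d' i c x = 0 \<longleftrightarrow> x \<in> d' (Suc i) c ` piece (?G (Suc (Suc i))) c"
      if i: "Suc i < K" and x: "x \<in> piece (?G (Suc i)) c" for i c x
    proof
      assume "d' i c x = 0"
      then have "ai (Suc i) c x \<in> d (Suc i) c ` piece (F (Suc (Suc i))) c"
        unfolding ker using d'0[of i x c] aiin[of "Suc i" x c] i x by simp
      then obtain y where y: "y \<in> piece (F (Suc (Suc i))) c" "ai (Suc i) c x = d (Suc i) c y" by blast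
      have "x = a (Suc i) c (d (Suc i) c y)" using aai[of "Suc i" x c] y i x by simp
      also have "\<dots> = d' (Suc i) c (a (Suc (Suc i)) c y)"
        unfolding d'_def using aia[of "Suc (Suc i)" y c] y i by simp
      finally show "x \<in> d' (Suc i) c ` piece (?G (Suc (Suc i))) c"
        using ain[of "Suc (Suc i)" y c] y i by (intro image_eqI) auto
    next
      assume "x \<in> d' (Suc i) c ` piece (?G (Suc (Suc i))) c"
      then obtain y where y: "y \<in> piece (?G (Suc (Suc i))) c" "x = d' (Suc i) c y" by blast
      let ?y = "ai (Suc (Suc i)) c y"
      have y': "?y \<in> piece (F (Suc (Suc i))) c" using aiin[of "Suc (Suc i)" y c] y i by simp
      have "ai (Suc i) c x = d (Suc i) c ?y"
        unfolding y(2) d'_def using aia[of "Suc i" _ c] din[OF y'] i by simp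
      then have "d i c (ai (Suc i) c x) = 0" using ker[of i c] y' by blast
      then show "d' i c x = 0" using d'0[of i x c] i x by simp
    qed
    show "h c x = 0" if i: "Suc i < K" and h: "zn_hom (?G (Suc i)) (skyscraper L b) h"
      and x: "x \<in> piece (?G (Suc i)) c" and 0: "d' i c x = 0" for i b h c x
    proof (rule minimal_flat_cover_kills[OF conjunct1[OF syzygy_determined[of i]] _ L cD(6) bound _ _ h x])
      show "determined_in L (syzygy F \<epsilon> d i)" using ok[of i] i by simp
      show "bclamp L (\<beta> (Suc i) j) = \<beta> (Suc i) j" if "j < m (Suc i)" for j using \<beta>[of "Suc i" j] that i by simp
      show "zn_iso (?G (Suc i)) (F (Suc i)) (ai (Suc i))" using ai[of "Suc i"] i by simp
      show "d i c (ai (Suc i) c x) = 0" using d'0[of i x c] i x 0 by simp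
    qed
  qed
  obtain k' where k': "k = Suc k'" using k by (cases k) auto
  have "m k = 0" using vanishing[of k'] k k' K_def by simp
  then have "piece (?G k) b = {0}" for b by (auto simp: fun_eq_iff)
  then have "a k b x = 0" if "x \<in> piece (F k) b" for b x
    using ain[of k x b] that K_def by auto
  then show ?thesis
    unfolding zero_module_def using a0[of k] zn_piece(1)[OF resolution_term(2)] K_def by fastforce
qed

end

section \<open>Existence, uniqueness and length for the flat objects\<close>

lemma length_at_mostI:
  assumes "\<And>i. n < i \<Longrightarrow> zero_module (X i)"
  shows "length_at_most X n"
proof (cases "\<forall>i. zero_module (X i)")
  case False
  then obtain i where i: "\<not> zero_module (X i)" by blast
  let ?l = "GREATEST i. \<not> zero_module (X i)"
  have b: "\<And>y. \<not> zero_module (X y) \<Longrightarrow> y \<le> n" using assms not_le by blast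
  have "\<not> zero_module (X ?l)" by (rule GreatestI_nat[where P = "\<lambda>i. \<not> zero_module (X i)", OF i b])
  moreover have "j \<le> ?l" if "\<not> zero_module (X j)" for j by (rule Greatest_le_nat[where P = "\<lambda>i. \<not> zero_module (X i)", OF that b])
  then have "\<forall>i>?l. zero_module (X i)" by (meson not_le)
  ultimately have "has_length X ?l" unfolding has_length_def by blast
  then show ?thesis unfolding length_at_most_def using b \<open>\<not> zero_module (X ?l)\<close> by blast
qed (simp add: length_at_most_def)

text \<open>Allows the summand count of a vanishing term to be recorded as 0, as the finiteness
  condition on resolutions asks.\<close>

lemma flat_summands_zero:
  fixes F :: "('k::field, 'f::ab_group_add, 'n::finite) zn_module"
  assumes "is_zn_module F" "zero_module F"
  shows "flat_summands F 0"
proof -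
  have "zn_iso F (direct_sum 0 (\<lambda>i. indicator_module (flat_region 0 {}) :: ('k, 'k, 'n) zn_module)) (\<lambda>b x. 0)"
    using assms(2) by (intro zn_isoI zn_homI) (auto simp: zero_module_def bij_betw_def fun_eq_iff)
  then show ?thesis unfolding flat_summands_def zn_isomorphic_def using assms(1)
    by (intro conjI exI[of _ "\<lambda>_. 0"] exI[of _ "\<lambda>_. {}"] exI[of _ "\<lambda>b x. 0"])
qed

lemma cover_of_kernel_exact:
  assumes "zn_surj F' (zn_kernel F p) f"
  shows "exact_at F' f F p"
  using assms by (simp add: exact_at_def zn_surj_def)

lemma cover_is_cokernel:
  assumes "is_zn_module N" "zn_hom F N p" "zn_surj F N p" "zn_surj F' (zn_kernel F p) f"
  shows "is_cokernel F' F f N p"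
  using assms cover_of_kernel_exact by (simp add: is_cokernel_def)

lemma minimal_flat_presentation_exists:
  fixes N :: "('k::field, 'v::ab_group_add, 'n::finite) zn_module"
  assumes N: "is_zn_module N" "finitely_determined N"
  shows "\<exists>(F1 :: ('k, 'n) std_module) F0 \<phi> \<epsilon>. minimal_flat_presentation N F1 F0 \<phi> \<epsilon>"
proof -
  obtain F0 :: "('k, 'n) std_module" and \<epsilon> where e: "minimal_flat_cover N F0 \<epsilon>"
    using minimal_flat_cover_exists[OF N] by blast
  note eD = minimal_flat_coverD[OF e]
  obtain F1 :: "('k, 'n) std_module" and \<phi> where f: "minimal_flat_cover (zn_kernel F0 \<epsilon>) F1 \<phi>"
    using minimal_flat_cover_exists[OF zn_module_kernel[OF eD(1) N(1) eD(2)]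
        finitely_determined_kernel[OF eD(1) N(1) eD(2) eD(5) N(2)]] by blast
  note fD = minimal_flat_coverD[OF f]
  have "minimal_flat_presentation N F1 F0 \<phi> \<epsilon>"
    unfolding minimal_flat_presentation_def finite_flat_presentation_def
    using e f eD(4) fD(4) zn_hom_from_kernel[OF fD(2)] cover_is_cokernel[OF N(1) eD(2,3) fD(3)] by blast
  then show ?thesis by blast
qed

lemma minimal_flat_resolution_exists:
  fixes N :: "('k::field, 'v::ab_group_add, 'n::finite) zn_module"
  assumes N: "is_zn_module N" "finitely_determined N"
  shows "\<exists>(F :: nat \<Rightarrow> ('k, 'n) std_module) d \<epsilon>. minimal_flat_resolution N F d \<epsilon>"
proof -
  obtain F0 :: "('k, 'n) std_module" and \<epsilon> where e: "minimal_flat_cover N F0 \<epsilon>"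
    using minimal_flat_cover_exists[OF N] by blast
  note eD = minimal_flat_coverD[OF e]
  \<comment> \<open>A state consists of the current syzygy, its chosen cover and the covering map;
    \<open>?Q\<close> says that the next syzygy is the kernel of this cover.\<close>
  let ?P = "\<lambda>n s. case s of (Z :: ('k, 'n) std_module, F :: ('k, 'n) std_module, p) \<Rightarrow>
    (n = (0::nat) \<longrightarrow> Z = zn_kernel F0 \<epsilon>) \<and> is_zn_module Z \<and> finitely_determined Z \<and> minimal_flat_cover Z F p"
  let ?Q = "\<lambda>(n::nat) s s'. case s of (Z :: ('k, 'n) std_module, F :: ('k, 'n) std_module, p) \<Rightarrow>
    fst s' = zn_kernel F p"
  have Z0: "is_zn_module (zn_kernel F0 \<epsilon>)" "finitely_determined (zn_kernel F0 \<epsilon>)"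
    using zn_module_kernel[OF eD(1) N(1) eD(2)] finitely_determined_kernel[OF eD(1) N(1) eD(2) eD(5) N(2)] by auto
  have "\<exists>s. \<forall>n. ?P n (s n) \<and> ?Q n (s n) (s (Suc n))"
  proof (rule dependent_nat_choice)
    obtain F :: "('k, 'n) std_module" and p where "minimal_flat_cover (zn_kernel F0 \<epsilon>) F p"
      using minimal_flat_cover_exists[OF Z0] by blast
    then show "\<exists>s. ?P 0 s" using Z0 by (intro exI[of _ "(zn_kernel F0 \<epsilon>, F, p)"]) simp
  next
    fix s n assume s: "?P n s"
    obtain Z F p where sp: "s = (Z, F, p)" by (cases s) auto
    note pD = minimal_flat_coverD[of Z F p]
    have p: "is_zn_module Z" "finitely_determined Z" "minimal_flat_cover Z F p" using s sp by auto
    have Z': "is_zn_module (zn_kernel F p)" "finitely_determined (zn_kernel F p)"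
      using zn_module_kernel[OF pD(1) p(1) pD(2)] finitely_determined_kernel[OF pD(1) p(1) pD(2) pD(5) p(2)] p(3) by auto
    obtain F' :: "('k, 'n) std_module" and p' where "minimal_flat_cover (zn_kernel F p) F' p'"
      using minimal_flat_cover_exists[OF Z'] by blast
    then show "\<exists>s'. ?P (Suc n) s' \<and> ?Q n s s'"
      using Z' sp by (intro exI[of _ "(zn_kernel F p, F', p')"]) simp
  qed
  then obtain s where s': "\<forall>n. ?P n (s n) \<and> ?Q n (s n) (s (Suc n))" ..
  note s = conjunct1[OF spec[OF s']] conjunct2[OF spec[OF s']]
  \<comment> \<open>The index moves by one: the cover in state \<open>n\<close> is the term
    \<open>Suc n\<close>, since the term 0 covers \<open>N\<close> itself.\<close>
  define F where "F i = (case i of 0 \<Rightarrow> F0 | Suc n \<Rightarrow> fst (snd (s n)))" for i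
  define d where "d n = snd (snd (s n))" for n
  have Z: "fst (s n) = syzygy F \<epsilon> d n" for n
  proof (cases n)
    case 0
    then show ?thesis using s(1)[of 0] by (auto simp: F_def split: prod.splits)
  next
    case (Suc k)
    then show ?thesis using s(2)[of k] by (auto simp: F_def d_def split: prod.splits)
  qed
  have cover: "minimal_flat_cover (syzygy F \<epsilon> d n) (F (Suc n)) (d n)" for n
    using s(1)[of n] Z[of n] by (auto simp: F_def d_def split: prod.splits)
  have F0: "finite_flat (F 0)" "zn_hom (F 0) N \<epsilon>" using eD by (simp_all add: F_def)
  note rt = resolution_term[OF N F0 cover]
  note cD = minimal_flat_coverD[OF cover]
  have "\<forall>i. \<exists>m. flat_summands (F i) m \<and> (CARD('n) < i \<longrightarrow> m = 0)"
    using rt(1,2) minimal_flat_resolution_vanishing[OF N F0 cover] flat_summands_zero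
    unfolding finite_flat_def by metis
  then obtain m where m: "\<And>i. flat_summands (F i) (m i)" "\<And>i. CARD('n) < i \<Longrightarrow> m i = 0" by metis
  have "{i. m i \<noteq> 0} \<subseteq> {..CARD('n)}"
  proof
    fix i assume "i \<in> {i. m i \<noteq> 0}"
    then show "i \<in> {..CARD('n)}" using m(2)[of i] by (cases "CARD('n) < i") auto
  qed
  then have "finite {i. m i \<noteq> 0}" by (rule finite_subset) simp
  moreover have "zn_hom (F (Suc i)) (F i) (d i)" for i by (rule zn_hom_from_syzygy[OF cD(2)])
  moreover have "is_cokernel (F 1) (F 0) (d 0) N \<epsilon>"
    using cover_is_cokernel[OF N(1) F0(2), of "F 1" "d 0"] eD(3) cD(3)[of 0] by (simp add: F_def)
  moreover have "exact_at (F (Suc (Suc i))) (d (Suc i)) (F (Suc i)) (d i)" for i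
    using cover_of_kernel_exact cD(3)[of "Suc i"] by auto
  ultimately have "finite_flat_resolution N F d \<epsilon>"
    unfolding finite_flat_resolution_def using m(1) by (intro conjI allI exI[of _ m])
  moreover have "minimal_flat_cover N (F 0) \<epsilon>" using e by (simp add: F_def)
  ultimately have "minimal_flat_resolution N F d \<epsilon>"
    unfolding minimal_flat_resolution_def using cover[of 0] cover[of "Suc _"] by simp
  then show ?thesis by blast
qed

lemma finitely_determined_of_flat_presentation:
  assumes "finite_flat_presentation N F1 F0 \<phi> \<epsilon>"
  shows "finitely_determined N"
proof -
  obtain m n where "flat_summands F1 m" "flat_summands F0 n"
    using assms unfolding finite_flat_presentation_def finite_flat_def by blast
  then show ?thesis
    using assms finitely_determined_cokernel[of F1 F0 \<phi> N \<epsilon>] finitely_determined_flat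
    unfolding finite_flat_presentation_def flat_summands_def by metis
qed

lemma flat_presentation_of_resolution:
  "finite_flat_resolution N F d \<epsilon> \<Longrightarrow> finite_flat_presentation N (F 1) (F 0) (d 0) \<epsilon>"
  unfolding finite_flat_resolution_def finite_flat_presentation_def finite_flat_def by (metis One_nat_def)

lemma zn_iso_kernel:
  assumes "zn_iso F F' \<alpha>" "\<And>b x. x \<in> piece F b \<Longrightarrow> f' b (\<alpha> b x) = 0 \<longleftrightarrow> f b x = 0"
  shows "zn_iso (zn_kernel F f) (zn_kernel F' f') \<alpha>"
proof (rule zn_isoI)
  show "zn_hom (zn_kernel F f) (zn_kernel F' f') \<alpha>"
    using zn_hom_into_kernel[OF zn_hom_kernel[OF zn_isoD(1)[OF assms(1)], of f], of f'] assms(2) by auto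
  fix b
  have 1: "inj_on (\<alpha> b) (piece F b)" "\<alpha> b ` piece F b = piece F' b"
    using zn_isoD(2)[OF assms(1), of b] by (auto simp: bij_betw_def)
  have "inj_on (\<alpha> b) (piece (zn_kernel F f) b)" using inj_on_subset[OF 1(1)] by auto
  moreover have "\<alpha> b ` piece (zn_kernel F f) b = piece (zn_kernel F' f') b"
    unfolding zn_kernel_simps 1(2)[symmetric] using assms(2)[of _ b] by blast
  ultimately show "bij_betw (\<alpha> b) (piece (zn_kernel F f) b) (piece (zn_kernel F' f') b)"
    by (simp add: bij_betw_def)
qed

lemma minimal_flat_presentation_unique:
  fixes F1 :: "('k::field, 'f::ab_group_add, 'n::finite) zn_module" and F1' :: "('k, 'g::ab_group_add, 'n) zn_module"
  assumes N: "is_zn_module N" and p: "minimal_flat_presentation N F1 F0 \<phi> \<epsilon>"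
    and p': "minimal_flat_presentation N F1' F0' \<phi>' \<epsilon>'"
  shows "flat_presentation_isomorphic F1 F0 \<phi> \<epsilon> F1' F0' \<phi>' \<epsilon>'"
proof -
  have fd: "finitely_determined N"
    using p finitely_determined_of_flat_presentation unfolding minimal_flat_presentation_def by blast
  have e: "minimal_flat_cover N F0 \<epsilon>" "minimal_flat_cover (zn_kernel F0 \<epsilon>) F1 \<phi>"
    and e': "minimal_flat_cover N F0' \<epsilon>'" "minimal_flat_cover (zn_kernel F0' \<epsilon>') F1' \<phi>'"
    using p p' unfolding minimal_flat_presentation_def by blast+
  note eD = minimal_flat_coverD[OF e(1)] and eD' = minimal_flat_coverD[OF e'(1)]
  obtain \<alpha> where \<alpha>: "zn_iso F0 F0' \<alpha>" "\<And>b x. x \<in> piece F0 b \<Longrightarrow> \<epsilon>' b (\<alpha> b x) = \<epsilon> b x"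
    by (rule minimal_flat_cover_unique[OF N fd e(1) e'(1)]) (rule that; assumption)
  have k: "zn_iso (zn_kernel F0 \<epsilon>) (zn_kernel F0' \<epsilon>') \<alpha>"
    by (rule zn_iso_kernel[OF \<alpha>(1)]) (simp add: \<alpha>(2))
  obtain \<alpha>1 where \<alpha>1: "zn_iso F1 F1' \<alpha>1" "\<And>b x. x \<in> piece F1 b \<Longrightarrow> \<phi>' b (\<alpha>1 b x) = \<alpha> b (\<phi> b x)"
    by (rule minimal_flat_cover_unique_iso[OF zn_module_kernel[OF eD(1) N eD(2)]
          finitely_determined_kernel[OF eD(1) N eD(2,5) fd] zn_module_kernel[OF eD'(1) N eD'(2)] k e(2) e'(2)])
      (rule that; assumption)
  show ?thesis
    unfolding flat_presentation_isomorphic_def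
    by (intro exI[of _ \<alpha>1] exI[of _ \<alpha>] conjI allI ballI \<alpha> \<alpha>1) (simp_all add: \<alpha>(2) \<alpha>1(2))
qed

lemma minimal_flat_resolutionD:
  assumes N: "is_zn_module N" and p: "minimal_flat_resolution N F d \<epsilon>"
  shows "finitely_determined N" "minimal_flat_cover N (F 0) \<epsilon>" "finite_flat (F 0)" "zn_hom (F 0) N \<epsilon>"
    "minimal_flat_cover (syzygy F \<epsilon> d i) (F (Suc i)) (d i)"
proof -
  show "finitely_determined N"
    using p finitely_determined_of_flat_presentation flat_presentation_of_resolution
    unfolding minimal_flat_resolution_def by blast
  show 1: "minimal_flat_cover N (F 0) \<epsilon>" using p unfolding minimal_flat_resolution_def by blast
  show "finite_flat (F 0)" "zn_hom (F 0) N \<epsilon>" using minimal_flat_coverD[OF 1] by auto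
  show "minimal_flat_cover (syzygy F \<epsilon> d i) (F (Suc i)) (d i)"
    using p unfolding minimal_flat_resolution_def by (cases i) auto
qed

lemma minimal_flat_resolution_unique:
  fixes F :: "nat \<Rightarrow> ('k::field, 'f::ab_group_add, 'n::finite) zn_module" and F' :: "nat \<Rightarrow> ('k, 'g::ab_group_add, 'n) zn_module"
  assumes N: "is_zn_module N" and p: "minimal_flat_resolution N F d \<epsilon>" and p': "minimal_flat_resolution N F' d' \<epsilon>'"
  shows "flat_resolution_isomorphic F d \<epsilon> F' d' \<epsilon>'"
proof -
  note r = minimal_flat_resolutionD[OF N p] and r' = minimal_flat_resolutionD[OF N p']
  note t = resolution_term[OF N r(1,3,4,5)] and t' = resolution_term[OF N r'(1,3,4,5)]
  note z = syzygy_determined[OF N r(1,3,4,5)] and z' = syzygy_determined[OF N r'(1,3,4,5)]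
  \<comment> \<open>The isomorphism of syzygies is part of the invariant, since the next step
    applies uniqueness of covers to it. The augmentations enter at \<open>n = 0\<close>
    only.\<close>
  let ?P = "\<lambda>n \<alpha>. zn_iso (F n) (F' n) \<alpha> \<and> zn_iso (syzygy F \<epsilon> d n) (syzygy F' \<epsilon>' d' n) \<alpha> \<and>
    (n = 0 \<longrightarrow> (\<forall>b. \<forall>x\<in>piece (F 0) b. \<epsilon>' b (\<alpha> b x) = \<epsilon> b x))"
  let ?Q = "\<lambda>n \<alpha> \<alpha>'. \<forall>b. \<forall>x\<in>piece (F (Suc n)) b. d' n b (\<alpha>' b x) = \<alpha> b (d n b x)"
  have "\<exists>\<alpha>. \<forall>n. ?P n (\<alpha> n) \<and> ?Q n (\<alpha> n) (\<alpha> (Suc n))"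
  proof (rule dependent_nat_choice)
    obtain \<alpha> where \<alpha>: "zn_iso (F 0) (F' 0) \<alpha>" "\<And>b x. x \<in> piece (F 0) b \<Longrightarrow> \<epsilon>' b (\<alpha> b x) = \<epsilon> b x"
      by (rule minimal_flat_cover_unique[OF N r(1,2) r'(2)]) (rule that; assumption)
    have "zn_iso (syzygy F \<epsilon> d 0) (syzygy F' \<epsilon>' d' 0) \<alpha>"
      unfolding syzygy_simps by (rule zn_iso_kernel[OF \<alpha>(1)]) (simp add: \<alpha>(2))
    then show "\<exists>\<alpha>. ?P 0 \<alpha>" using \<alpha> by blast
  next
    fix \<alpha> n assume "?P n \<alpha>"
    then have \<alpha>: "zn_iso (F n) (F' n) \<alpha>" "zn_iso (syzygy F \<epsilon> d n) (syzygy F' \<epsilon>' d' n) \<alpha>" by auto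
    obtain \<alpha>' where \<alpha>': "zn_iso (F (Suc n)) (F' (Suc n)) \<alpha>'"
      "\<And>b x. x \<in> piece (F (Suc n)) b \<Longrightarrow> d' n b (\<alpha>' b x) = \<alpha> b (d n b x)"
      by (rule minimal_flat_cover_unique_iso[OF conjunct1[OF z] conjunct2[OF z] conjunct1[OF z'] \<alpha>(2) r(5) r'(5)])
        (rule that; assumption)
    have "\<alpha> b (d n b x) = 0 \<longleftrightarrow> d n b x = 0" if x: "x \<in> piece (F (Suc n)) b" for b x
    proof -
      have "d n b x \<in> piece (syzygy F \<epsilon> d n) b"
        using zn_hom_apply(1)[OF t(2) minimal_flat_coverD(2)[OF r(5)] x] .
      then have "d n b x \<in> piece (F n) b" using syzygy_piece by blast
      then show ?thesis
        using zn_isoD(3)[OF \<alpha>(1) _ zn_piece(1)[OF t(2)]] zn_hom_apply(5)[OF t(2) zn_isoD(1)[OF \<alpha>(1)]] by metis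
    qed
    then have "zn_iso (syzygy F \<epsilon> d (Suc n)) (syzygy F' \<epsilon>' d' (Suc n)) \<alpha>'"
      unfolding syzygy_simps by (intro zn_iso_kernel[OF \<alpha>'(1)]) (simp add: \<alpha>'(2))
    then show "\<exists>\<alpha>'. ?P (Suc n) \<alpha>' \<and> ?Q n \<alpha> \<alpha>'" using \<alpha>' by (intro exI[of _ \<alpha>']) simp
  qed
  then obtain \<alpha> where \<alpha>: "\<forall>n. ?P n (\<alpha> n) \<and> ?Q n (\<alpha> n) (\<alpha> (Suc n))" ..
  show ?thesis
    unfolding flat_resolution_isomorphic_def
    by (rule exI[of _ \<alpha>]) (use \<alpha> in auto)
qed

lemma minimal_flat_resolution_length:
  fixes F :: "nat \<Rightarrow> ('k::field, 'f::ab_group_add, 'n::finite) zn_module"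
  assumes N: "is_zn_module N" and p: "minimal_flat_resolution N F d \<epsilon>"
  shows "length_at_most F CARD('n)"
  using minimal_flat_resolution_vanishing[OF N minimal_flat_resolutionD(1,3,4,5)[OF N p]]
  by (intro length_at_mostI)

section \<open>Matlis duality\<close>

text \<open>Functionals on a subspace are normalised to vanish off it, so that they are determined as
  functions on the ambient space.\<close>

definition dual_space :: "('k::field \<Rightarrow> 'v \<Rightarrow> 'v) \<Rightarrow> 'v::ab_group_add set \<Rightarrow> ('v \<Rightarrow> 'k) set" where
  "dual_space s V = {g. linear_between s (*) V UNIV g \<and> (\<forall>x. x \<notin> V \<longrightarrow> g x = 0)}"

definition pullback :: "'v set \<Rightarrow> ('v \<Rightarrow> 'w) \<Rightarrow> ('w \<Rightarrow> 'k::zero) \<Rightarrow> 'v \<Rightarrow> 'k" where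
  "pullback V f g = (\<lambda>x. if x \<in> V then g (f x) else 0)"

lemma dual_spaceD:
  assumes "g \<in> dual_space s V"
  shows "linear_between s (*) V UNIV g" "x \<in> V \<Longrightarrow> y \<in> V \<Longrightarrow> g (x + y) = g x + g y"
    "x \<in> V \<Longrightarrow> g (s a x) = a * g x" "x \<notin> V \<Longrightarrow> g x = 0"
  using assms by (auto simp: dual_space_def linear_between_def)

lemma dual_space_eqI:
  assumes "g \<in> dual_space s V" "h \<in> dual_space s V" "\<And>x. x \<in> V \<Longrightarrow> g x = h x"
  shows "g = h"
proof
  fix x show "g x = h x"
    using assms(3) dual_spaceD(4)[OF assms(1)] dual_spaceD(4)[OF assms(2)] by (cases "x \<in> V") auto
qed

lemma dual_space_restrict:
  assumes "linear_between s (*) V UNIV g" and s: "vector_space s" and V: "module.subspace s V"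
  shows "(\<lambda>x. if x \<in> V then g x else 0) \<in> dual_space s V"
proof -
  interpret vector_space s by fact
  show ?thesis using assms(1) subspace_add[OF V] subspace_scale[OF V]
    by (auto simp: dual_space_def linear_between_def)
qed

lemma vector_space_functionals: "vector_space (\<lambda>a (g :: 'v \<Rightarrow> 'k::field) x. a * g x)"
  by unfold_locales (auto simp: fun_eq_iff algebra_simps)

lemma subspace_dual_space:
  assumes s: "vector_space s" and V: "module.subspace s V"
  shows "module.subspace (\<lambda>a g x. a * g x) (dual_space s V)"
proof -
  interpret s: vector_space s by fact
  interpret d: vector_space "\<lambda>a (g :: 'b \<Rightarrow> 'a) x. a * g x" by (rule vector_space_functionals)
  show ?thesis unfolding d.subspace_def dual_space_def
    using s.subspace_add[OF V] s.subspace_scale[OF V]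
    by (auto simp: linear_between_def algebra_simps)
qed

lemma pullback_in_dual:
  assumes s: "vector_space s" and V: "module.subspace s V"
    and f: "linear_between s t V W f" and g: "g \<in> dual_space t W"
  shows "pullback V f g \<in> dual_space s V"
  unfolding pullback_def
  using linear_betweenD[OF f] dual_spaceD[OF g]
  by (intro dual_space_restrict[OF _ s V]) (auto simp: linear_between_def)

lemma pullback_linear:
  assumes s: "vector_space s" and V: "module.subspace s V" and f: "linear_between s t V W f"
  shows "linear_between (\<lambda>a g x. a * g x) (\<lambda>a g x. a * g x) (dual_space t W) (dual_space s V) (pullback V f)"
  using pullback_in_dual[OF assms] by (auto simp: linear_between_def pullback_def fun_eq_iff)

lemma pullback_inj:
  assumes "f ` V = W"
  shows "inj_on (pullback V f) (dual_space t W)"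
proof (rule inj_onI)
  fix g h assume gh: "g \<in> dual_space t W" "h \<in> dual_space t W" "pullback V f g = pullback V f h"
  have "g (f x) = h (f x)" if "x \<in> V" for x
    using fun_cong[OF gh(3), of x] that by (simp add: pullback_def)
  then show "g = h" using assms by (intro dual_space_eqI[OF gh(1,2)]) auto
qed

text \<open>Exactness of the dual: a functional killing the kernel of \<open>f\<close> factors
  through \<open>f\<close>, and the factor is normalised by cutting it off outside
  \<open>W\<close>.\<close>

lemma pullback_image:
  assumes s: "vector_space s" and V: "module.subspace s V" and t: "vector_space t" and W: "module.subspace t W"
    and f: "linear_between s t V W f" and g: "g \<in> dual_space s V" and ker: "\<And>x. x \<in> V \<Longrightarrow> f x = 0 \<Longrightarrow> g x = 0"
  shows "g \<in> pullback V f ` dual_space t W"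
proof -
  obtain \<psi> where \<psi>: "Vector_Spaces.linear t (*) \<psi>" "\<And>x. x \<in> V \<Longrightarrow> \<psi> (f x) = g x"
    by (rule functional_factor[OF s t V f dual_spaceD(1)[OF g] ker]) (assumption+, (rule that; assumption))
  let ?h = "\<lambda>x. if x \<in> W then \<psi> x else 0"
  have h: "?h \<in> dual_space t W"
    by (rule dual_space_restrict[OF linear_betweenI_linear[OF \<psi>(1)] t W]) simp
  have "pullback V f ?h = g"
    using \<psi>(2) linear_betweenD(1)[OF f] dual_spaceD(4)[OF g] by (auto simp: pullback_def fun_eq_iff)
  then show ?thesis using h by blast
qed

lemma pullback_surj:
  assumes s: "vector_space s" and V: "module.subspace s V" and t: "vector_space t" and W: "module.subspace t W"
    and f: "linear_between s t V W f" and inj: "inj_on f V"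
  shows "pullback V f ` dual_space t W = dual_space s V"
proof
  show "pullback V f ` dual_space t W \<subseteq> dual_space s V" using pullback_in_dual[OF s V f] by blast
  show "dual_space s V \<subseteq> pullback V f ` dual_space t W"
  proof
    fix g assume g: "g \<in> dual_space s V"
    interpret vector_space s by fact
    have 0: "0 \<in> V" by (rule subspace_0[OF V])
    have "x = 0" if "x \<in> V" "f x = 0" for x
      using inj_onD[OF inj, of x 0] that 0 linear_between_zero[OF f 0] by simp
    moreover have "g 0 = 0" using linear_between_zero[OF dual_spaceD(1)[OF g] 0] .
    ultimately show "g \<in> pullback V f ` dual_space t W"
      by (intro pullback_image[OF s V t W f g]) auto
  qed
qed

text \<open>The coordinate functionals of a basis form a dual basis, which settles finiteness. A
  functional on the dual is evaluation at the vector whose coordinates are its values on that dual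
  basis.\<close>

lemma dual_space_finite:
  fixes s :: "'k::field \<Rightarrow> 'v::ab_group_add \<Rightarrow> 'v"
  assumes s: "vector_space s" and V: "module.subspace s V" and B: "finite B" "module.span s B = V"
  shows "\<exists>D. finite D \<and> module.span (\<lambda>a g x. a * g x) D = dual_space s V"
    and "\<Phi> \<in> dual_space (\<lambda>a g x. a * g x) (dual_space s V) \<Longrightarrow> \<exists>x\<in>V. \<forall>g\<in>dual_space s V. \<Phi> g = g x"
proof -
  interpret s: vector_space s by fact
  let ?t = "\<lambda>a (g :: 'v \<Rightarrow> 'k) x. a * g x"
  interpret d: vector_space ?t by (rule vector_space_functionals)
  note sd = subspace_dual_space[OF s V]
  obtain C where C: "finite C" "s.span C = V" "s.independent C" "C \<subseteq> V"
    using finite_basis_subspace[OF s V order_refl B] by blast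
  define \<delta> where "\<delta> c = (\<lambda>x. if x \<in> V then s.representation C x c else 0)" for c
  have \<delta>: "\<delta> c \<in> dual_space s V" for c
    unfolding \<delta>_def
    by (rule dual_space_restrict[OF _ s V])
      (auto simp: linear_between_def C(2) s.representation_add[OF C(3)] s.representation_scale[OF C(3)])
  have exp: "g = (\<Sum>c\<in>C. ?t (g c) (\<delta> c))" if g: "g \<in> dual_space s V" for g
  proof (rule dual_space_eqI[OF g])
    show "(\<Sum>c\<in>C. ?t (g c) (\<delta> c)) \<in> dual_space s V"
      by (intro d.subspace_sum[OF sd] d.subspace_scale[OF sd] \<delta>)
    fix x assume x: "x \<in> V"
    have ap: "(\<Sum>c\<in>D. ?t (g c) (\<delta> c)) x = (\<Sum>c\<in>D. g c * \<delta> c x)" if "finite D" for D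
      using that by induction auto
    have m: "s (s.representation C x c) c \<in> V" if "c \<in> C" for c
      using that C(4) s.subspace_scale[OF V] by blast
    have gs: "g (\<Sum>c\<in>D. s (s.representation C x c) c) = (\<Sum>c\<in>D. g (s (s.representation C x c) c))"
      if "finite D" "D \<subseteq> C" for D
      using that
    proof induction
      case empty
      show ?case using linear_between_zero[OF dual_spaceD(1)[OF g] s.subspace_0[OF V]] by simp
    next
      case (insert c D)
      then show ?case
        using dual_spaceD(2)[OF g m[of c] s.subspace_sum[OF V, of D "\<lambda>c. s (s.representation C x c) c"]] m by auto
    qed
    have "x = (\<Sum>c\<in>C. s (s.representation C x c) c)"
      using s.sum_representation_eq[OF C(3) _ C(1) order_refl, of x] x C(2) by simp
    then have "g x = (\<Sum>c\<in>C. g (s (s.representation C x c) c))" using gs[OF C(1) order_refl] by simp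
    also have "\<dots> = (\<Sum>c\<in>C. g c * \<delta> c x)"
      using x C(4) dual_spaceD(3)[OF g] by (intro sum.cong) (auto simp: \<delta>_def)
    finally show "g x = (\<Sum>c\<in>C. ?t (g c) (\<delta> c)) x" using ap[OF C(1)] by simp
  qed
  have "d.span (\<delta> ` C) = dual_space s V"
  proof (rule d.span_subspace[OF _ _ sd])
    show "\<delta> ` C \<subseteq> dual_space s V" using \<delta> by blast
    show "dual_space s V \<subseteq> d.span (\<delta> ` C)"
    proof
      fix g assume "g \<in> dual_space s V"
      have "(\<Sum>c\<in>C. ?t (g c) (\<delta> c)) \<in> d.span (\<delta> ` C)"
        by (intro d.span_sum d.span_scale d.span_base imageI)
      then show "g \<in> d.span (\<delta> ` C)" using exp[OF \<open>g \<in> dual_space s V\<close>] by simp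
    qed
  qed
  then show "\<exists>D. finite D \<and> d.span D = dual_space s V" using C(1) by blast
  assume \<Phi>: "\<Phi> \<in> dual_space ?t (dual_space s V)"
  define x where "x = (\<Sum>c\<in>C. s (\<Phi> (\<delta> c)) c)"
  have sc: "s (\<Phi> (\<delta> c)) c \<in> V" if "c \<in> C" for c using that C(4) s.subspace_scale[OF V] by blast
  have xV: "x \<in> V" unfolding x_def by (rule s.subspace_sum[OF V sc])
  have "\<Phi> g = g x" if g: "g \<in> dual_space s V" for g
  proof -
    have 1: "\<Phi> (\<Sum>c\<in>D. ?t (g c) (\<delta> c)) = (\<Sum>c\<in>D. g c * \<Phi> (\<delta> c))" if "finite D" for D
      using that
    proof induction
      case empty
      show ?case using linear_between_zero[OF dual_spaceD(1)[OF \<Phi>] d.subspace_0[OF sd]] by (simp add: zero_fun_def)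
    next
      case (insert c D)
      have "(\<Sum>c\<in>D. ?t (g c) (\<delta> c)) \<in> dual_space s V"
        by (intro d.subspace_sum[OF sd] d.subspace_scale[OF sd] \<delta>)
      then show ?case
        using insert dual_spaceD(2)[OF \<Phi> d.subspace_scale[OF sd \<delta>[of c], of "g c"]] dual_spaceD(3)[OF \<Phi> \<delta>] by (simp add: plus_fun_def)
    qed
    have 2: "g (\<Sum>c\<in>D. s (\<Phi> (\<delta> c)) c) = (\<Sum>c\<in>D. \<Phi> (\<delta> c) * g c)" if "finite D" "D \<subseteq> C" for D
      using that
    proof induction
      case empty
      show ?case using linear_between_zero[OF dual_spaceD(1)[OF g] s.subspace_0[OF V]] by simp
    next
      case (insert c D)
      have "(\<Sum>c\<in>D. s (\<Phi> (\<delta> c)) c) \<in> V" using insert.prems sc by (intro s.subspace_sum[OF V]) auto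
      then show ?case
        using insert dual_spaceD(2)[OF g sc[of c]] dual_spaceD(3)[OF g, of c] C(4) by auto
    qed
    have "\<Phi> g = (\<Sum>c\<in>C. g c * \<Phi> (\<delta> c))" using 1[OF C(1)] exp[OF g] by simp
    also have "\<dots> = g x" unfolding x_def using 2[OF C(1) order_refl] by (simp add: mult.commute)
    finally show ?thesis .
  qed
  then show "\<exists>x\<in>V. \<forall>g\<in>dual_space s V. \<Phi> g = g x" using xV by blast
qed

text \<open>The graded Matlis dual: transposition reverses the direction of the structure maps, and
  negation of degrees restores it.\<close>

definition zn_dual :: "('k::field, 'v::ab_group_add, 'n::finite) zn_module \<Rightarrow> ('k, 'v \<Rightarrow> 'k, 'n) zn_module" where
  "zn_dual M = \<lparr>scl = \<lambda>a g x. a * g x, piece = \<lambda>b. dual_space (scl M) (piece M (- b)),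
     str = \<lambda>b c. pullback (piece M (- c)) (str M (- c) (- b))\<rparr>"

definition zn_dual_map :: "('k::field, 'v::ab_group_add, 'n::finite) zn_module \<Rightarrow> (int ^ 'n \<Rightarrow> 'v \<Rightarrow> 'w)
    \<Rightarrow> int ^ 'n \<Rightarrow> ('w \<Rightarrow> 'k) \<Rightarrow> 'v \<Rightarrow> 'k" where
  "zn_dual_map M f b = pullback (piece M (- b)) (f (- b))"

lemma zn_dual_simps [simp]:
  "scl (zn_dual M) = (\<lambda>a g x. a * g x)" "piece (zn_dual M) b = dual_space (scl M) (piece M (- b))"
  "str (zn_dual M) b c = pullback (piece M (- c)) (str M (- c) (- b))"
  by (simp_all add: zn_dual_def)

lemma neg_le: "(b :: int ^ 'n::finite) \<le> c \<Longrightarrow> - c \<le> - b"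
  by (simp add: less_eq_vec_def)

lemma zn_module_dual:
  assumes M: "is_zn_module M"
  shows "is_zn_module (zn_dual M)"
  unfolding is_zn_module_def zn_dual_simps
proof (intro conjI allI impI ballI)
  show "vector_space (\<lambda>a (g :: 'b \<Rightarrow> 'a) x. a * g x)" by (rule vector_space_functionals)
  show "module.subspace (\<lambda>a g x. a * g x) (dual_space (scl M) (piece M (- b)))" for b
    by (rule subspace_dual_space[OF zn_vector_space[OF M] zn_subspace[OF M]])
  show "linear_between (\<lambda>a g x. a * g x) (\<lambda>a g x. a * g x) (dual_space (scl M) (piece M (- b)))
      (dual_space (scl M) (piece M (- c))) (pullback (piece M (- c)) (str M (- c) (- b)))" if "b \<le> c" for b c
    by (rule pullback_linear[OF zn_vector_space[OF M] zn_subspace[OF M] zn_str_linear[OF M neg_le[OF that]]])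
  fix b c d g assume g: "g \<in> dual_space (scl M) (piece M (- b))"
  show "pullback (piece M (- b)) (str M (- b) (- b)) g = g"
    using str_id[OF M] dual_spaceD(4)[OF g] by (auto simp: pullback_def fun_eq_iff)
  show "pullback (piece M (- d)) (str M (- d) (- c)) (pullback (piece M (- c)) (str M (- c) (- b)) g) =
    pullback (piece M (- d)) (str M (- d) (- b)) g" if "b \<le> c" "c \<le> d"
    using str_comp[OF M neg_le[OF that(2)] neg_le[OF that(1)]] zn_str(1)[OF M neg_le[OF that(2)]]
    by (auto simp: pullback_def fun_eq_iff)
qed

lemma zn_hom_dual:
  assumes M: "is_zn_module M" and N: "is_zn_module N" and f: "zn_hom M N f"
  shows "zn_hom (zn_dual N) (zn_dual M) (zn_dual_map M f)"
  unfolding zn_hom_def zn_dual_simps zn_dual_map_def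
proof (intro conjI allI impI ballI)
  show "linear_between (\<lambda>a g x. a * g x) (\<lambda>a g x. a * g x) (dual_space (scl N) (piece N (- b)))
      (dual_space (scl M) (piece M (- b))) (pullback (piece M (- b)) (f (- b)))" for b
    by (rule pullback_linear[OF zn_vector_space[OF M] zn_subspace[OF M] hom_linear[OF f]])
  fix b c :: "int ^ 'c" and g assume bc: "b \<le> c"
  show "pullback (piece M (- c)) (f (- c)) (pullback (piece N (- c)) (str N (- c) (- b)) g) =
      pullback (piece M (- c)) (str M (- c) (- b)) (pullback (piece M (- b)) (f (- b)) g)"
    using hom_nat[OF f neg_le[OF bc]] zn_hom_apply(1)[OF M f] zn_str(1)[OF M neg_le[OF bc]]
    by (auto simp: pullback_def fun_eq_iff)
qed

lemma zn_inj_dual: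
  assumes "zn_surj M N f"
  shows "zn_inj (zn_dual N) (zn_dual_map M f)"
  unfolding zn_inj_def zn_dual_simps zn_dual_map_def
  by (intro allI pullback_inj) (use assms in \<open>simp add: zn_surj_def\<close>)

lemma zn_surj_dual:
  assumes M: "is_zn_module M" and N: "is_zn_module N" and f: "zn_hom M N f" "zn_inj M f"
  shows "zn_surj (zn_dual N) (zn_dual M) (zn_dual_map M f)"
  unfolding zn_surj_def zn_dual_simps zn_dual_map_def
  by (intro allI pullback_surj[OF zn_vector_space[OF M] zn_subspace[OF M] zn_vector_space[OF N] zn_subspace[OF N]
        hom_linear[OF f(1)]]) (use f(2) in \<open>simp add: zn_inj_def\<close>)

lemma zn_iso_dual:
  assumes "is_zn_module M" "is_zn_module N" "zn_iso M N f"
  shows "zn_iso (zn_dual N) (zn_dual M) (zn_dual_map M f)"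
  using zn_hom_dual[OF assms(1,2)] zn_surj_dual[OF assms(1,2)] zn_inj_dual assms(3) unfolding zn_iso_def by auto

definition evaluation :: "('k::field, 'v::ab_group_add, 'n::finite) zn_module \<Rightarrow> int ^ 'n \<Rightarrow> 'v \<Rightarrow> ('v \<Rightarrow> 'k) \<Rightarrow> 'k" where
  "evaluation M b x = (\<lambda>g. if g \<in> dual_space (scl M) (piece M b) then g x else 0)"

text \<open>Reflexivity degree by degree, the two negations of degrees cancelling; surjectivity
  rests on the finite dimension of the components.\<close>

lemma zn_iso_evaluation:
  assumes M: "is_zn_module M" and fin: "zn_finite M"
  shows "zn_iso M (zn_dual (zn_dual M)) (evaluation M)"
proof (rule zn_isoI)
  let ?D = "\<lambda>b. dual_space (scl M) (piece M b)" and ?t = "\<lambda>a (g :: 'b \<Rightarrow> 'a) x. a * g x"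
  have ein: "evaluation M b x \<in> dual_space ?t (?D b)" if "x \<in> piece M b" for b x
    unfolding evaluation_def
    by (rule dual_space_restrict[OF _ vector_space_functionals subspace_dual_space[OF zn_vector_space[OF M] zn_subspace[OF M]]])
      (auto simp: linear_between_def)
  have eq: "evaluation M b x = \<Phi>" if "\<Phi> \<in> dual_space ?t (?D b)" "\<And>g. g \<in> ?D b \<Longrightarrow> \<Phi> g = g x" for b x \<Phi>
    using that dual_spaceD(4)[OF that(1)] by (auto simp: evaluation_def fun_eq_iff)
  show "zn_hom M (zn_dual (zn_dual M)) (evaluation M)"
  proof (rule zn_homI, unfold zn_dual_simps minus_minus)
    fix b c x y a assume x: "x \<in> piece M b"
    show "evaluation M b x \<in> dual_space ?t (?D b)" by (rule ein[OF x])
    show "evaluation M b (x + y) = evaluation M b x + evaluation M b y" if "y \<in> piece M b"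
      using dual_spaceD(2)[OF _ x that] by (auto simp: evaluation_def fun_eq_iff)
    show "evaluation M b (scl M a x) = (\<lambda>g. a * evaluation M b x g)"
      using dual_spaceD(3)[OF _ x] by (auto simp: evaluation_def fun_eq_iff)
    show "evaluation M c (str M b c x) = pullback (?D c) (pullback (piece M b) (str M b c)) (evaluation M b x)"
      if bc: "b \<le> c"
      using pullback_in_dual[OF zn_vector_space[OF M] zn_subspace[OF M] zn_str_linear[OF M bc]] x
      by (auto simp: evaluation_def pullback_def[of "?D c"] fun_eq_iff) (auto simp: pullback_def)
  qed
  fix b
  show "bij_betw (evaluation M b) (piece M b) (piece (zn_dual (zn_dual M)) b)"
    unfolding zn_dual_simps minus_minus
  proof (rule bij_betw_imageI)
    show "inj_on (evaluation M b) (piece M b)"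
    proof (rule inj_onI, rule ccontr)
      fix x y assume xy: "x \<in> piece M b" "y \<in> piece M b" "evaluation M b x = evaluation M b y" "x \<noteq> y"
      interpret vector_space "scl M" by (rule zn_vector_space[OF M])
      obtain \<psi> where \<psi>: "Vector_Spaces.linear (scl M) (*) \<psi>" "\<psi> (x - y) = 1"
        by (rule functional_separation[OF zn_vector_space[OF M] subspace_single_0, of "x - y"])
          (use xy(4) that in auto)
      let ?g = "\<lambda>x. if x \<in> piece M b then \<psi> x else 0"
      have "?g \<in> ?D b"
        by (rule dual_space_restrict[OF linear_betweenI_linear[OF \<psi>(1)] zn_vector_space[OF M] zn_subspace[OF M]]) simp
      then have "\<psi> x = \<psi> y" using fun_cong[OF xy(3), of ?g] xy(1,2) by (simp add: evaluation_def)
      moreover have "\<psi> x = \<psi> (x - y) + \<psi> y"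
        using \<psi>(1) unfolding Vector_Spaces.linear_iff by (metis diff_add_cancel)
      ultimately show False using \<psi>(2) by simp
    qed
    obtain B where B: "finite B" "module.span (scl M) B = piece M b" using fin unfolding zn_finite_def by blast
    have "\<Phi> \<in> evaluation M b ` piece M b" if \<Phi>: "\<Phi> \<in> dual_space ?t (?D b)" for \<Phi>
      using dual_space_finite(2)[OF zn_vector_space[OF M] zn_subspace[OF M] B \<Phi>] eq[OF \<Phi>] by blast
    then show "evaluation M b ` piece M b = dual_space ?t (?D b)" using ein by blast
  qed
qed

lemma finitely_determined_dual:
  fixes M :: "('k::field, 'v::ab_group_add, 'n::finite) zn_module"
  assumes M: "is_zn_module M" and fd: "finitely_determined M"
  shows "finitely_determined (zn_dual M)"
proof -
  have "zn_finite (zn_dual M)"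
    unfolding zn_finite_def zn_dual_simps
  proof
    fix b
    obtain B where B: "finite B" "module.span (scl M) B = piece M (- b)"
      using fd unfolding finitely_determined_def zn_finite_def by blast
    show "\<exists>D. finite D \<and> module.span (\<lambda>a g x. a * g x) D = dual_space (scl M) (piece M (- b))"
      by (rule dual_space_finite(1)[OF zn_vector_space[OF M] zn_subspace[OF M] B])
  qed
  moreover obtain L where L: "L \<ge> 0" "determined_in L M" using fd unfolding finitely_determined_iff by auto
  have "determined_in L (zn_dual M)"
    unfolding determined_in_def
  proof (intro allI impI)
    fix i :: 'n and b :: "int ^ 'n" assume b: "b $ i < - L \<or> L \<le> b $ i"
    let ?c = "b + axis i 1"
    have c: "(- ?c) $ i < - L \<or> L \<le> (- ?c) $ i" "- b = - ?c + axis i 1" using b by (auto simp: axis_def)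
    have bij: "bij_betw (str M (- ?c) (- b)) (piece M (- ?c)) (piece M (- b))"
      using L(2) c unfolding determined_in_def by metis
    have le: "- ?c \<le> - b" by (rule neg_le[OF le_add_axis])
    show "bij_betw (str (zn_dual M) b ?c) (piece (zn_dual M) b) (piece (zn_dual M) ?c)"
      unfolding zn_dual_simps
      by (intro bij_betw_imageI pullback_inj bij_betw_imp_surj_on[OF bij] bij_betw_imp_inj_on[OF bij]
        pullback_surj[OF zn_vector_space[OF M] zn_subspace[OF M] zn_vector_space[OF M] zn_subspace[OF M] zn_str_linear[OF M le]])
  qed
  ultimately show ?thesis using L(1) unfolding finitely_determined_iff by blast
qed

lemma direct_sum_indicator_piece:
  "piece (direct_sum m (\<lambda>i. indicator_module (S i))) b = {x. \<forall>i. x i \<noteq> 0 \<longrightarrow> i < m \<and> b \<in> S i}"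
  by (auto simp: not_less[symmetric])

text \<open>A functional on a finite direct sum is its vector of values on the unit vectors. These
  values vanish automatically for summands absent in degree \<open>- b\<close>, because functionals
  are normalised to vanish off the component.\<close>

lemma dual_direct_sum_indicator:
  fixes S :: "nat \<Rightarrow> (int ^ 'n::finite) set"
  assumes conv: "\<And>i b c d. b \<le> c \<Longrightarrow> c \<le> d \<Longrightarrow> b \<in> S i \<Longrightarrow> d \<in> S i \<Longrightarrow> c \<in> S i"
  obtains \<theta> where "zn_iso (zn_dual (direct_sum m (\<lambda>i. indicator_module (S i) :: ('k::field, 'k, 'n) zn_module)))
    (direct_sum m (\<lambda>i. indicator_module {c. - c \<in> S i} :: ('k, 'k, 'n) zn_module)) \<theta>"
proof -
  let ?M = "direct_sum m (\<lambda>i. indicator_module (S i) :: ('k, 'k, 'n) zn_module)"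
  let ?N = "direct_sum m (\<lambda>i. indicator_module {c. - c \<in> S i} :: ('k, 'k, 'n) zn_module)"
  have M: "is_zn_module ?M" by (rule zn_module_direct_sum_indicator) (fact conv)
  define \<theta> :: "int ^ 'n \<Rightarrow> ((nat \<Rightarrow> 'k) \<Rightarrow> 'k) \<Rightarrow> nat \<Rightarrow> 'k" where
    "\<theta> b g = (\<lambda>i. if i < m then g (unit_vec i) else 0)" for b g
  have u: "unit_vec i \<in> piece ?M b \<longleftrightarrow> i < m \<and> b \<in> S i" for i b
    by (auto simp: unit_vec_def)
  have exp: "g x = (\<Sum>i<m. x i * g (unit_vec i))" if g: "g \<in> dual_space (scl ?M) (piece ?M b)" and x: "x \<in> piece ?M b" for g x b
  proof -
    interpret vector_space "scl ?M" by (rule zn_vector_space[OF M])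
    have m: "(\<lambda>j. x i * unit_vec i j) \<in> piece ?M b" for i using x by (auto simp: unit_vec_def split: if_splits)
    have *: "g (\<Sum>i\<in>J. (\<lambda>j. x i * unit_vec i j)) = (\<Sum>i\<in>J. g (\<lambda>j. x i * unit_vec i j))" if "finite J" for J
      using that
    proof induction
      case empty
      show ?case using linear_between_zero[OF dual_spaceD(1)[OF g] zn_piece(1)[OF M]] by (simp add: zero_fun_def)
    next
      case (insert i J)
      have "(\<Sum>i\<in>J. (\<lambda>j. x i * unit_vec i j)) \<in> piece ?M b" by (rule zn_piece(5)[OF M m])
      then show ?case using insert dual_spaceD(2)[OF g m[of i]] by (simp add: plus_fun_def)
    qed
    have **: "g (\<lambda>j. x i * unit_vec i j) = x i * g (unit_vec i)" for i
    proof (cases "x i = 0")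
      case True
      then show ?thesis using linear_between_zero[OF dual_spaceD(1)[OF g] zn_piece(1)[OF M]] by (simp add: zero_fun_def)
    next
      case False
      then have "unit_vec i \<in> piece ?M b" unfolding u using x[unfolded direct_sum_indicator_piece] by blast
      then show ?thesis using dual_spaceD(3)[OF g, of "unit_vec i" "x i"] by simp
    qed
    have "x = (\<Sum>i<m. (\<lambda>j. x i * unit_vec i j))" by (rule unit_vec_expand) (use x[unfolded direct_sum_indicator_piece] in blast)
    then have "g x = (\<Sum>i<m. g (\<lambda>j. x i * unit_vec i j))" using *[of "{..<m}"] by simp
    then show ?thesis using ** by simp
  qed
  have "zn_iso (zn_dual ?M) ?N \<theta>"
  proof (rule zn_isoI)
    show "zn_hom (zn_dual ?M) ?N \<theta>"
    proof (rule zn_homI)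
      fix b c g assume g: "g \<in> piece (zn_dual ?M) b"
      then have gu: "g (unit_vec i) = 0" if "i < m" "- b \<notin> S i" for i
        using dual_spaceD(4)[of g _ _ "unit_vec i"] u[of i "- b"] that by simp
      then show "\<theta> b g \<in> piece ?N b" by (auto simp: \<theta>_def split: if_splits)
      show "\<theta> c (str (zn_dual ?M) b c g) = str ?N b c (\<theta> b g)" if bc: "b \<le> c"
      proof
        fix i
        have g0: "g (\<lambda>i. 0) = 0" using linear_between_zero[OF dual_spaceD(1), of g "scl ?M" "piece ?M (- b)"] g zn_piece(1)[OF M]
          by (simp add: zero_fun_def del: direct_sum_simps)
        have "str ?M (- c) (- b) (unit_vec i) = (if - c \<in> S i \<and> - b \<in> S i \<and> i < m then unit_vec i else (\<lambda>i. 0))"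
          by (auto simp: unit_vec_def fun_eq_iff)
        then show "\<theta> c (str (zn_dual ?M) b c g) i = str ?N b c (\<theta> b g) i"
          using u[of i "- c"] gu[of i] g0 by (simp add: \<theta>_def pullback_def del: direct_sum_simps) (auto)
      qed
    qed (auto simp: \<theta>_def fun_eq_iff)
    fix b
    show "bij_betw (\<theta> b) (piece (zn_dual ?M) b) (piece ?N b)"
    proof (rule bij_betw_imageI)
      show "inj_on (\<theta> b) (piece (zn_dual ?M) b)"
      proof (rule inj_onI)
        fix g h assume gh: "g \<in> piece (zn_dual ?M) b" "h \<in> piece (zn_dual ?M) b" "\<theta> b g = \<theta> b h"
        have "g (unit_vec i) = h (unit_vec i)" if "i < m" for i
          using fun_cong[OF gh(3), of i] that by (simp add: \<theta>_def)
        then show "g = h" using gh(1,2) exp[of g "- b"] exp[of h "- b"]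
          by (intro dual_space_eqI[of g "scl ?M" "piece ?M (- b)" h]) (simp_all del: direct_sum_simps)
      qed
      show "\<theta> b ` piece (zn_dual ?M) b = piece ?N b"
      proof
        show "\<theta> b ` piece (zn_dual ?M) b \<subseteq> piece ?N b"
          using zn_hom_apply(1)[OF zn_module_dual[OF M] \<open>zn_hom (zn_dual ?M) ?N \<theta>\<close>] by blast
        show "piece ?N b \<subseteq> \<theta> b ` piece (zn_dual ?M) b"
        proof
          fix y assume y: "y \<in> piece ?N b"
          let ?g = "\<lambda>x. if x \<in> piece ?M (- b) then (\<Sum>i<m. y i * x i) else 0"
          have "?g \<in> dual_space (scl ?M) (piece ?M (- b))"
            by (rule dual_space_restrict[OF _ zn_vector_space[OF M] zn_subspace[OF M]])
              (auto simp: linear_between_def sum.distrib[symmetric] sum_distrib_left algebra_simps)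
          moreover have "\<theta> b ?g = y"
          proof
            fix i
            have "(\<Sum>j<m. y j * unit_vec i j) = (if i < m then y i else 0)"
              by (simp add: unit_vec_def if_distrib cong: if_cong)
            then show "\<theta> b ?g i = y i" using u[of i "- b"] y
              by (auto simp: \<theta>_def)
          qed
          ultimately show "y \<in> \<theta> b ` piece (zn_dual ?M) b" by (intro image_eqI[of _ _ ?g]) simp_all
        qed
      qed
    qed
  qed
  then show thesis by (rule that)
qed

section \<open>Injective hulls\<close>

lemma flat_region_convex:
  "b \<le> c \<Longrightarrow> c \<le> d \<Longrightarrow> b \<in> flat_region a T \<Longrightarrow> d \<in> flat_region a T \<Longrightarrow> c \<in> flat_region a T"
  by (auto simp: flat_region_eq less_eq_vec_def intro: order_trans)

lemma injective_region_convex: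
  "b \<le> c \<Longrightarrow> c \<le> d \<Longrightarrow> b \<in> injective_region a T \<Longrightarrow> d \<in> injective_region a T \<Longrightarrow> c \<in> injective_region a T"
  by (auto simp: injective_region_eq less_eq_vec_def intro: order_trans)

lemma neg_flat_region: "{c. - c \<in> flat_region b T} = injective_region (- b) T"
  by (auto simp: flat_region_eq injective_region_eq)

lemma neg_injective_region: "{c. - c \<in> injective_region b T} = flat_region (- b) T"
  by (auto simp: flat_region_eq injective_region_eq)

abbreviation flat_sum :: "nat \<Rightarrow> (nat \<Rightarrow> int ^ 'n::finite) \<Rightarrow> (nat \<Rightarrow> 'n set) \<Rightarrow> ('k::field, 'n) std_module" where
  "flat_sum m b T \<equiv> direct_sum m (\<lambda>i. indicator_module (flat_region (b i) (T i)))"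

abbreviation injective_sum :: "nat \<Rightarrow> (nat \<Rightarrow> int ^ 'n::finite) \<Rightarrow> (nat \<Rightarrow> 'n set) \<Rightarrow> ('k::field, 'n) std_module" where
  "injective_sum m b T \<equiv> direct_sum m (\<lambda>i. indicator_module (injective_region (b i) (T i)))"

lemma zn_module_flat_sum: "is_zn_module (flat_sum m b T :: ('k::field, 'n::finite) std_module)"
  by (rule zn_module_direct_sum_indicator) (rule flat_region_convex)

lemma flat_summands_flat_sum: "flat_summands (flat_sum m b T :: ('k::field, 'n::finite) std_module) m"
  unfolding flat_summands_def zn_isomorphic_def
  by (intro conjI zn_module_flat_sum exI[of _ b] exI[of _ T]) (rule exI, rule zn_iso_refl)

lemma zn_module_injective_sum: "is_zn_module (injective_sum m b T :: ('k::field, 'n::finite) std_module)"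
  by (rule zn_module_direct_sum_indicator) (rule injective_region_convex)

lemma injective_summands_injective_sum: "injective_summands (injective_sum m b T :: ('k::field, 'n::finite) std_module) m"
  unfolding injective_summands_def zn_isomorphic_def
  by (intro conjI zn_module_injective_sum exI[of _ b] exI[of _ T]) (rule exI, rule zn_iso_refl)

text \<open>Negation carries flat regions to injective ones, so duality exchanges the two kinds of
  modules and preserves the number of summands.\<close>

lemma injective_summands_dual:
  fixes F :: "('k::field, 'f::ab_group_add, 'n::finite) zn_module"
  assumes "flat_summands F m"
  shows "injective_summands (zn_dual F) m"
proof -
  have F: "is_zn_module F" using assms by (simp add: flat_summands_def)
  obtain b T a where a: "zn_iso F (flat_sum m b T :: ('k, 'n) std_module) a"
    using assms unfolding flat_summands_def zn_isomorphic_def by blast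
  let ?S = "flat_sum m b T :: ('k, 'n) std_module"
  note S = zn_module_flat_sum[of m b T, where ?'k = 'k]
  obtain \<theta> where \<theta>: "zn_iso (zn_dual ?S) (injective_sum m (\<lambda>i. - b i) T) \<theta>"
    by (rule dual_direct_sum_indicator[of "\<lambda>i. flat_region (b i) (T i)" m, OF flat_region_convex])
      (assumption+, unfold neg_flat_region, rule that)
  have "zn_isomorphic (zn_dual F) (zn_dual ?S)"
    using zn_isomorphic_sym[OF zn_module_dual[OF S]] zn_iso_dual[OF F S a] unfolding zn_isomorphic_def by blast
  then show ?thesis
    unfolding injective_summands_def
    using zn_module_dual[OF F] zn_isomorphic_trans[OF _ exI[of "zn_iso _ _", OF \<theta>, folded zn_isomorphic_def]]
    by (intro conjI exI[of _ "\<lambda>i. - b i"] exI[of _ T])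
qed

lemma flat_summands_dual:
  fixes E :: "('k::field, 'e::ab_group_add, 'n::finite) zn_module"
  assumes "injective_summands E m"
  shows "flat_summands (zn_dual E) m"
proof -
  have E: "is_zn_module E" using assms by (simp add: injective_summands_def)
  obtain b T a where a: "zn_iso E (injective_sum m b T :: ('k, 'n) std_module) a"
    using assms unfolding injective_summands_def zn_isomorphic_def by blast
  let ?S = "injective_sum m b T :: ('k, 'n) std_module"
  note S = zn_module_injective_sum[of m b T, where ?'k = 'k]
  obtain \<theta> where \<theta>: "zn_iso (zn_dual ?S) (flat_sum m (\<lambda>i. - b i) T) \<theta>"
    by (rule dual_direct_sum_indicator[of "\<lambda>i. injective_region (b i) (T i)" m, OF injective_region_convex])
      (assumption+, unfold neg_injective_region, rule that)
  have "zn_isomorphic (zn_dual E) (zn_dual ?S)"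
    using zn_isomorphic_sym[OF zn_module_dual[OF S]] zn_iso_dual[OF E S a] unfolding zn_isomorphic_def by blast
  then show ?thesis
    unfolding flat_summands_def
    using zn_module_dual[OF E] zn_isomorphic_trans[OF _ exI[of "zn_iso _ _", OF \<theta>, folded zn_isomorphic_def]]
    by (intro conjI exI[of _ "\<lambda>i. - b i"] exI[of _ T])
qed

text \<open>An injective sum is isomorphic to the dual of the flat sum with negated base points, so
  determinacy is inherited through duality.\<close>

lemma finitely_determined_injective:
  fixes E :: "('k::field, 'e::ab_group_add, 'n::finite) zn_module"
  assumes "injective_summands E m"
  shows "finitely_determined E"
proof -
  have E: "is_zn_module E" using assms by (simp add: injective_summands_def)
  obtain b T a where a: "zn_iso E (injective_sum m b T :: ('k, 'n) std_module) a"
    using assms unfolding injective_summands_def zn_isomorphic_def by blast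
  let ?S = "flat_sum m (\<lambda>i. - b i) T :: ('k, 'n) std_module" and ?I = "injective_sum m b T :: ('k, 'n) std_module"
  note S = zn_module_flat_sum[of m "\<lambda>i. - b i" T, where ?'k = 'k]
  note I = zn_module_injective_sum[of m b T, where ?'k = 'k]
  obtain \<theta> where "zn_iso (zn_dual ?S) (injective_sum m (\<lambda>i. - (- b i)) T) \<theta>"
    by (rule dual_direct_sum_indicator[of "\<lambda>i. flat_region (- b i) (T i)" m, OF flat_region_convex])
      (assumption+, unfold neg_flat_region, rule that)
  then have \<theta>: "zn_iso (zn_dual ?S) ?I \<theta>" by simp
  have "finitely_determined (zn_dual ?S)"
    by (rule finitely_determined_dual[OF S finitely_determined_flat[OF flat_summands_flat_sum]])
  then have "finitely_determined ?I" by (rule finitely_determined_iso[OF zn_module_dual[OF S] I \<theta>])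
  moreover obtain g where "zn_iso ?I E g" using zn_iso_sym[OF E a] by blast
  ultimately show ?thesis using finitely_determined_iso[OF I E] by blast
qed

text \<open>Dualising the cover embeds the double dual of \<open>N\<close>, hence \<open>N\<close>
  itself, in the dual of \<open>F\<close>. As that dual lives in a function space, it is replaced by
  an explicit injective sum with the same number of summands, which is an admissible competitor in
  \<open>std_module\<close>.\<close>

lemma hull_of_dual_cover:
  fixes N :: "('k::field, 'v::ab_group_add, 'n::finite) zn_module"
  assumes N: "is_zn_module N" "finitely_determined N" and p: "flat_cover (zn_dual N) F p" and m: "flat_summands F m"
  shows "\<exists>(E :: ('k, 'n) std_module) j. injective_hull N E j \<and> injective_summands E m"
proof -
  have F: "is_zn_module F" by (rule flat_cover_module[OF p])
  note DN = zn_module_dual[OF N(1)]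
  have p1: "zn_hom F (zn_dual N) p" "zn_surj F (zn_dual N) p" using p by (simp_all add: flat_cover_def)
  have ev: "zn_iso N (zn_dual (zn_dual N)) (evaluation N)"
    by (rule zn_iso_evaluation) (use N in \<open>auto simp: finitely_determined_def\<close>)
  obtain b T \<gamma> where \<gamma>: "zn_iso (zn_dual F) (injective_sum m b T :: ('k, 'n) std_module) \<gamma>"
    using injective_summands_dual[OF m] unfolding injective_summands_def zn_isomorphic_def by blast
  let ?E = "injective_sum m b T :: ('k, 'n) std_module"
  let ?j = "\<lambda>b x. \<gamma> b (zn_dual_map F p b (evaluation N b x))"
  have h1: "zn_hom (zn_dual (zn_dual N)) (zn_dual F) (zn_dual_map F p)" by (rule zn_hom_dual[OF F DN p1(1)])
  have "zn_hom N ?E ?j"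
    by (rule zn_hom_comp[OF zn_hom_comp[OF zn_isoD(1)[OF ev] h1] zn_isoD(1)[OF \<gamma>]])
  moreover have "zn_inj N ?j"
    unfolding zn_inj_def
  proof (intro allI inj_onI)
    fix b x y assume xy: "x \<in> piece N b" "y \<in> piece N b" "?j b x = ?j b y"
    note e = zn_hom_apply(1)[OF N(1) zn_isoD(1)[OF ev]]
    note f = zn_hom_apply(1)[OF zn_module_dual[OF DN] h1]
    have "zn_dual_map F p b (evaluation N b x) = zn_dual_map F p b (evaluation N b y)"
      using xy(3) zn_isoD(3)[OF \<gamma> f[OF e[OF xy(1)]] f[OF e[OF xy(2)]]] by simp
    then have "evaluation N b x = evaluation N b y"
      using zn_inj_dual[OF p1(2)] e[OF xy(1)] e[OF xy(2)] unfolding zn_inj_def inj_on_def by blast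
    then show "x = y" using zn_isoD(3)[OF ev xy(1,2)] by simp
  qed
  ultimately have "injective_hull N ?E ?j"
    unfolding injective_hull_def finite_injective_def using injective_summands_injective_sum by blast
  then show ?thesis using injective_summands_injective_sum by blast
qed

lemma minimal_injective_hullD:
  assumes "minimal_injective_hull N E j"
  shows "is_zn_module E" "zn_hom N E j" "zn_inj N j" "finite_injective E" "finitely_determined E"
  using assms finitely_determined_injective[of E]
  by (auto simp: minimal_injective_hull_def injective_hull_def finite_injective_def injective_summands_def)

text \<open>A cover of the dual with fewer summands would give, by
  \<open>hull_of_dual_cover\<close>, a hull of \<open>N\<close> with fewer summands; so minimality
  passes to the dual.\<close>

lemma minimal_flat_cover_dual:
  fixes N :: "('k::field, 'v::ab_group_add, 'n::finite) zn_module"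
  assumes N: "is_zn_module N" "finitely_determined N" and j: "minimal_injective_hull N E j"
  shows "minimal_flat_cover (zn_dual N) (zn_dual E) (zn_dual_map N j)"
proof -
  note jD = minimal_injective_hullD[OF j]
  obtain m where m: "injective_summands E m"
    and min: "\<And>(E' :: ('k, 'n) std_module) j' m'. injective_hull N E' j' \<Longrightarrow> injective_summands E' m' \<Longrightarrow> m \<le> m'"
    using j unfolding minimal_injective_hull_def by blast
  have fs: "flat_summands (zn_dual E) m" by (rule flat_summands_dual[OF m])
  then have "flat_cover (zn_dual N) (zn_dual E) (zn_dual_map N j)"
    using zn_hom_dual[OF N(1) jD(1,2)] zn_surj_dual[OF N(1) jD(1,2,3)]
    unfolding flat_cover_def finite_flat_def by blast
  moreover have "flat_cover_bound (zn_dual N) m"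
    unfolding flat_cover_bound_def using hull_of_dual_cover[OF N] min by blast
  ultimately show ?thesis using fs unfolding minimal_flat_cover_iff by blast
qed

lemma minimal_injective_hull_exists:
  fixes N :: "('k::field, 'v::ab_group_add, 'n::finite) zn_module"
  assumes N: "is_zn_module N" "finitely_determined N"
  obtains E :: "('k, 'n) std_module" and j where "minimal_injective_hull N E j"
proof -
  let ?P = "\<lambda>m. \<exists>(E :: ('k, 'n) std_module) j. injective_hull N E j \<and> injective_summands E m"
  obtain F :: "('k, 'n) std_module" and p where p: "minimal_flat_cover (zn_dual N) F p"
    using minimal_flat_cover_exists[OF zn_module_dual[OF N(1)] finitely_determined_dual[OF N]] by blast
  then obtain m where "flat_summands F m" unfolding minimal_flat_cover_def by blast
  then have "?P m" by (rule hull_of_dual_cover[OF N minimal_flat_coverD(6)[OF p]])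
  then have "?P (LEAST m. ?P m)" by (rule LeastI)
  then obtain E :: "('k, 'n) std_module" and j where Ej: "injective_hull N E j" "injective_summands E (LEAST m. ?P m)" by blast
  have "(LEAST m. ?P m) \<le> m'" if "injective_hull N E' j'" "injective_summands E' m'"
    for E' :: "('k, 'n) std_module" and j' m'
    using that by (intro Least_le) blast
  then have "minimal_injective_hull N E j"
    unfolding minimal_injective_hull_def using Ej by blast
  then show thesis by (rule that)
qed

lemma minimal_injective_hull_unique:
  fixes N :: "('k::field, 'v::ab_group_add, 'n::finite) zn_module"
    and E :: "('k, 'e::ab_group_add, 'n) zn_module" and E' :: "('k, 'h::ab_group_add, 'n) zn_module"
  assumes N: "is_zn_module N" "finitely_determined N"
    and j: "minimal_injective_hull N E j" and j': "minimal_injective_hull N E' j'"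
  obtains \<beta> where "zn_iso E E' \<beta>" "\<And>b x. x \<in> piece N b \<Longrightarrow> \<beta> b (j b x) = j' b x"
proof -
  note jD = minimal_injective_hullD[OF j] and jD' = minimal_injective_hullD[OF j']
  \<comment> \<open>The two hulls are taken in the opposite order, since dualising the isomorphism
    \<open>\<alpha>\<close> once more reverses its direction.\<close>
  obtain \<alpha> where \<alpha>: "zn_iso (zn_dual E') (zn_dual E) \<alpha>"
    "\<And>b g. g \<in> piece (zn_dual E') b \<Longrightarrow> zn_dual_map N j b (\<alpha> b g) = zn_dual_map N j' b g"
    by (rule minimal_flat_cover_unique[OF zn_module_dual[OF N(1)] finitely_determined_dual[OF N]
          minimal_flat_cover_dual[OF N j'] minimal_flat_cover_dual[OF N j]]) (rule that; assumption)
  have fin: "zn_finite E" "zn_finite E'" using jD(5) jD'(5) by (simp_all add: finitely_determined_def)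
  note ev = zn_iso_evaluation[OF jD(1) fin(1)] and ev' = zn_iso_evaluation[OF jD'(1) fin(2)]
  obtain g where g: "zn_iso (zn_dual (zn_dual E')) E' g" "\<And>b x. x \<in> piece E' b \<Longrightarrow> g b (evaluation E' b x) = x"
    "\<And>b y. y \<in> piece (zn_dual (zn_dual E')) b \<Longrightarrow> evaluation E' b (g b y) = y"
    by (rule zn_iso_inverse[OF jD'(1) ev']) (rule that; assumption)
  have D\<alpha>: "zn_iso (zn_dual (zn_dual E)) (zn_dual (zn_dual E')) (zn_dual_map (zn_dual E') \<alpha>)"
    by (rule zn_iso_dual[OF zn_module_dual[OF jD'(1)] zn_module_dual[OF jD(1)] \<alpha>(1)])
  let ?\<beta> = "\<lambda>b x. g b (zn_dual_map (zn_dual E') \<alpha> b (evaluation E b x))"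
  have "zn_iso E E' ?\<beta>" by (rule zn_iso_trans[OF zn_iso_trans[OF ev D\<alpha>] g(1)])
  moreover have "?\<beta> b (j b x) = j' b x" if x: "x \<in> piece N b" for b x
  proof -
    have "zn_dual_map (zn_dual E') \<alpha> b (evaluation E b (j b x)) = evaluation E' b (j' b x)"
    proof
      fix \<psi>
      show "zn_dual_map (zn_dual E') \<alpha> b (evaluation E b (j b x)) \<psi> = evaluation E' b (j' b x) \<psi>"
      proof (cases "\<psi> \<in> piece (zn_dual E') (- b)")
        case True
        have "\<alpha> (- b) \<psi> \<in> piece (zn_dual E) (- b)"
          by (rule zn_hom_apply(1)[OF zn_module_dual[OF jD'(1)] zn_isoD(1)[OF \<alpha>(1)] True])
        moreover have "\<alpha> (- b) \<psi> (j b x) = \<psi> (j' b x)"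
          using fun_cong[OF \<alpha>(2)[OF True], of x] x by (simp add: zn_dual_map_def pullback_def)
        ultimately show ?thesis using True by (simp add: zn_dual_map_def pullback_def evaluation_def)
      qed (simp add: zn_dual_map_def pullback_def evaluation_def)
    qed
    then show ?thesis using g(2) zn_hom_apply(1)[OF N(1) jD'(2) x] by simp
  qed
  ultimately show thesis by (rule that)
qed

lemma injective_hull_source:
  assumes "injective_hull N E j" "zn_iso N' N \<theta>"
  shows "injective_hull N' E (\<lambda>b x. j b (\<theta> b x))"
proof -
  have "zn_inj N' (\<lambda>b x. j b (\<theta> b x))"
    using assms zn_isoD(2,3)[OF assms(2)] unfolding injective_hull_def zn_inj_def inj_on_def bij_betw_def by blast
  then show ?thesis using assms zn_hom_comp[OF zn_isoD(1)[OF assms(2)]] unfolding injective_hull_def by blast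
qed

lemma minimal_injective_hull_source:
  assumes N: "is_zn_module N'" and \<theta>: "zn_iso N' N \<theta>" and j: "minimal_injective_hull N E j"
  shows "minimal_injective_hull N' E (\<lambda>b x. j b (\<theta> b x))"
proof -
  obtain \<theta>' where \<theta>': "zn_iso N N' \<theta>'" using zn_iso_sym[OF N \<theta>] by blast
  show ?thesis
    using j injective_hull_source[OF _ \<theta>] injective_hull_source[OF _ \<theta>'] unfolding minimal_injective_hull_def by blast
qed

lemma minimal_injective_hull_unique_iso:
  fixes N :: "('k::field, 'v::ab_group_add, 'n::finite) zn_module"
    and E :: "('k, 'e::ab_group_add, 'n) zn_module" and E' :: "('k, 'h::ab_group_add, 'n) zn_module"
  assumes N: "is_zn_module N" "finitely_determined N" and \<theta>: "zn_iso N N' \<theta>"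
    and j: "minimal_injective_hull N E j" and j': "minimal_injective_hull N' E' j'"
  obtains \<beta> where "zn_iso E E' \<beta>" "\<And>b x. x \<in> piece N b \<Longrightarrow> \<beta> b (j b x) = j' b (\<theta> b x)"
  by (rule minimal_injective_hull_unique[OF N j minimal_injective_hull_source[OF N(1) \<theta> j']])
    (rule that; assumption)

text \<open>Functionals on the quotient of \<open>M\<close> by the image of \<open>f\<close> are the
  functionals on \<open>M\<close> that vanish on that image, and these form the kernel of the dual
  of \<open>f\<close>.\<close>

lemma zn_iso_dual_cokernel:
  assumes K: "is_zn_module K" and M: "is_zn_module M" and f: "zn_hom K M f" and C: "is_cokernel K M f C q"
  shows "zn_iso (zn_dual C) (zn_kernel (zn_dual M) (zn_dual_map K f)) (zn_dual_map M q)"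
proof -
  have q: "is_zn_module C" "zn_hom M C q" "zn_surj M C q" and ex: "\<And>b. f b ` piece K b = {x \<in> piece M b. q b x = 0}"
    using C by (auto simp: is_cokernel_def exact_at_def)
  note h = zn_hom_dual[OF M q(1,2)]
  have "zn_dual_map K f b (zn_dual_map M q b g) = 0" if g: "g \<in> piece (zn_dual C) b" for b g
  proof
    fix x
    have "g 0 = 0"
      using linear_between_zero[OF dual_spaceD(1)] g zn_piece(1)[OF q(1)] by auto
    moreover have "q (- b) (f (- b) x) = 0" if "x \<in> piece K (- b)" using ex[of "- b"] that by blast
    ultimately show "zn_dual_map K f b (zn_dual_map M q b g) x = 0 x"
      by (simp add: zn_dual_map_def pullback_def)
  qed
  then have hom: "zn_hom (zn_dual C) (zn_kernel (zn_dual M) (zn_dual_map K f)) (zn_dual_map M q)"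
    by (rule zn_hom_into_kernel[OF h])
  moreover have "zn_inj (zn_dual C) (zn_dual_map M q)" by (rule zn_inj_dual[OF q(3)])
  moreover have "zn_surj (zn_dual C) (zn_kernel (zn_dual M) (zn_dual_map K f)) (zn_dual_map M q)"
    unfolding zn_surj_def
  proof (intro allI equalityI)
    fix b
    show "zn_dual_map M q b ` piece (zn_dual C) b \<subseteq> piece (zn_kernel (zn_dual M) (zn_dual_map K f)) b"
      using zn_hom_apply(1)[OF zn_module_dual[OF q(1)] hom] by blast
    show "piece (zn_kernel (zn_dual M) (zn_dual_map K f)) b \<subseteq> zn_dual_map M q b ` piece (zn_dual C) b"
    proof
      fix g assume "g \<in> piece (zn_kernel (zn_dual M) (zn_dual_map K f)) b"
      then have g: "g \<in> dual_space (scl M) (piece M (- b))" and k: "zn_dual_map K f b g = 0" by auto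
      have "g x = 0" if "x \<in> piece M (- b)" "q (- b) x = 0" for x
      proof -
        have "x \<in> f (- b) ` piece K (- b)" unfolding ex using that by simp
        then obtain y where "y \<in> piece K (- b)" "x = f (- b) y" by blast
        then show ?thesis using fun_cong[OF k, of y] by (simp add: zn_dual_map_def pullback_def)
      qed
      then show "g \<in> zn_dual_map M q b ` piece (zn_dual C) b"
        unfolding zn_dual_map_def zn_dual_simps
        by (intro pullback_image[OF zn_vector_space[OF M] zn_subspace[OF M] zn_vector_space[OF q(1)]
              zn_subspace[OF q(1)] hom_linear[OF q(2)] g])
    qed
  qed
  ultimately show ?thesis by (simp add: zn_iso_def)
qed

text \<open>Combines the duality of cokernels and kernels with that of hulls and covers. With it a
  minimal injective resolution dualises, term by term, to a sequence of minimal flat covers of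
  syzygies.\<close>

lemma minimal_flat_cover_dual_cokernel:
  assumes K: "is_zn_module K" "finitely_determined K" and M: "is_zn_module M" "finitely_determined M"
    and f: "zn_hom K M f" and g: "minimal_hull_of_cokernel K f M g E"
  shows "minimal_flat_cover (zn_kernel (zn_dual M) (zn_dual_map K f)) (zn_dual E) (zn_dual_map M g)"
proof -
  obtain C :: "('a, 'c) std_module" and q j where C: "is_cokernel K M f C q" and j: "minimal_injective_hull C E j"
    and jq: "\<And>b x. x \<in> piece M b \<Longrightarrow> j b (q b x) = g b x"
    using g unfolding minimal_hull_of_cokernel_def by blast
  have Cm: "is_zn_module C" "zn_hom M C q" using C by (auto simp: is_cokernel_def)
  have "finitely_determined C" by (rule finitely_determined_cokernel[OF K(1) M(1) f C K(2) M(2)])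
  from minimal_flat_cover_target[OF zn_module_dual[OF Cm(1)] zn_iso_dual_cokernel[OF K(1) M(1) f C]
      minimal_flat_cover_dual[OF Cm(1) this j]]
  have "minimal_flat_cover (zn_kernel (zn_dual M) (zn_dual_map K f)) (zn_dual E)
    (\<lambda>b x. zn_dual_map M q b (zn_dual_map C j b x))" .
  then show ?thesis
    by (rule minimal_flat_cover_cong)
      (use jq zn_hom_apply(1)[OF M(1) Cm(2)] in \<open>auto simp: zn_dual_map_def pullback_def fun_eq_iff\<close>)
qed

text \<open>Coordinates on the quotient are chosen independently in each degree. Components of a
  module may overlap in the ambient space, so the choices in different degrees are linked by the
  structure maps alone.\<close>

lemma std_cokernel_exists:
  fixes M :: "('k::field, 'v::ab_group_add, 'n::finite) zn_module"
  assumes K: "is_zn_module K" and M: "is_zn_module M" "finitely_determined M" and f: "zn_hom K M f"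
  shows "\<exists>(C :: ('k, 'n) std_module) q. is_cokernel K M f C q"
proof -
  let ?t = "\<lambda>a (x :: nat \<Rightarrow> 'k) i. a * x i"
  have sub: "f b ` piece K b \<subseteq> piece M b" for b using zn_hom_apply(1)[OF K f] by blast
  have "\<exists>\<pi>. Vector_Spaces.linear (scl M) ?t \<pi> \<and> (\<forall>x\<in>piece M b. \<pi> x = 0 \<longleftrightarrow> x \<in> f b ` piece K b)" for b
  proof -
    obtain B where B: "finite B" "module.span (scl M) B = piece M b"
      using M(2) unfolding finitely_determined_def zn_finite_def by blast
    obtain \<pi> where "Vector_Spaces.linear (scl M) ?t \<pi>" "\<And>x. x \<in> piece M b \<Longrightarrow> \<pi> x = 0 \<longleftrightarrow> x \<in> f b ` piece K b"
      by (rule quotient_coordinates[OF zn_vector_space[OF M(1)]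
            subspace_linear_image[OF zn_vector_space[OF K] zn_vector_space[OF M(1)] zn_subspace[OF K] hom_linear[OF f]]
            sub zn_subspace[OF M(1)] B]) (rule that; assumption)
    then show ?thesis by blast
  qed
  then obtain \<pi> where \<pi>: "\<And>b. Vector_Spaces.linear (scl M) ?t (\<pi> b)"
    "\<And>b x. x \<in> piece M b \<Longrightarrow> \<pi> b x = 0 \<longleftrightarrow> x \<in> f b ` piece K b" by metis
  obtain C where C: "is_zn_module C" "scl C = ?t" "\<And>b. piece C b = \<pi> b ` piece M b"
    "zn_hom M C \<pi>" "zn_surj M C \<pi>"
  proof (rule quotient_module[OF M(1) vector_space_functionals])
    show "linear_between (scl M) ?t (piece M b) UNIV (\<pi> b)" for b by (rule linear_betweenI_linear[OF \<pi>(1)]) simp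
    show "\<pi> c (str M b c x) = 0" if bc: "b \<le> c" and x: "x \<in> piece M b" "\<pi> b x = 0" for b c x
    proof -
      obtain y where y: "y \<in> piece K b" "x = f b y" using \<pi>(2)[OF x(1)] x(2) by blast
      then have "str M b c x = f c (str K b c y)" using hom_nat[OF f bc y(1)] by simp
      then show ?thesis using \<pi>(2)[OF zn_str(1)[OF M(1) bc x(1)]] zn_str(1)[OF K bc y(1)] by blast
    qed
  qed (rule that; assumption)
  have "exact_at K f M \<pi>" unfolding exact_at_def using \<pi>(2) sub by blast
  then show ?thesis using C unfolding is_cokernel_def by blast
qed

section \<open>Injective copresentations and resolutions\<close>

lemma hull_of_cokernelD:
  fixes M :: "('k::field, 'v::ab_group_add, 'n::finite) zn_module"
  assumes M: "is_zn_module M" and g: "minimal_hull_of_cokernel K f M g E"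
  shows "is_zn_module E" "finite_injective E" "finitely_determined E" "zn_hom M E g" "exact_at K f M g"
proof -
  obtain C :: "('k, 'n) std_module" and q j where C: "is_cokernel K M f C q" and j: "minimal_injective_hull C E j"
    and jq: "\<And>b x. x \<in> piece M b \<Longrightarrow> j b (q b x) = g b x"
    using g unfolding minimal_hull_of_cokernel_def by blast
  have q: "is_zn_module C" "zn_hom M C q" and ex: "\<And>b. f b ` piece K b = {x \<in> piece M b. q b x = 0}"
    using C by (auto simp: is_cokernel_def exact_at_def)
  note jD = minimal_injective_hullD[OF j]
  show "is_zn_module E" "finite_injective E" "finitely_determined E" by (rule jD)+
  show "zn_hom M E g" by (rule zn_hom_cong[OF M zn_hom_comp[OF q(2) jD(2)]]) (simp add: jq)
  have "g b x = 0 \<longleftrightarrow> q b x = 0" if x: "x \<in> piece M b" for b x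
  proof -
    have "inj_on (j b) (piece C b)" using jD(3) by (simp add: zn_inj_def)
    then have "j b (q b x) = j b 0 \<longleftrightarrow> q b x = 0"
      using zn_hom_apply(1)[OF M q(2) x] zn_piece(1)[OF q(1)] by (simp add: inj_on_eq_iff)
    then show ?thesis using jq[OF x] zn_hom_apply(5)[OF q(1) jD(2)] by simp
  qed
  then show "exact_at K f M g" unfolding exact_at_def ex by auto
qed

lemma hull_of_cokernel_exists:
  fixes M :: "('k::field, 'v::ab_group_add, 'n::finite) zn_module"
  assumes K: "is_zn_module K" "finitely_determined K" and M: "is_zn_module M" "finitely_determined M"
    and f: "zn_hom K M f"
  shows "\<exists>g (E :: ('k, 'n) std_module). minimal_hull_of_cokernel K f M g E"
proof -
  obtain C :: "('k, 'n) std_module" and q where C: "is_cokernel K M f C q"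
    using std_cokernel_exists[OF K(1) M f] by blast
  have "is_zn_module C" using C by (simp add: is_cokernel_def)
  then obtain E :: "('k, 'n) std_module" and j where "minimal_injective_hull C E j"
    using minimal_injective_hull_exists[OF _ finitely_determined_cokernel[OF K(1) M(1) f C K(2) M(2)]] by blast
  then have "minimal_hull_of_cokernel K f M (\<lambda>b x. j b (q b x)) E"
    unfolding minimal_hull_of_cokernel_def using C by blast
  then show ?thesis by blast
qed

text \<open>A cokernel depends only on the image being divided out, so the hypothesis
  \<open>im\<close> compares images and leaves \<open>K\<close> and \<open>K'\<close> otherwise
  unrelated. The isomorphism \<open>\<theta>\<close> then descends to the cokernels, where
  uniqueness of hulls applies.\<close>

lemma hull_of_cokernel_unique:
  fixes M :: "('k::field, 'v::ab_group_add, 'n::finite) zn_module" and M' :: "('k, 'w::ab_group_add, 'n) zn_module"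
    and E :: "('k, 'e::ab_group_add, 'n) zn_module" and E' :: "('k, 'h::ab_group_add, 'n) zn_module"
  assumes K: "is_zn_module K" "finitely_determined K" and M: "is_zn_module M" "finitely_determined M"
    and f: "zn_hom K M f" and M': "is_zn_module M'" and \<theta>: "zn_iso M M' \<theta>"
    and im: "\<And>b. \<theta> b ` f b ` piece K b = f' b ` piece K' b"
    and g: "minimal_hull_of_cokernel K f M g E" and g': "minimal_hull_of_cokernel K' f' M' g' E'"
  obtains \<beta> where "zn_iso E E' \<beta>" "\<And>b x. x \<in> piece M b \<Longrightarrow> \<beta> b (g b x) = g' b (\<theta> b x)"
proof -
  obtain C :: "('k, 'n) std_module" and q j where C: "is_cokernel K M f C q" and j: "minimal_injective_hull C E j"
    and jq: "\<And>b x. x \<in> piece M b \<Longrightarrow> j b (q b x) = g b x"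
    using g unfolding minimal_hull_of_cokernel_def by blast
  obtain C' :: "('k, 'n) std_module" and q' j' where C': "is_cokernel K' M' f' C' q'"
    and j': "minimal_injective_hull C' E' j'" and jq': "\<And>b x. x \<in> piece M' b \<Longrightarrow> j' b (q' b x) = g' b x"
    using g' unfolding minimal_hull_of_cokernel_def by blast
  have q: "is_zn_module C" "zn_hom M C q" "zn_surj M C q" "\<And>b. f b ` piece K b = {x \<in> piece M b. q b x = 0}"
    using C by (auto simp: is_cokernel_def exact_at_def)
  have q': "is_zn_module C'" "zn_hom M' C' q'" "zn_surj M' C' q'" "\<And>b. f' b ` piece K' b = {x \<in> piece M' b. q' b x = 0}"
    using C' by (auto simp: is_cokernel_def exact_at_def)
  note th = zn_isoD[OF \<theta>]
  have thin: "\<theta> b x \<in> piece M' b" if "x \<in> piece M b" for b x by (rule zn_hom_apply(1)[OF M(1) th(1) that])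
  \<comment> \<open>Because \<open>\<theta>\<close> is injective and matches the images, the two
    quotient maps have the same kernel along \<open>\<theta>\<close>; this gives both the descent
    and its injectivity.\<close>
  have key: "q' b (\<theta> b x) = 0 \<longleftrightarrow> q b x = 0" if x: "x \<in> piece M b" for b x
  proof -
    have "q' b (\<theta> b x) = 0 \<longleftrightarrow> \<theta> b x \<in> \<theta> b ` f b ` piece K b"
      unfolding im q'(4) using thin[OF x] by simp
    also have "\<dots> \<longleftrightarrow> x \<in> f b ` piece K b"
      using th(3)[OF x] q(4)[of b] by fastforce
    finally show ?thesis unfolding q(4) using x by simp
  qed
  obtain \<xi> where \<xi>: "zn_hom C C' \<xi>" "\<And>b x. x \<in> piece M b \<Longrightarrow> \<xi> b (q b x) = q' b (\<theta> b x)"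
  proof (rule zn_hom_descend[OF M(1) q(1-3) q'(1) zn_hom_comp[OF th(1) q'(2)]])
    show "q' b (\<theta> b x) = 0" if "x \<in> piece M b" "q b x = 0" for b x using key that by blast
  qed (rule that; assumption)
  have "zn_iso C C' \<xi>"
  proof (rule zn_isoI[OF \<xi>(1)], rule bij_betw_imageI)
    fix b
    have qim: "q b ` piece M b = piece C b" "q' b ` piece M' b = piece C' b" using q(3) q'(3) by (simp_all add: zn_surj_def)
    show "inj_on (\<xi> b) (piece C b)"
    proof (rule inj_onI)
      fix u v assume uv: "u \<in> piece C b" "v \<in> piece C b" "\<xi> b u = \<xi> b v"
      then have "u \<in> q b ` piece M b" "v \<in> q b ` piece M b" unfolding qim by simp_all
      then obtain x y where xy: "x \<in> piece M b" "y \<in> piece M b" "u = q b x" "v = q b y" by auto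
      have "q' b (\<theta> b (x - y)) = 0"
        using uv(3) xy \<xi>(2) zn_hom_apply(3)[OF M(1) zn_hom_comp[OF th(1) q'(2)] xy(1,2)] by simp
      then have "q b (x - y) = 0" using key zn_piece(3)[OF M(1) xy(1,2)] by blast
      then show "u = v" using zn_hom_apply(3)[OF M(1) q(2) xy(1,2)] xy by simp
    qed
    have "\<xi> b ` q b ` piece M b = q' b ` \<theta> b ` piece M b"
      unfolding image_image using \<xi>(2) by (rule image_cong[OF refl])
    then show "\<xi> b ` piece C b = piece C' b"
      using th(2)[of b] unfolding qim bij_betw_def by (simp add: qim(2))
  qed
  then obtain \<beta> where \<beta>: "zn_iso E E' \<beta>" "\<And>b x. x \<in> piece C b \<Longrightarrow> \<beta> b (j b x) = j' b (\<xi> b x)"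
    by (rule minimal_injective_hull_unique_iso[OF q(1) finitely_determined_cokernel[OF K(1) M(1) f C K(2) M(2)] _ j j'])
      (rule that; assumption)
  have "\<beta> b (g b x) = g' b (\<theta> b x)" if x: "x \<in> piece M b" for b x
    using \<beta>(2)[OF zn_hom_apply(1)[OF M(1) q(2) x]] jq[OF x] \<xi>(2)[OF x] jq'[OF thin[OF x]] by simp
  then show thesis using that \<beta>(1) by blast
qed

lemma hull_iso_kernel:
  assumes N: "is_zn_module N" and \<eta>: "zn_hom N E \<eta>" "zn_inj N \<eta>" and ex: "exact_at N \<eta> E \<psi>"
  shows "zn_iso N (zn_kernel E \<psi>) \<eta>"
  unfolding zn_iso_def
proof (intro conjI)
  show "zn_hom N (zn_kernel E \<psi>) \<eta>"
    by (rule zn_hom_into_kernel[OF \<eta>(1)]) (use ex in \<open>auto simp: exact_at_def\<close>)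
  show "zn_surj N (zn_kernel E \<psi>) \<eta>" using ex by (simp add: zn_surj_def exact_at_def)
qed (rule \<eta>(2))

lemma minimal_injective_copresentation_exists:
  fixes N :: "('k::field, 'v::ab_group_add, 'n::finite) zn_module"
  assumes N: "is_zn_module N" "finitely_determined N"
  shows "\<exists>(E0 :: ('k, 'n) std_module) E1 \<eta> \<psi>. minimal_injective_copresentation N E0 E1 \<eta> \<psi>"
proof -
  obtain E0 :: "('k, 'n) std_module" and \<eta> where e: "minimal_injective_hull N E0 \<eta>"
    using minimal_injective_hull_exists[OF N] by blast
  note eD = minimal_injective_hullD[OF e]
  obtain \<psi> and E1 :: "('k, 'n) std_module" where g: "minimal_hull_of_cokernel N \<eta> E0 \<psi> E1"
    using hull_of_cokernel_exists[OF N eD(1,5,2)] by blast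
  note gD = hull_of_cokernelD[OF eD(1) g]
  have "minimal_injective_copresentation N E0 E1 \<eta> \<psi>"
    unfolding minimal_injective_copresentation_def finite_injective_copresentation_def
    using e g eD(4) gD(2,4) hull_iso_kernel[OF N(1) eD(2,3) gD(5)] by blast
  then show ?thesis by blast
qed

lemma finitely_determined_of_kernel:
  assumes N: "is_zn_module N" and E: "finite_injective E0" "finite_injective E1" "zn_hom E0 E1 \<psi>"
    and \<eta>: "zn_iso N (zn_kernel E0 \<psi>) \<eta>"
  shows "finitely_determined N"
proof -
  have m: "is_zn_module E0" "is_zn_module E1" "finitely_determined E0" "finitely_determined E1"
    using E(1,2) finitely_determined_injective by (auto simp: finite_injective_def injective_summands_def)
  obtain \<theta> where "zn_iso (zn_kernel E0 \<psi>) N \<theta>" using zn_iso_sym[OF N \<eta>] by blast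
  then show ?thesis
    using finitely_determined_iso[OF zn_module_kernel[OF m(1,2) E(3)] N] finitely_determined_kernel[OF m(1,2) E(3) m(3,4)] by blast
qed

lemma finitely_determined_of_injective_copresentation:
  assumes N: "is_zn_module N" and "finite_injective_copresentation N E0 E1 \<eta> \<psi>"
  shows "finitely_determined N"
  using assms(2) finitely_determined_of_kernel[OF N] unfolding finite_injective_copresentation_def by metis

lemma finitely_determined_of_injective_resolution:
  assumes N: "is_zn_module N" and E: "finite_injective_resolution N E d \<eta>"
  shows "finitely_determined N"
proof (rule finitely_determined_of_kernel[OF N])
  show "finite_injective (E 0)" "finite_injective (E (Suc 0))" "zn_hom (E 0) (E (Suc 0)) (d 0)"
    "zn_iso N (zn_kernel (E 0) (d 0)) \<eta>"
    using E unfolding finite_injective_resolution_def finite_injective_def by blast+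
qed

lemma minimal_injective_copresentation_unique:
  fixes N :: "('k::field, 'v::ab_group_add, 'n::finite) zn_module"
    and E0 :: "('k, 'e::ab_group_add, 'n) zn_module" and E0' :: "('k, 'h::ab_group_add, 'n) zn_module"
  assumes N: "is_zn_module N" and p: "minimal_injective_copresentation N E0 E1 \<eta> \<psi>"
    and p': "minimal_injective_copresentation N E0' E1' \<eta>' \<psi>'"
  shows "injective_copresentation_isomorphic N E0 E1 \<eta> \<psi> E0' E1' \<eta>' \<psi>'"
proof -
  have fd: "finitely_determined N"
    using p finitely_determined_of_injective_copresentation[OF N] unfolding minimal_injective_copresentation_def by blast
  have e: "minimal_injective_hull N E0 \<eta>" "minimal_hull_of_cokernel N \<eta> E0 \<psi> E1"
    and e': "minimal_injective_hull N E0' \<eta>'" "minimal_hull_of_cokernel N \<eta>' E0' \<psi>' E1'"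
    using p p' unfolding minimal_injective_copresentation_def by blast+
  note eD = minimal_injective_hullD[OF e(1)] and eD' = minimal_injective_hullD[OF e'(1)]
  obtain \<beta> where \<beta>: "zn_iso E0 E0' \<beta>" "\<And>b x. x \<in> piece N b \<Longrightarrow> \<beta> b (\<eta> b x) = \<eta>' b x"
    by (rule minimal_injective_hull_unique[OF N fd e(1) e'(1)]) (rule that; assumption)
  have im: "\<beta> b ` \<eta> b ` piece N b = \<eta>' b ` piece N b" for b
    unfolding image_image using \<beta>(2) by (rule image_cong[OF refl])
  obtain \<beta>1 where \<beta>1: "zn_iso E1 E1' \<beta>1" "\<And>b x. x \<in> piece E0 b \<Longrightarrow> \<beta>1 b (\<psi> b x) = \<psi>' b (\<beta> b x)"
    by (rule hull_of_cokernel_unique[OF N fd eD(1,5,2) eD'(1) \<beta>(1) im e(2) e'(2)]) (rule that; assumption)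
  show ?thesis
    unfolding injective_copresentation_isomorphic_def
    by (intro exI[of _ \<beta>] exI[of _ \<beta>1] conjI allI ballI \<beta> \<beta>1)
qed

context
  fixes N :: "('k::field, 'v::ab_group_add, 'n::finite) zn_module"
    and E :: "nat \<Rightarrow> ('k, 'e::ab_group_add, 'n) zn_module"
    and \<eta> :: "int ^ 'n \<Rightarrow> 'v \<Rightarrow> 'e" and d :: "nat \<Rightarrow> int ^ 'n \<Rightarrow> 'e \<Rightarrow> 'e"
  assumes N: "is_zn_module N" "finitely_determined N"
    and hull: "minimal_injective_hull N (E 0) \<eta>"
    and hull0: "minimal_hull_of_cokernel N \<eta> (E 0) (d 0) (E 1)"
    and hullS: "\<And>i. minimal_hull_of_cokernel (E i) (d i) (E (Suc i)) (d (Suc i)) (E (Suc (Suc i)))"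
begin

lemma injective_resolution_term:
  "is_zn_module (E i) \<and> finite_injective (E i) \<and> finitely_determined (E i) \<and> zn_hom (E i) (E (Suc i)) (d i)"
proof (induction i)
  case 0
  note eD = minimal_injective_hullD[OF hull]
  show ?case using eD hull_of_cokernelD(4)[OF eD(1) hull0] by simp
next
  case (Suc i)
  have m: "is_zn_module (E (Suc i)) \<and> finite_injective (E (Suc i)) \<and> finitely_determined (E (Suc i))"
  proof (cases i)
    case 0
    then show ?thesis using hull_of_cokernelD(1-3)[OF minimal_injective_hullD(1)[OF hull] hull0] by simp
  next
    case (Suc k)
    then show ?thesis using hull_of_cokernelD(1-3)[OF _ hullS[of k]] \<open>is_zn_module (E i) \<and> _\<close> by simp
  qed
  then show ?case using hull_of_cokernelD(4)[OF _ hullS[of i]] by blast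
qed

lemma injective_resolution_exact: "exact_at (E i) (d i) (E (Suc i)) (d (Suc i))"
  using hull_of_cokernelD(5)[OF _ hullS] injective_resolution_term by blast

text \<open>The dual terms and differentials satisfy the hypotheses of the flat vanishing lemma, and
  a finite-dimensional component with zero dual is zero because evaluation is injective.\<close>

lemma minimal_injective_resolution_vanishing:
  assumes k: "CARD('n) < k"
  shows "zero_module (E k)"
proof -
  let ?F = "\<lambda>i. zn_dual (E i)" and ?\<epsilon> = "zn_dual_map N \<eta>" and ?d = "\<lambda>i. zn_dual_map (E i) (d i)"
  note t = injective_resolution_term
  note eD = minimal_injective_hullD[OF hull]
  note p0 = minimal_flat_coverD[OF minimal_flat_cover_dual[OF N hull]]
  have cover: "minimal_flat_cover (syzygy ?F ?\<epsilon> ?d i) (?F (Suc i)) (?d i)" for i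
  proof (cases i)
    case 0
    then show ?thesis
      using minimal_flat_cover_dual_cokernel[OF N eD(1,5,2) hull0] by simp
  next
    case (Suc j)
    then show ?thesis
      using minimal_flat_cover_dual_cokernel[OF _ _ _ _ _ hullS[of j]] t[of j] t[of "Suc j"] by simp
  qed
  have "zero_module (?F k)"
    by (rule minimal_flat_resolution_vanishing[OF zn_module_dual[OF N(1)] finitely_determined_dual[OF N] p0(4,2) cover k])
  moreover have m: "is_zn_module (E k)" using t by blast
  ultimately have z: "dual_space (scl (E k)) (piece (E k) b) = {0}" for b
    unfolding zero_module_def zn_dual_simps by (metis minus_minus)
  have "x = 0" if x: "x \<in> piece (E k) b" for b x
  proof -
    have "evaluation (E k) b x = evaluation (E k) b 0"
      unfolding evaluation_def z by (auto simp: fun_eq_iff)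
    then show ?thesis
      using zn_isoD(3)[OF zn_iso_evaluation[OF m] x zn_piece(1)[OF m]] t[of k] by (simp add: finitely_determined_def)
  qed
  then show ?thesis unfolding zero_module_def using zn_piece(1)[OF m] by blast
qed

end

lemma minimal_injective_resolutionD:
  assumes N: "is_zn_module N" and p: "minimal_injective_resolution N E d \<eta>"
  shows "finitely_determined N" "minimal_injective_hull N (E 0) \<eta>" "minimal_hull_of_cokernel N \<eta> (E 0) (d 0) (E 1)"
    "minimal_hull_of_cokernel (E i) (d i) (E (Suc i)) (d (Suc i)) (E (Suc (Suc i)))"
  using p finitely_determined_of_injective_resolution[OF N] unfolding minimal_injective_resolution_def by blast+

lemma injective_summands_zero:
  fixes E :: "('k::field, 'e::ab_group_add, 'n::finite) zn_module"
  assumes "is_zn_module E" "zero_module E"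
  shows "injective_summands E 0"
proof -
  have "zn_iso E (direct_sum 0 (\<lambda>i. indicator_module (injective_region 0 {}) :: ('k, 'k, 'n) zn_module)) (\<lambda>b x. 0)"
    using assms(2) by (intro zn_isoI zn_homI) (auto simp: zero_module_def bij_betw_def fun_eq_iff)
  then show ?thesis unfolding injective_summands_def zn_isomorphic_def using assms(1)
    by (intro conjI exI[of _ "\<lambda>_. 0"] exI[of _ "\<lambda>_. {}"] exI[of _ "\<lambda>b x. 0"])
qed

lemma minimal_injective_resolution_exists:
  fixes N :: "('k::field, 'v::ab_group_add, 'n::finite) zn_module"
  assumes N: "is_zn_module N" "finitely_determined N"
  shows "\<exists>(E :: nat \<Rightarrow> ('k, 'n) std_module) d \<eta>. minimal_injective_resolution N E d \<eta>"
proof -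
  obtain E0 :: "('k, 'n) std_module" and \<eta> where e: "minimal_injective_hull N E0 \<eta>"
    using minimal_injective_hull_exists[OF N] by blast
  note eD = minimal_injective_hullD[OF e]
  obtain d0 and E1 :: "('k, 'n) std_module" where g: "minimal_hull_of_cokernel N \<eta> E0 d0 E1"
    using hull_of_cokernel_exists[OF N eD(1,5,2)] by blast
  note gD = hull_of_cokernelD[OF eD(1) g]
  \<comment> \<open>A state is a differential with its source and target: the next hull is taken
    over a cokernel, so the previous term has to be remembered.\<close>
  let ?P = "\<lambda>n s. case s of (A :: ('k, 'n) std_module, f, B :: ('k, 'n) std_module) \<Rightarrow>
    (n = (0::nat) \<longrightarrow> s = (E0, d0, E1)) \<and> is_zn_module A \<and> finitely_determined A \<and>
    is_zn_module B \<and> finitely_determined B \<and> zn_hom A B f"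
  let ?Q = "\<lambda>(n::nat) s s'. case s of (A :: ('k, 'n) std_module, f, B :: ('k, 'n) std_module) \<Rightarrow>
    fst s' = B \<and> minimal_hull_of_cokernel A f B (fst (snd s')) (snd (snd s') :: ('k, 'n) std_module)"
  have "\<exists>s. \<forall>n. ?P n (s n) \<and> ?Q n (s n) (s (Suc n))"
  proof (rule dependent_nat_choice)
    show "\<exists>s. ?P 0 s" using eD(1,5) gD(1,3,4) by (intro exI[of _ "(E0, d0, E1)"]) simp
  next
    fix s n assume s: "?P n s"
    obtain A f B where sp: "s = (A, f, B)" by (cases s) auto
    have m: "is_zn_module A" "finitely_determined A" "is_zn_module B" "finitely_determined B" "zn_hom A B f"
      using s sp by auto
    obtain g and D :: "('k, 'n) std_module" where g: "minimal_hull_of_cokernel A f B g D"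
      using hull_of_cokernel_exists[OF m] by blast
    then show "\<exists>s'. ?P (Suc n) s' \<and> ?Q n s s'"
      using sp m(3,4) hull_of_cokernelD[OF m(3) g] by (intro exI[of _ "(B, g, D)"]) simp
  qed
  then obtain s where s': "\<forall>n. ?P n (s n) \<and> ?Q n (s n) (s (Suc n))" ..
  note s = conjunct1[OF spec[OF s']] conjunct2[OF spec[OF s']]
  define E where "E n = fst (s n)" for n
  define d where "d n = fst (snd (s n))" for n
  have s0: "s 0 = (E0, d0, E1)" using s(1)[of 0] by (auto split: prod.splits)
  have sn: "snd (snd (s n)) = E (Suc n)" for n using s(2)[of n] by (auto simp: E_def split: prod.splits)
  have E0: "E 0 = E0" "d 0 = d0" "E 1 = E1" using s0 sn[of 0] by (simp_all add: E_def d_def)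
  have hull: "minimal_injective_hull N (E 0) \<eta>" and hull0: "minimal_hull_of_cokernel N \<eta> (E 0) (d 0) (E 1)"
    using e g E0 by simp_all
  have hullS: "minimal_hull_of_cokernel (E i) (d i) (E (Suc i)) (d (Suc i)) (E (Suc (Suc i)))" for i
    using s(2)[of i] sn[of "Suc i"] sn[of i] by (auto simp: E_def d_def split: prod.splits)
  note t = injective_resolution_term[OF N hull hull0 hullS]
  have "\<exists>m. injective_summands (E i) m \<and> (CARD('n) < i \<longrightarrow> m = 0)" for i
    using t[of i] minimal_injective_resolution_vanishing[OF N hull hull0 hullS, of i] injective_summands_zero[of "E i"]
    unfolding finite_injective_def by (cases "CARD('n) < i") auto
  then obtain m where m: "\<And>i. injective_summands (E i) (m i)" "\<And>i. CARD('n) < i \<Longrightarrow> m i = 0" by metis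
  have "{i. m i \<noteq> 0} \<subseteq> {..CARD('n)}"
  proof
    fix i assume "i \<in> {i. m i \<noteq> 0}"
    then show "i \<in> {..CARD('n)}" using m(2)[of i] by (cases "CARD('n) < i") auto
  qed
  then have "finite {i. m i \<noteq> 0}" by (rule finite_subset) simp
  moreover have "zn_iso N (zn_kernel (E 0) (d 0)) \<eta>"
    using hull_iso_kernel[OF N(1) eD(2,3) gD(5)] E0 by simp
  moreover have "zn_hom (E i) (E (Suc i)) (d i)" for i using t by blast
  ultimately have "finite_injective_resolution N E d \<eta>"
    unfolding finite_injective_resolution_def
    using m(1) injective_resolution_exact[OF N hull hull0 hullS] by (intro conjI allI exI[of _ m])
  then have "minimal_injective_resolution N E d \<eta>"
    unfolding minimal_injective_resolution_def using hull hull0 hullS by (intro conjI allI)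
  then show ?thesis by blast
qed

lemma minimal_injective_resolution_unique:
  fixes N :: "('k::field, 'v::ab_group_add, 'n::finite) zn_module"
    and E :: "nat \<Rightarrow> ('k, 'e::ab_group_add, 'n) zn_module" and E' :: "nat \<Rightarrow> ('k, 'h::ab_group_add, 'n) zn_module"
  assumes N: "is_zn_module N" and p: "minimal_injective_resolution N E d \<eta>" and p': "minimal_injective_resolution N E' d' \<eta>'"
  shows "injective_resolution_isomorphic N E d \<eta> E' d' \<eta>'"
proof -
  note r = minimal_injective_resolutionD[OF N p] and r' = minimal_injective_resolutionD[OF N p']
  note t = injective_resolution_term[OF N r] and t' = injective_resolution_term[OF N r']
  \<comment> \<open>This is the submodule of \<open>E n\<close> that is divided out before the next
    hull. The induction carries along that the isomorphisms match these submodules, which is what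
    \<open>hull_of_cokernel_unique\<close> asks for.\<close>
  define im where "im n b = (case n of 0 \<Rightarrow> \<eta> b ` piece N b | Suc k \<Rightarrow> d k b ` piece (E k) b)" for n b
  define im' where "im' n b = (case n of 0 \<Rightarrow> \<eta>' b ` piece N b | Suc k \<Rightarrow> d' k b ` piece (E' k) b)" for n b
  let ?P = "\<lambda>n \<beta>. zn_iso (E n) (E' n) \<beta> \<and> (\<forall>b. \<beta> b ` im n b = im' n b) \<and>
    (n = 0 \<longrightarrow> (\<forall>b. \<forall>x\<in>piece N b. \<beta> b (\<eta> b x) = \<eta>' b x))"
  let ?Q = "\<lambda>n \<beta> \<beta>'. \<forall>b. \<forall>x\<in>piece (E n) b. \<beta>' b (d n b x) = d' n b (\<beta> b x)"
  have "\<exists>\<beta>. \<forall>n. ?P n (\<beta> n) \<and> ?Q n (\<beta> n) (\<beta> (Suc n))"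
  proof (rule dependent_nat_choice)
    obtain \<beta> where \<beta>: "zn_iso (E 0) (E' 0) \<beta>" "\<And>b x. x \<in> piece N b \<Longrightarrow> \<beta> b (\<eta> b x) = \<eta>' b x"
      by (rule minimal_injective_hull_unique[OF N r(1,2) r'(2)]) (rule that; assumption)
    have "\<beta> b ` im 0 b = im' 0 b" for b
      unfolding im_def im'_def nat.case image_image using \<beta>(2) by (rule image_cong[OF refl])
    then show "\<exists>\<beta>. ?P 0 \<beta>" using \<beta> by blast
  next
    fix \<beta> n assume "?P n \<beta>"
    then have \<beta>: "zn_iso (E n) (E' n) \<beta>" "\<And>b. \<beta> b ` im n b = im' n b" by auto
    have "\<exists>\<beta>'. zn_iso (E (Suc n)) (E' (Suc n)) \<beta>' \<and> ?Q n \<beta> \<beta>'"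
    proof (cases n)
      case 0
      note eD = minimal_injective_hullD[OF r(2)] and eD' = minimal_injective_hullD[OF r'(2)]
      have im0: "\<beta> b ` \<eta> b ` piece N b = \<eta>' b ` piece N b" for b
        using \<beta>(2)[of b] 0 by (simp add: im_def im'_def)
      obtain \<beta>' where "zn_iso (E 1) (E' 1) \<beta>'" "\<And>b x. x \<in> piece (E 0) b \<Longrightarrow> \<beta>' b (d 0 b x) = d' 0 b (\<beta> b x)"
        by (rule hull_of_cokernel_unique[OF N r(1) eD(1,5,2) eD'(1) \<beta>(1)[unfolded 0] im0 r(3) r'(3)])
          (rule that; assumption)
      then show ?thesis using 0 by (intro exI[of _ \<beta>']) simp
    next
      case (Suc k)
      have imS: "\<beta> b ` d k b ` piece (E k) b = d' k b ` piece (E' k) b" for b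
        using \<beta>(2)[of b] Suc by (simp add: im_def im'_def)
      have m: "is_zn_module (E k)" "finitely_determined (E k)" "is_zn_module (E (Suc k))"
        "finitely_determined (E (Suc k))" "zn_hom (E k) (E (Suc k)) (d k)" "is_zn_module (E' (Suc k))"
        using t[of k] t[of "Suc k"] t'[of "Suc k"] by auto
      obtain \<beta>' where "zn_iso (E (Suc (Suc k))) (E' (Suc (Suc k))) \<beta>'"
        "\<And>b x. x \<in> piece (E (Suc k)) b \<Longrightarrow> \<beta>' b (d (Suc k) b x) = d' (Suc k) b (\<beta> b x)"
        by (rule hull_of_cokernel_unique[OF m \<beta>(1)[unfolded Suc] imS r(4) r'(4)]) (rule that; assumption)
      then show ?thesis using Suc by (intro exI[of _ \<beta>']) simp
    qed
    then obtain \<beta>' where \<beta>': "zn_iso (E (Suc n)) (E' (Suc n)) \<beta>'" "?Q n \<beta> \<beta>'" by blast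
    have "\<beta>' b ` im (Suc n) b = im' (Suc n) b" for b
    proof -
      have "\<beta>' b ` d n b ` piece (E n) b = d' n b ` \<beta> b ` piece (E n) b"
        unfolding image_image using \<beta>'(2) by (intro image_cong) auto
      also have "\<beta> b ` piece (E n) b = piece (E' n) b" using zn_isoD(2)[OF \<beta>(1), of b] by (simp add: bij_betw_def)
      finally show ?thesis by (simp add: im_def im'_def)
    qed
    then show "\<exists>\<beta>'. ?P (Suc n) \<beta>' \<and> ?Q n \<beta> \<beta>'" using \<beta>' by (intro exI[of _ \<beta>']) simp
  qed
  then obtain \<beta> where \<beta>: "\<forall>n. ?P n (\<beta> n) \<and> ?Q n (\<beta> n) (\<beta> (Suc n))" ..
  show ?thesis
    unfolding injective_resolution_isomorphic_def
    by (rule exI[of _ \<beta>]) (use \<beta> in auto)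
qed

lemma minimal_injective_resolution_length:
  fixes E :: "nat \<Rightarrow> ('k::field, 'e::ab_group_add, 'n::finite) zn_module"
  assumes N: "is_zn_module N" and p: "minimal_injective_resolution N E d \<eta>"
  shows "length_at_most E CARD('n)"
  using minimal_injective_resolution_vanishing[OF N minimal_injective_resolutionD[OF N p]]
  by (intro length_at_mostI)

section \<open>Flange presentations as a cover followed by a hull\<close>

lemma flange_of_cover_hull:
  assumes N: "is_zn_module N" and p: "flat_cover N F p" and j: "injective_hull N E j"
  shows "finite_flange_presentation N F E (\<lambda>b x. j b (p b x))"
proof -
  have p1: "finite_flat F" "zn_hom F N p" "zn_surj F N p" and j1: "finite_injective E" "zn_hom N E j" "zn_inj N j"
    using p j by (simp_all add: flat_cover_def injective_hull_def)
  let ?\<phi> = "\<lambda>b x. j b (p b x)"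
  \<comment> \<open>As \<open>p\<close> is surjective, the image of the composite is the copy of
    \<open>N\<close> embedded by \<open>j\<close>.\<close>
  have im: "?\<phi> b ` piece F b = j b ` piece N b" for b
    using p1(3) unfolding zn_surj_def by (metis image_image)
  have "zn_iso N (zn_image F E ?\<phi>) j"
  proof (rule zn_isoI)
    show "zn_hom N (zn_image F E ?\<phi>) j"
      using j1(2) by (simp add: zn_hom_def linear_between_def im)
    show "bij_betw (j b) (piece N b) (piece (zn_image F E ?\<phi>) b)" for b
      using j1(3) by (simp add: im zn_inj_def bij_betw_def)
  qed
  then have "zn_isomorphic (zn_image F E ?\<phi>) N"
    using zn_isomorphic_sym[OF N] unfolding zn_isomorphic_def by blast
  then show ?thesis
    unfolding finite_flange_presentation_def using p1(1) j1(1) zn_hom_comp[OF p1(2) j1(2)] by blast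
qed

text \<open>Split the morphism through its image. The identification of the image with
  \<open>N\<close> turns the surjection onto the image into a cover and the inclusion of the image
  into a hull.\<close>

lemma flangeE:
  assumes N: "is_zn_module N" and \<phi>: "finite_flange_presentation N F E \<phi>"
  obtains p j where "flat_cover N F p" "injective_hull N E j" "\<And>b x. x \<in> piece F b \<Longrightarrow> \<phi> b x = j b (p b x)"
proof -
  have h: "finite_flat F" "finite_injective E" "zn_hom F E \<phi>" and "zn_isomorphic (zn_image F E \<phi>) N"
    using \<phi> by (simp_all add: finite_flange_presentation_def)
  then obtain f where f: "zn_iso (zn_image F E \<phi>) N f" unfolding zn_isomorphic_def by blast
  have m: "is_zn_module F" "is_zn_module E"
    using h by (auto simp: finite_flat_def flat_summands_def finite_injective_def injective_summands_def)
  let ?I = "zn_image F E \<phi>"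
  have I: "is_zn_module ?I" by (rule zn_module_image[OF m h(3)])
  obtain g where g: "zn_iso N ?I g" "\<And>b x. x \<in> piece ?I b \<Longrightarrow> g b (f b x) = x" "\<And>b y. y \<in> piece N b \<Longrightarrow> f b (g b y) = y"
    by (rule zn_iso_inverse[OF I f]) (rule that; assumption)
  have hI: "zn_hom F ?I \<phi>" using h(3) by (simp add: zn_hom_def linear_between_def)
  have "zn_surj F ?I \<phi>" by (simp add: zn_surj_def)
  then have "flat_cover N F (\<lambda>b x. f b (\<phi> b x))"
    unfolding flat_cover_def
    using h(1) zn_hom_comp[OF hI zn_isoD(1)[OF f]] zn_surj_comp[of F ?I \<phi> N f] f by (simp add: zn_iso_def)
  moreover have "injective_hull N E g"
    unfolding injective_hull_def
  proof (intro conjI h(2))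
    show "zn_inj N g" using g(1) by (simp add: zn_iso_def)
    show "zn_hom N E g"
    proof (rule zn_homI)
      note gh = zn_hom_apply[OF N zn_isoD(1)[OF g(1)]]
      show "g b x \<in> piece E b" if "x \<in> piece N b" for b x
        using gh(1)[OF that] zn_hom_apply(1)[OF m(1) h(3)] by auto
      show "g b (x + y) = g b x + g b y" if "x \<in> piece N b" "y \<in> piece N b" for b x y by (rule gh(2)[OF that])
      show "g b (scl N a x) = scl E a (g b x)" if "x \<in> piece N b" for b x a using gh(4)[OF that] by simp
      show "g c (str N b c x) = str E b c (g b x)" if "b \<le> c" "x \<in> piece N b" for b c x
        using hom_nat[OF zn_isoD(1)[OF g(1)] that] by simp
    qed
  qed
  moreover have "\<phi> b x = g b (f b (\<phi> b x))" if "x \<in> piece F b" for b x using g(2)[of "\<phi> b x" b] that by simp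
  ultimately show thesis by (rule that)
qed

lemma finitely_determined_of_flange:
  assumes N: "is_zn_module N" and \<phi>: "finite_flange_presentation N F E \<phi>"
  shows "finitely_determined N"
proof -
  have h: "zn_hom F E \<phi>" "zn_isomorphic (zn_image F E \<phi>) N"
    using \<phi> by (simp_all add: finite_flange_presentation_def)
  obtain k l where "flat_summands F k" "injective_summands E l"
    using \<phi> unfolding finite_flange_presentation_def finite_flat_def finite_injective_def by blast
  then have m: "is_zn_module F" "is_zn_module E" "finitely_determined F" "finitely_determined E"
    by (simp_all add: finitely_determined_flat finitely_determined_injective)
      (simp_all add: flat_summands_def injective_summands_def)
  show ?thesis
    using finitely_determined_iso[OF zn_module_image[OF m(1,2) h(1)] N _ finitely_determined_image[OF m(1,2) h(1) m(3,4)]] h(2)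
    unfolding zn_isomorphic_def by blast
qed

text \<open>The two counts can be minimised simultaneously because every flange presentation splits
  into a cover and a hull, and any cover can be combined with any hull.\<close>

lemma minimal_flange_presentation_exists:
  fixes N :: "('k::field, 'v::ab_group_add, 'n::finite) zn_module"
  assumes N: "is_zn_module N" "finitely_determined N"
  shows "\<exists>(F :: ('k, 'n) std_module) (E :: ('k, 'n) std_module) \<phi>. minimal_flange_presentation N F E \<phi>"
proof -
  obtain F :: "('k, 'n) std_module" and p where p: "minimal_flat_cover N F p" using minimal_flat_cover_exists[OF N] by blast
  obtain E :: "('k, 'n) std_module" and j where j: "minimal_injective_hull N E j" using minimal_injective_hull_exists[OF N] by blast
  obtain m where m: "flat_summands F m" "flat_cover_bound N m" using p unfolding minimal_flat_cover_iff by blast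
  obtain e where e: "injective_summands E e"
    "\<And>(E' :: ('k, 'n) std_module) j' m'. injective_hull N E' j' \<Longrightarrow> injective_summands E' m' \<Longrightarrow> e \<le> m'"
    using j unfolding minimal_injective_hull_def by blast
  have "finite_flange_presentation N F E (\<lambda>b x. j b (p b x))"
    using flange_of_cover_hull[OF N(1)] p j unfolding minimal_flat_cover_def minimal_injective_hull_def by blast
  moreover have "m \<le> m' \<and> e \<le> e'"
    if f': "finite_flange_presentation N F' E' \<phi>'" and s': "flat_summands F' m'" "injective_summands E' e'"
    for F' E' :: "('k, 'n) std_module" and \<phi>' m' e'
  proof -
    obtain p' j' where "flat_cover N F' p'" "injective_hull N E' j'"
      "\<And>b x. x \<in> piece F' b \<Longrightarrow> \<phi>' b x = j' b (p' b x)"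
      by (rule flangeE[OF N(1) f']) (rule that; assumption)
    then show ?thesis using m(2) e(2) s' unfolding flat_cover_bound_def by blast
  qed
  ultimately show ?thesis unfolding minimal_flange_presentation_def using m(1) e(1) by blast
qed

text \<open>To see that one factor is minimal, combine an arbitrary competitor for it with a fixed
  object on the other side: the simultaneous bound then yields the bound for that factor
  alone.\<close>

lemma minimal_flangeE:
  fixes N :: "('k::field, 'v::ab_group_add, 'n::finite) zn_module"
  assumes N: "is_zn_module N" and \<phi>: "minimal_flange_presentation N F E \<phi>"
  obtains p j where "minimal_flat_cover N F p" "minimal_injective_hull N E j"
    "\<And>b x. x \<in> piece F b \<Longrightarrow> \<phi> b x = j b (p b x)"
proof -
  have f: "finite_flange_presentation N F E \<phi>" using \<phi> by (simp add: minimal_flange_presentation_def)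
  have fd: "finitely_determined N" by (rule finitely_determined_of_flange[OF N f])
  obtain p j where pj: "flat_cover N F p" "injective_hull N E j" "\<And>b x. x \<in> piece F b \<Longrightarrow> \<phi> b x = j b (p b x)"
    by (rule flangeE[OF N f]) (rule that; assumption)
  obtain m e where me: "flat_summands F m" "injective_summands E e"
    and min: "\<And>(F' :: ('k, 'n) std_module) (E' :: ('k, 'n) std_module) \<phi>' m' p'.
      finite_flange_presentation N F' E' \<phi>' \<Longrightarrow> flat_summands F' m' \<Longrightarrow> injective_summands E' p' \<Longrightarrow> m \<le> m' \<and> e \<le> p'"
    using \<phi> unfolding minimal_flange_presentation_def by blast
  obtain F0 :: "('k, 'n) std_module" and p0 where p0: "minimal_flat_cover N F0 p0"
    using minimal_flat_cover_exists[OF N fd] by blast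
  obtain E0 :: "('k, 'n) std_module" and j0 where j0: "minimal_injective_hull N E0 j0"
    using minimal_injective_hull_exists[OF N fd] by blast
  obtain m0 e0 where m0: "flat_summands F0 m0" and e0: "injective_summands E0 e0"
    using p0 j0 unfolding minimal_flat_cover_def minimal_injective_hull_def by blast
  have p0': "flat_cover N F0 p0" and j0': "injective_hull N E0 j0"
    using p0 j0 by (simp_all add: minimal_flat_cover_def minimal_injective_hull_def)
  have "m \<le> m'" if "flat_cover N F' p'" "flat_summands F' m'" for F' :: "('k, 'n) std_module" and p' m'
    using min[OF flange_of_cover_hull[OF N that(1) j0'] that(2) e0] by simp
  then have "minimal_flat_cover N F p" unfolding minimal_flat_cover_def using pj(1) me(1) by blast
  moreover have "e \<le> e'" if "injective_hull N E' j'" "injective_summands E' e'" for E' :: "('k, 'n) std_module" and j' e'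
    using min[OF flange_of_cover_hull[OF N p0' that(1)] m0 that(2)] by simp
  then have "minimal_injective_hull N E j" unfolding minimal_injective_hull_def using pj(2) me(2) by blast
  ultimately show thesis using pj(3) by (rule that)
qed

lemma minimal_flange_presentation_unique:
  fixes N :: "('k::field, 'v::ab_group_add, 'n::finite) zn_module"
  assumes N: "is_zn_module N" and \<phi>: "minimal_flange_presentation N F E \<phi>" and \<phi>': "minimal_flange_presentation N F' E' \<phi>'"
  shows "flange_isomorphic F E \<phi> F' E' \<phi>'"
proof -
  have fd: "finitely_determined N"
    using finitely_determined_of_flange[OF N] \<phi> unfolding minimal_flange_presentation_def by blast
  obtain p j where pj: "minimal_flat_cover N F p" "minimal_injective_hull N E j"
    "\<And>b x. x \<in> piece F b \<Longrightarrow> \<phi> b x = j b (p b x)"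
    by (rule minimal_flangeE[OF N \<phi>]) (rule that; assumption)
  obtain p' j' where pj': "minimal_flat_cover N F' p'" "minimal_injective_hull N E' j'"
    "\<And>b x. x \<in> piece F' b \<Longrightarrow> \<phi>' b x = j' b (p' b x)"
    by (rule minimal_flangeE[OF N \<phi>']) (rule that; assumption)
  obtain \<alpha> where \<alpha>: "zn_iso F F' \<alpha>" "\<And>b x. x \<in> piece F b \<Longrightarrow> p' b (\<alpha> b x) = p b x"
    by (rule minimal_flat_cover_unique[OF N fd pj(1) pj'(1)]) (rule that; assumption)
  obtain \<beta> where \<beta>: "zn_iso E E' \<beta>" "\<And>b x. x \<in> piece N b \<Longrightarrow> \<beta> b (j b x) = j' b x"
    by (rule minimal_injective_hull_unique[OF N fd pj(2) pj'(2)]) (rule that; assumption)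
  note pD = minimal_flat_coverD[OF pj(1)]
  have "\<beta> b (\<phi> b x) = \<phi>' b (\<alpha> b x)" if x: "x \<in> piece F b" for b x
    using pj(3)[OF x] pj'(3)[OF zn_hom_apply(1)[OF pD(1) zn_isoD(1)[OF \<alpha>(1)] x]] \<alpha>(2)[OF x]
      \<beta>(2)[OF zn_hom_apply(1)[OF pD(1,2) x]] by simp
  then show ?thesis unfolding flange_isomorphic_def using \<alpha>(1) \<beta>(1) by blast
qed

theorem theorem6p19:
  fixes N :: "('k::field, 'v::ab_group_add, 'n::finite) zn_module"
  assumes "is_zn_module N"
  shows
    "(finitely_determined N \<longleftrightarrow>
        (\<exists>(F :: ('k, 'n) std_module) (E :: ('k, 'n) std_module) \<phi>.
           finite_flange_presentation N F E \<phi>)) \<and>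
     (finitely_determined N \<longleftrightarrow>
        (\<exists>(F\<^sub>1 :: ('k, 'n) std_module) F\<^sub>0 \<phi> \<epsilon>. finite_flat_presentation N F\<^sub>1 F\<^sub>0 \<phi> \<epsilon>)) \<and>
     (finitely_determined N \<longleftrightarrow>
        (\<exists>(E\<^sub>0 :: ('k, 'n) std_module) E\<^sub>1 \<eta> \<psi>. finite_injective_copresentation N E\<^sub>0 E\<^sub>1 \<eta> \<psi>)) \<and>
     (finitely_determined N \<longleftrightarrow>
        (\<exists>(F :: nat \<Rightarrow> ('k, 'n) std_module) d \<epsilon>. finite_flat_resolution N F d \<epsilon>)) \<and>
     (finitely_determined N \<longleftrightarrow>
        (\<exists>(E :: nat \<Rightarrow> ('k, 'n) std_module) d \<eta>. finite_injective_resolution N E d \<eta>)) \<and>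

     (finitely_determined N \<longleftrightarrow>
        (\<exists>(F :: ('k, 'n) std_module) (E :: ('k, 'n) std_module) \<phi>.
           minimal_flange_presentation N F E \<phi>)) \<and>
     (finitely_determined N \<longleftrightarrow>
        (\<exists>(F\<^sub>1 :: ('k, 'n) std_module) F\<^sub>0 \<phi> \<epsilon>. minimal_flat_presentation N F\<^sub>1 F\<^sub>0 \<phi> \<epsilon>)) \<and>
     (finitely_determined N \<longleftrightarrow>
        (\<exists>(E\<^sub>0 :: ('k, 'n) std_module) E\<^sub>1 \<eta> \<psi>. minimal_injective_copresentation N E\<^sub>0 E\<^sub>1 \<eta> \<psi>)) \<and>
     (finitely_determined N \<longleftrightarrow>
        (\<exists>(F :: nat \<Rightarrow> ('k, 'n) std_module) d \<epsilon>. minimal_flat_resolution N F d \<epsilon>)) \<and>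
     (finitely_determined N \<longleftrightarrow>
        (\<exists>(E :: nat \<Rightarrow> ('k, 'n) std_module) d \<eta>. minimal_injective_resolution N E d \<eta>)) \<and>

     (\<forall>(F :: ('k, 'f::ab_group_add, 'n) zn_module) (E :: ('k, 'e::ab_group_add, 'n) zn_module) \<phi>
        (F' :: ('k, 'g::ab_group_add, 'n) zn_module) (E' :: ('k, 'h::ab_group_add, 'n) zn_module) \<phi>'.
        minimal_flange_presentation N F E \<phi> \<longrightarrow> minimal_flange_presentation N F' E' \<phi>' \<longrightarrow>
        flange_isomorphic F E \<phi> F' E' \<phi>') \<and>
     (\<forall>(F\<^sub>1 :: ('k, 'f, 'n) zn_module) F\<^sub>0 \<phi> \<epsilon> (F\<^sub>1' :: ('k, 'g, 'n) zn_module) F\<^sub>0' \<phi>' \<epsilon>'.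
        minimal_flat_presentation N F\<^sub>1 F\<^sub>0 \<phi> \<epsilon> \<longrightarrow> minimal_flat_presentation N F\<^sub>1' F\<^sub>0' \<phi>' \<epsilon>' \<longrightarrow>
        flat_presentation_isomorphic F\<^sub>1 F\<^sub>0 \<phi> \<epsilon> F\<^sub>1' F\<^sub>0' \<phi>' \<epsilon>') \<and>
     (\<forall>(E\<^sub>0 :: ('k, 'e, 'n) zn_module) E\<^sub>1 \<eta> \<psi> (E\<^sub>0' :: ('k, 'h, 'n) zn_module) E\<^sub>1' \<eta>' \<psi>'.
        minimal_injective_copresentation N E\<^sub>0 E\<^sub>1 \<eta> \<psi> \<longrightarrow>
        minimal_injective_copresentation N E\<^sub>0' E\<^sub>1' \<eta>' \<psi>' \<longrightarrow>
        injective_copresentation_isomorphic N E\<^sub>0 E\<^sub>1 \<eta> \<psi> E\<^sub>0' E\<^sub>1' \<eta>' \<psi>') \<and>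
     (\<forall>(F :: nat \<Rightarrow> ('k, 'f, 'n) zn_module) d \<epsilon> (F' :: nat \<Rightarrow> ('k, 'g, 'n) zn_module) d' \<epsilon>'.
        minimal_flat_resolution N F d \<epsilon> \<longrightarrow> minimal_flat_resolution N F' d' \<epsilon>' \<longrightarrow>
        flat_resolution_isomorphic F d \<epsilon> F' d' \<epsilon>') \<and>
     (\<forall>(E :: nat \<Rightarrow> ('k, 'e, 'n) zn_module) d \<eta> (E' :: nat \<Rightarrow> ('k, 'h, 'n) zn_module) d' \<eta>'.
        minimal_injective_resolution N E d \<eta> \<longrightarrow> minimal_injective_resolution N E' d' \<eta>' \<longrightarrow>
        injective_resolution_isomorphic N E d \<eta> E' d' \<eta>') \<and>

     (\<forall>(F :: nat \<Rightarrow> ('k, 'f, 'n) zn_module) d \<epsilon>.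
        minimal_flat_resolution N F d \<epsilon> \<longrightarrow> length_at_most F CARD('n)) \<and>
     (\<forall>(E :: nat \<Rightarrow> ('k, 'e, 'n) zn_module) d \<eta>.
        minimal_injective_resolution N E d \<eta> \<longrightarrow> length_at_most E CARD('n))"
proof -
  note N = assms
  have flange: "\<exists>(F :: ('k, 'n) std_module) (E :: ('k, 'n) std_module) \<phi>. minimal_flange_presentation N F E \<phi>"
    if "finitely_determined N" by (rule minimal_flange_presentation_exists[OF N that])
  have flat: "\<exists>(F\<^sub>1 :: ('k, 'n) std_module) F\<^sub>0 \<phi> \<epsilon>. minimal_flat_presentation N F\<^sub>1 F\<^sub>0 \<phi> \<epsilon>"
    if "finitely_determined N" by (rule minimal_flat_presentation_exists[OF N that])
  have inj: "\<exists>(E\<^sub>0 :: ('k, 'n) std_module) E\<^sub>1 \<eta> \<psi>. minimal_injective_copresentation N E\<^sub>0 E\<^sub>1 \<eta> \<psi>"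
    if "finitely_determined N" by (rule minimal_injective_copresentation_exists[OF N that])
  have fres: "\<exists>(F :: nat \<Rightarrow> ('k, 'n) std_module) d \<epsilon>. minimal_flat_resolution N F d \<epsilon>"
    if "finitely_determined N" by (rule minimal_flat_resolution_exists[OF N that])
  have ires: "\<exists>(E :: nat \<Rightarrow> ('k, 'n) std_module) d \<eta>. minimal_injective_resolution N E d \<eta>"
    if "finitely_determined N" by (rule minimal_injective_resolution_exists[OF N that])
  \<comment> \<open>All equivalences close the same circle: a finitely determined module has a
    minimal object, a minimal object is finite, and a finite one forces determinacy.\<close>
  have finite: "minimal_flange_presentation N F E \<phi> \<Longrightarrow> finite_flange_presentation N F E \<phi>"
    "minimal_flat_presentation N F\<^sub>1 F\<^sub>0 \<phi>' \<epsilon> \<Longrightarrow> finite_flat_presentation N F\<^sub>1 F\<^sub>0 \<phi>' \<epsilon>"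
    "minimal_injective_copresentation N E\<^sub>0 E\<^sub>1 \<eta> \<psi> \<Longrightarrow> finite_injective_copresentation N E\<^sub>0 E\<^sub>1 \<eta> \<psi>"
    "minimal_flat_resolution N Fs d \<epsilon> \<Longrightarrow> finite_flat_resolution N Fs d \<epsilon>"
    "minimal_injective_resolution N Es d \<eta> \<Longrightarrow> finite_injective_resolution N Es d \<eta>"
    for F E F\<^sub>1 F\<^sub>0 E\<^sub>0 E\<^sub>1 :: "('k, 'n) std_module" and Fs Es :: "nat \<Rightarrow> ('k, 'n) std_module"
      and \<phi> \<phi>' \<epsilon> \<eta> \<psi> d
    by (simp_all add: minimal_flange_presentation_def minimal_flat_presentation_def
        minimal_injective_copresentation_def minimal_flat_resolution_def minimal_injective_resolution_def)
  note fd = finitely_determined_of_flange[OF N] finitely_determined_of_flat_presentation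
    finitely_determined_of_injective_copresentation[OF N]
    finitely_determined_of_flat_presentation[OF flat_presentation_of_resolution]
    finitely_determined_of_injective_resolution[OF N]
  show ?thesis
    apply (intro conjI allI impI)
    subgoal using flange finite(1) fd(1) by blast
    subgoal using flat finite(2) fd(2) by blast
    subgoal using inj finite(3) fd(3) by blast
    subgoal using fres finite(4) fd(4) by blast
    subgoal using ires finite(5) fd(5) by blast
    subgoal using flange finite(1) fd(1) by blast
    subgoal using flat finite(2) fd(2) by blast
    subgoal using inj finite(3) fd(3) by blast
    subgoal using fres finite(4) fd(4) by blast
    subgoal using ires finite(5) fd(5) by blast
    subgoal by (rule minimal_flange_presentation_unique[OF N])
    subgoal by (rule minimal_flat_presentation_unique[OF N])
    subgoal by (rule minimal_injective_copresentation_unique[OF N])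
    subgoal by (rule minimal_flat_resolution_unique[OF N])
    subgoal by (rule minimal_injective_resolution_unique[OF N])
    subgoal by (rule minimal_flat_resolution_length[OF N])
    subgoal by (rule minimal_injective_resolution_length[OF N])
    done
qed

end
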